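(* Let $n\ge1$, let $q$ be the cardinality of a finite field, and let $\lambda$ be a fixed partition of $n$. Then $$(1-q)(1-q^2)\cdots(1-q^{l(\lambda)-1})=\frac{n}{1-q^{-n}}\sum_{\mu\vdash n}(-1)^{l(\mu)+1}\frac{1}{l(\mu)}\binom{l(\mu)}{m_1(\mu),\dots,m_n(\mu)}(1-q^{-1})^{l(\mu)}f^{\lambda}_{(1)^{m_1(\mu)},\dots,(n)^{m_n(\mu)}},$$ where the sum is over all partitions $\mu=(1^{m_1(\mu)},\dots,n^{m_n(\mu)})$ of $n$, $l(\cdot)$ denotes the length (number of parts), the left side is the empty product $1$ if $l(\lambda)=1$, and $f^{\lambda}_{(1)^{m_1(\mu)},\dots,(n)^{m_n(\mu)}}$ are the Hall numbers defined in the context.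
   Context: Let $k=\mathbb{F}_q$ and consider finite-dimensional nilpotent representations of the Jordan quiver over $k$, i.e. pairs $(V,\rho)$ with $V$ a finite-dimensional $k$-vector space and $\rho$ a nilpotent endomorphism. Let $I_{(r)}$ be the indecomposable one of dimension $r$ (a single nilpotent Jordan block of size $r$), and for a partition $\lambda=(1^{r_1},\dots,n^{r_n})$ let $I_\lambda=I_{(1)}^{\oplus r_1}\oplus\cdots\oplus I_{(n)}^{\oplus r_n}$; these represent all isomorphism classes. The Hall algebra $\mathbf{H}^{nil}_{\hat{A}_0}$ has as basis the isomorphism classes of these representations, also written $I_\lambda$, with multiplication $$[M]\cdot[N]=\sum_{[R]}\frac{\mathbf{P}^R_{M,N}}{a_Ma_N}[R],$$ where $\mathbf{P}^R_{M,N}$ is the number of short exact sequences $0\to N\to R\to M\to0$ and $a_M=|\mathrm{Aut}(M)|$ (the Euler-form factor in the general definition equals $1$ here). The Hall numbers are defined by expanding the product in this algebra: $$I_{(1)}^{m_1(\mu)}\cdots I_{(n)}^{m_n(\mu)}=\sum_{\lambda\vdash n}f^{\lambda}_{(1)^{m_1(\mu)},\dots,(n)^{m_n(\mu)}}I_\lambda,$$ where $I_{(r)}^{m}$ on the left denotes the $m$-th power in the Hall algebra (not a direct sum). *)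

theory Defs
  imports
    "Jordan_Normal_Form.Jordan_Normal_Form"
    "Jordan_Normal_Form.Matrix_Kernel"
    "HOL-Library.Poly_Mapping"
    "HOL-Library.Multiset"
    "HOL-Library.Cardinality"
begin

section \<open>Nilpotent representations of the Jordan quiver\<close>

text \<open>
  A representation \<open>(V, \<rho>)\<close> of dimension \<open>d\<close> is taken on \<open>V = k\<^sup>d\<close>, so that it is
  a nilpotent matrix in \<open>carrier_mat d d\<close>; every finite-dimensional representation is
  isomorphic to one of this form.
\<close>

definition nilpotent_mat :: "'k::field mat \<Rightarrow> bool" where
  "nilpotent_mat A \<longleftrightarrow>
     square_mat A \<and> (\<exists>m. A ^\<^sub>m m = 0\<^sub>m (dim_row A) (dim_row A))"

definition rep_hom :: "'k::field mat \<Rightarrow> 'k mat \<Rightarrow> 'k mat set" where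
  "rep_hom A B = {X \<in> carrier_mat (dim_row B) (dim_row A). X * A = B * X}"

definition rep_iso :: "'k::field mat \<Rightarrow> 'k mat \<Rightarrow> 'k mat set" where
  "rep_iso A B = {X \<in> rep_hom A B. invertible_mat X}"

text \<open>
  The set of short exact sequences \<open>0 \<rightarrow> N \<rightarrow> R \<rightarrow> M \<rightarrow> 0\<close>, as pairs \<open>(\<phi>, \<psi>)\<close> of
  morphisms \<open>\<phi> : N \<rightarrow> R\<close> and \<open>\<psi> : R \<rightarrow> M\<close>.
\<close>

definition short_exact_seqs :: "'k::field mat \<Rightarrow> 'k mat \<Rightarrow> 'k mat \<Rightarrow> ('k mat \<times> 'k mat) set" where
  "short_exact_seqs M N R = {(\<phi>, \<psi>). \<phi> \<in> rep_hom N R \<and> \<psi> \<in> rep_hom R M \<and>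
     inj_on (\<lambda>v. \<phi> *\<^sub>v v) (carrier_vec (dim_row N)) \<and>
     (\<lambda>v. \<psi> *\<^sub>v v) ` carrier_vec (dim_row R) = carrier_vec (dim_row M) \<and>
     (\<lambda>v. \<phi> *\<^sub>v v) ` carrier_vec (dim_row N) = mat_kernel \<psi>}"


section \<open>Well-definedness on isomorphism classes\<close>

lemma nilpotent_mat_square: "nilpotent_mat A \<Longrightarrow> square_mat A"
  by (simp add: nilpotent_mat_def)

lemma rep_isoE:
  assumes "X \<in> rep_iso A B" and "square_mat A" and "square_mat B"
  obtains Y n where "A \<in> carrier_mat n n" "B \<in> carrier_mat n n"
    "X \<in> carrier_mat n n" "Y \<in> carrier_mat n n"
    "X * Y = 1\<^sub>m n" "Y * X = 1\<^sub>m n" "X * A = B * X" "Y * B = A * Y"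
proof -
  define n where "n = dim_row A"
  from assms(1) have X: "X \<in> carrier_mat (dim_row B) n" and comm: "X * A = B * X"
    and inv: "invertible_mat X"
    unfolding rep_iso_def rep_hom_def n_def by blast+
  from inv X have n: "dim_row B = n" by (auto simp: invertible_mat_def)
  have A: "A \<in> carrier_mat n n" and B: "B \<in> carrier_mat n n"
    using assms n by (auto simp: n_def)
  from X n have X': "X \<in> carrier_mat n n" by simp
  from inv obtain Y where XY: "X * Y = 1\<^sub>m n" and YX': "Y * X = 1\<^sub>m (dim_row Y)"
    using X' by (auto simp: invertible_mat_def inverts_mat_def)
  from XY have "dim_col Y = n" by (metis index_mult_mat(3) index_one_mat(3))
  moreover from YX' X' have "dim_row Y = n"
    by (metis carrier_matD(2) index_mult_mat(3) index_one_mat(3))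
  ultimately have Y: "Y \<in> carrier_mat n n" and YX: "Y * X = 1\<^sub>m n" using YX' by auto
  have "Y * B = Y * B * (X * Y)" using XY B Y by simp
  also have "\<dots> = Y * (B * X) * Y" using X' Y B by (simp add: assoc_mult_mat[of _ n n _ n _ n])
  also have "\<dots> = Y * (X * A) * Y" using comm by simp
  also have "\<dots> = (Y * X) * A * Y" using X' Y A by (simp add: assoc_mult_mat[of _ n n _ n _ n])
  also have "\<dots> = A * Y" using YX A by simp
  finally show ?thesis using that A B X' Y XY YX comm by blast
qed

lemma rep_isoI:
  assumes "A \<in> carrier_mat n n" "B \<in> carrier_mat n n"
    "X \<in> carrier_mat n n" "Y \<in> carrier_mat n n"
    "X * Y = 1\<^sub>m n" "Y * X = 1\<^sub>m n" "X * A = B * X"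
  shows "X \<in> rep_iso A B"
proof -
  have "invertible_mat X" using assms(3-6) unfolding invertible_mat_def inverts_mat_def
    by (metis carrier_matD square_mat.simps)
  moreover have "X \<in> rep_hom A B" using assms(1-3,7) unfolding rep_hom_def by simp
  ultimately show ?thesis unfolding rep_iso_def by blast
qed

lemma rep_iso_refl:
  assumes "square_mat A" shows "1\<^sub>m (dim_row A) \<in> rep_iso A A"
proof -
  have A: "A \<in> carrier_mat (dim_row A) (dim_row A)"
    using assms by (intro carrier_matI) simp_all
  show ?thesis
    by (rule rep_isoI[OF A A one_carrier_mat one_carrier_mat])
      (simp_all add: left_mult_one_mat[OF A] right_mult_one_mat[OF A])
qed

lemma rep_iso_sym:
  assumes "rep_iso A B \<noteq> {}" "square_mat A" "square_mat B"
  shows "rep_iso B A \<noteq> {}"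
proof -
  from assms obtain X where "X \<in> rep_iso A B" by blast
  from rep_isoE[OF this assms(2,3)] obtain Y n where "A \<in> carrier_mat n n" "B \<in> carrier_mat n n"
    "X \<in> carrier_mat n n" "Y \<in> carrier_mat n n"
    "X * Y = 1\<^sub>m n" "Y * X = 1\<^sub>m n" "X * A = B * X" "Y * B = A * Y" by metis
  then have "Y \<in> rep_iso B A" by (intro rep_isoI[of _ n _ _ X])
  then show ?thesis by blast
qed

lemma rep_iso_comp:
  assumes "X \<in> rep_iso A B" "X' \<in> rep_iso B C"
    and "square_mat A" "square_mat B" "square_mat C"
  shows "X' * X \<in> rep_iso A C"
proof -
  from rep_isoE[OF assms(1,3,4)] obtain Y n where 1: "A \<in> carrier_mat n n" "B \<in> carrier_mat n n"
    "X \<in> carrier_mat n n" "Y \<in> carrier_mat n n"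
    "X * Y = 1\<^sub>m n" "Y * X = 1\<^sub>m n" "X * A = B * X" by metis
  from rep_isoE[OF assms(2,4,5)] obtain Y' n' where 2: "B \<in> carrier_mat n' n'" "C \<in> carrier_mat n' n'"
    "X' \<in> carrier_mat n' n'" "Y' \<in> carrier_mat n' n'"
    "X' * Y' = 1\<^sub>m n'" "Y' * X' = 1\<^sub>m n'" "X' * B = C * X'" by metis
  have [simp]: "n' = n" using 1(2) 2(1) by auto
  note 2 = 2[simplified]
  note as = assoc_mult_mat[of _ n n _ n _ n]
  have "X' * X * (Y * Y') = X' * (X * Y) * Y'" using 1(3,4) 2(3,4) by (simp add: as)
  then have i1: "X' * X * (Y * Y') = 1\<^sub>m n" using 1 2 by simp
  have "Y * Y' * (X' * X) = Y * (Y' * X') * X" using 1(3,4) 2(3,4) by (simp add: as)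
  then have i2: "Y * Y' * (X' * X) = 1\<^sub>m n" using 1 2 by simp
  have "X' * X * A = X' * (X * A)" using 1 2 by (simp add: as)
  also have "\<dots> = X' * B * X" using 1(2,3) 2(3) by (simp add: 1(7) as)
  also have "\<dots> = C * (X' * X)" using 1(2,3) 2(2,3) by (simp add: 2(7) as)
  finally show ?thesis using 1 2 i1 i2
    by (intro rep_isoI[of _ n _ _ "Y * Y'"]) auto
qed

quotient_type (overloaded) 'k rep_class = "'k::field mat" /
  partial: "\<lambda>A B. nilpotent_mat A \<and> nilpotent_mat B \<and> rep_iso A B \<noteq> {}"
proof (rule part_equivpI)
  show "\<exists>A::'k mat. nilpotent_mat A \<and> nilpotent_mat A \<and> rep_iso A A \<noteq> {}"
    using rep_iso_refl[of "0\<^sub>m 0 0 :: 'k mat"]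
    by (intro exI[of _ "0\<^sub>m 0 0"]) (auto simp: nilpotent_mat_def intro!: exI[of _ 1])
  show "symp (\<lambda>A (B::'k mat). nilpotent_mat A \<and> nilpotent_mat B \<and> rep_iso A B \<noteq> {})"
    by (rule sympI) (metis nilpotent_mat_def rep_iso_sym)
  show "transp (\<lambda>A (B::'k mat). nilpotent_mat A \<and> nilpotent_mat B \<and> rep_iso A B \<noteq> {})"
  proof (rule transpI)
    fix A B C :: "'k mat"
    assume 1: "nilpotent_mat A \<and> nilpotent_mat B \<and> rep_iso A B \<noteq> {}"
      and 2: "nilpotent_mat B \<and> nilpotent_mat C \<and> rep_iso B C \<noteq> {}"
    then obtain X Y where "X \<in> rep_iso A B" "Y \<in> rep_iso B C" by blast
    then have "Y * X \<in> rep_iso A C" using 1 2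
      by (intro rep_iso_comp[of X A B Y C]) (simp_all add: nilpotent_mat_def)
    then show "nilpotent_mat A \<and> nilpotent_mat C \<and> rep_iso A C \<noteq> {}" using 1 2 by blast
  qed
qed

lemma finite_carrier_mat: "finite (carrier_mat nr nc :: 'k::finite mat set)"
proof -
  have "A \<in> mat nr nc ` ({0..<nr} \<times> {0..<nc} \<rightarrow>\<^sub>E UNIV)"
    if "A \<in> carrier_mat nr nc" for A :: "'k mat"
    using that
    by (intro image_eqI[of _ _ "restrict (\<lambda>ij. A $$ ij) ({0..<nr} \<times> {0..<nc})"] eq_matI)
      auto
  then have "carrier_mat nr nc \<subseteq> mat nr nc ` ({0..<nr} \<times> {0..<nc} \<rightarrow>\<^sub>E (UNIV :: 'k set))"
    by blast
  then show ?thesis by (rule finite_subset) (intro finite_imageI finite_PiE; simp)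
qed

lemma carrier_vec_lists: "carrier_vec n = vec_of_list ` {xs :: 'k list. length xs = n}"
proof (intro subset_antisym subsetI)
  fix v :: "'k vec" assume "v \<in> carrier_vec n"
  then have "length (list_of_vec v) = n" by simp
  then show "v \<in> vec_of_list ` {xs. length xs = n}"
    by (intro image_eqI[of _ _ "list_of_vec v"]) (simp_all add: vec_list)
qed (auto intro: carrier_vecI)

lemma card_carrier_vec: "card (carrier_vec n :: 'k::finite vec set) = CARD('k) ^ n"
proof -
  have "inj_on vec_of_list {xs :: 'k list. length xs = n}"
    by (intro inj_onI) (metis list_vec)
  then show ?thesis
    using card_lists_length_eq[of "UNIV :: 'k set" n] by (simp add: carrier_vec_lists card_image)
qed

lemma finite_carrier_vec: "finite (carrier_vec n :: 'k::finite vec set)"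
  using finite_lists_length_eq[of "UNIV :: 'k set" n] by (simp add: carrier_vec_lists)

lemma short_exact_seqsD:
  assumes "(\<phi>, \<psi>) \<in> short_exact_seqs M N R"
  shows "\<phi> \<in> carrier_mat (dim_row R) (dim_row N)" "\<psi> \<in> carrier_mat (dim_row M) (dim_row R)"
    "\<phi> * N = R * \<phi>" "\<psi> * R = M * \<psi>"
    "inj_on (\<lambda>v. \<phi> *\<^sub>v v) (carrier_vec (dim_row N))"
    "(\<lambda>v. \<psi> *\<^sub>v v) ` carrier_vec (dim_row R) = carrier_vec (dim_row M)"
    "(\<lambda>v. \<phi> *\<^sub>v v) ` carrier_vec (dim_row N) = mat_kernel \<psi>"
  using assms unfolding short_exact_seqs_def rep_hom_def mem_Collect_eq prod.case by blast+

lemma short_exact_seqsI: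
  assumes "\<phi> \<in> carrier_mat (dim_row R) (dim_row N)" "\<psi> \<in> carrier_mat (dim_row M) (dim_row R)"
    "\<phi> * N = R * \<phi>" "\<psi> * R = M * \<psi>"
    "inj_on (\<lambda>v. \<phi> *\<^sub>v v) (carrier_vec (dim_row N))"
    "(\<lambda>v. \<psi> *\<^sub>v v) ` carrier_vec (dim_row R) = carrier_vec (dim_row M)"
    "(\<lambda>v. \<phi> *\<^sub>v v) ` carrier_vec (dim_row N) = mat_kernel \<psi>"
  shows "(\<phi>, \<psi>) \<in> short_exact_seqs M N R"
  using assms unfolding short_exact_seqs_def rep_hom_def mem_Collect_eq prod.case by blast

lemma finite_short_exact_seqs: "finite (short_exact_seqs M N R :: ('k::{field,finite} mat \<times> _) set)"
proof (rule finite_subset)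
  show "short_exact_seqs M N R \<subseteq>
    carrier_mat (dim_row R) (dim_row N) \<times> carrier_mat (dim_row M) (dim_row R)"
    by (intro subrelI SigmaI; erule short_exact_seqsD)
qed (simp add: finite_carrier_mat)

lemma mat_zero_vec:
  "X \<in> carrier_mat nr nc \<Longrightarrow> X *\<^sub>v 0\<^sub>v nc = (0\<^sub>v nr :: 'k::field vec)"
  by (intro eq_vecI) auto

lemma conj_cancel_mat:
  fixes x :: "'k::field mat"
  assumes P: "P' \<in> carrier_mat r r" "P \<in> carrier_mat r r" and x: "x \<in> carrier_mat r n"
    and Q: "Q' \<in> carrier_mat n n" "Q \<in> carrier_mat n n"
    and inv: "P' * P = 1\<^sub>m r" "Q' * Q = 1\<^sub>m n"
  shows "P' * (P * x * Q') * Q = x"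
proof -
  have Px: "P * x \<in> carrier_mat r n" using P x by simp
  have "P' * (P * x * Q') * Q = P' * (P * x * Q' * Q)"
    using P(1) mult_carrier_mat[OF Px Q(1)] Q(2) by (rule assoc_mult_mat)
  also have "P * x * Q' * Q = P * x * (Q' * Q)" using Px Q by (rule assoc_mult_mat)
  also have "\<dots> = P * x" unfolding inv(2) by (rule right_mult_one_mat[OF Px])
  also have "P' * (P * x) = P' * P * x" using P x by (rule assoc_mult_mat[symmetric])
  also have "\<dots> = x" unfolding inv(1) by (rule left_mult_one_mat[OF x])
  finally show ?thesis .
qed

lemma card_short_exact_seqs_le:
  fixes M N R M' N' R' :: "'k::{field,finite} mat"
  assumes sq: "square_mat M" "square_mat N" "square_mat R"
      "square_mat M'" "square_mat N'" "square_mat R'"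
    and iso: "rep_iso M M' \<noteq> {}" "rep_iso N N' \<noteq> {}" "rep_iso R R' \<noteq> {}"
  shows "card (short_exact_seqs M N R) \<le> card (short_exact_seqs M' N' R')"
proof -
  from iso obtain a b c where "a \<in> rep_iso M M'" "b \<in> rep_iso N N'" "c \<in> rep_iso R R'"
    by blast
  note isos = this
  from rep_isoE[OF isos(1) sq(1,4)] obtain ai m where M: "M \<in> carrier_mat m m"
    "M' \<in> carrier_mat m m" and a: "a \<in> carrier_mat m m" "ai \<in> carrier_mat m m"
    "a * ai = 1\<^sub>m m" "ai * a = 1\<^sub>m m" and aM: "a * M = M' * a" "ai * M' = M * ai" by metis
  from rep_isoE[OF isos(2) sq(2,5)] obtain bi n where N: "N \<in> carrier_mat n n"
    "N' \<in> carrier_mat n n" and b: "b \<in> carrier_mat n n" "bi \<in> carrier_mat n n"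
    "b * bi = 1\<^sub>m n" "bi * b = 1\<^sub>m n" and bN: "b * N = N' * b" "bi * N' = N * bi" by metis
  from rep_isoE[OF isos(3) sq(3,6)] obtain ci r where R: "R \<in> carrier_mat r r"
    "R' \<in> carrier_mat r r" and c: "c \<in> carrier_mat r r" "ci \<in> carrier_mat r r"
    "c * ci = 1\<^sub>m r" "ci * c = 1\<^sub>m r" and cR: "c * R = R' * c" "ci * R' = R * ci" by metis
  have d: "dim_row M = m" "dim_row M' = m" "dim_row N = n" "dim_row N' = n"
    "dim_row R = r" "dim_row R' = r" using M N R by auto
  note asr = assoc_mult_mat[of _ r r _ n _ n] assoc_mult_mat[of _ r n _ n _ n]
    assoc_mult_mat[of _ r r _ r _ n]
  note asm = assoc_mult_mat[of _ m m _ r _ r] assoc_mult_mat[of _ m r _ r _ r]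
    assoc_mult_mat[of _ m m _ m _ r]
  have inv_vec: "a *\<^sub>v (ai *\<^sub>v v) = v" "ai *\<^sub>v (a *\<^sub>v v) = v" if "v \<in> carrier_vec m" for v
    using that a by (simp_all flip: assoc_mult_mat_vec[of _ m m _ m])
  have inv_vec_b: "b *\<^sub>v (bi *\<^sub>v v) = v" "bi *\<^sub>v (b *\<^sub>v v) = v" if "v \<in> carrier_vec n" for v
    using that b by (simp_all flip: assoc_mult_mat_vec[of _ n n _ n])
  have inv_vec_c: "c *\<^sub>v (ci *\<^sub>v v) = v" "ci *\<^sub>v (c *\<^sub>v v) = v" if "v \<in> carrier_vec r" for v
    using that c by (simp_all flip: assoc_mult_mat_vec[of _ r r _ r])
  define f where "f = (\<lambda>(\<phi>, \<psi>). (c * \<phi> * bi, a * \<psi> * ci))"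
  have "f (\<phi>, \<psi>) \<in> short_exact_seqs M' N' R'" if *: "(\<phi>, \<psi>) \<in> short_exact_seqs M N R" for \<phi> \<psi>
  proof -
    from * have p: "\<phi> \<in> carrier_mat r n" "\<psi> \<in> carrier_mat m r"
      and hom: "\<phi> * N = R * \<phi>" "\<psi> * R = M * \<psi>"
      and inj: "inj_on (\<lambda>v. \<phi> *\<^sub>v v) (carrier_vec n)"
      and surj: "(\<lambda>v. \<psi> *\<^sub>v v) ` carrier_vec r = carrier_vec m"
      and ex: "(\<lambda>v. \<phi> *\<^sub>v v) ` carrier_vec n = mat_kernel \<psi>"
      using short_exact_seqsD[of \<phi> \<psi> M N R] unfolding d by blast+
    let ?p = "c * \<phi> * bi" and ?s = "a * \<psi> * ci"
    have pc: "?p \<in> carrier_mat r n" "?s \<in> carrier_mat m r" using p a b c by auto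
    have pv: "?p *\<^sub>v v = c *\<^sub>v (\<phi> *\<^sub>v (bi *\<^sub>v v))" if "v \<in> carrier_vec n" for v
      using that p b c by (simp add: assoc_mult_mat_vec[of _ r n _ n] assoc_mult_mat_vec[of _ r r _ n])
    have sv: "?s *\<^sub>v v = a *\<^sub>v (\<psi> *\<^sub>v (ci *\<^sub>v v))" if "v \<in> carrier_vec r" for v
      using that p a c by (simp add: assoc_mult_mat_vec[of _ m r _ r] assoc_mult_mat_vec[of _ m m _ r])
    have "?p * N' = c * (\<phi> * N) * bi" using p b c N by (simp add: asr bN)
    also have "\<dots> = (c * R) * \<phi> * bi" unfolding hom using p b c R by (simp add: asr)
    also have "\<dots> = R' * ?p" unfolding cR using p b c R by (simp add: asr)
    finally have h1: "?p * N' = R' * ?p" .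
    have "?s * R' = a * (\<psi> * R) * ci" using p a c R by (simp add: asm cR)
    also have "\<dots> = (a * M) * \<psi> * ci" unfolding hom using p a c M by (simp add: asm)
    also have "\<dots> = M' * ?s" unfolding aM using p a c M by (simp add: asm)
    finally have h2: "?s * R' = M' * ?s" .
    have h3: "inj_on (\<lambda>v. ?p *\<^sub>v v) (carrier_vec n)"
    proof (rule inj_onI)
      fix v w assume v: "v \<in> carrier_vec n" and w: "w \<in> carrier_vec n" and "?p *\<^sub>v v = ?p *\<^sub>v w"
      then have "ci *\<^sub>v (c *\<^sub>v (\<phi> *\<^sub>v (bi *\<^sub>v v))) = ci *\<^sub>v (c *\<^sub>v (\<phi> *\<^sub>v (bi *\<^sub>v w)))"
        by (simp only: pv)
      then have "\<phi> *\<^sub>v (bi *\<^sub>v v) = \<phi> *\<^sub>v (bi *\<^sub>v w)"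
        using p b v w by (simp add: inv_vec_c)
      then have "bi *\<^sub>v v = bi *\<^sub>v w" using inj b v w by (simp add: inj_on_def)
      then show "v = w" using inv_vec_b v w by metis
    qed
    have h4: "(\<lambda>v. ?s *\<^sub>v v) ` carrier_vec r = carrier_vec m"
    proof (intro subset_antisym subsetI)
      fix w :: "'k vec" assume w: "w \<in> carrier_vec m"
      then have "ai *\<^sub>v w \<in> carrier_vec m" using a by simp
      with surj obtain u where u: "u \<in> carrier_vec r" "\<psi> *\<^sub>v u = ai *\<^sub>v w" by (metis imageE)
      then have "?s *\<^sub>v (c *\<^sub>v u) = w" using w c by (simp add: sv inv_vec inv_vec_c)
      then show "w \<in> (\<lambda>v. ?s *\<^sub>v v) ` carrier_vec r" using u c by (metis imageI mult_mat_vec_carrier)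
    next
      fix w assume "w \<in> (\<lambda>v. ?s *\<^sub>v v) ` carrier_vec r"
      then show "w \<in> carrier_vec m" using pc by auto
    qed
    have h5: "(\<lambda>v. ?p *\<^sub>v v) ` carrier_vec n = mat_kernel ?s"
    proof (intro subset_antisym subsetI)
      fix w assume "w \<in> (\<lambda>v. ?p *\<^sub>v v) ` carrier_vec n"
      then obtain v where v: "v \<in> carrier_vec n" "w = ?p *\<^sub>v v" by blast
      then have "\<phi> *\<^sub>v (bi *\<^sub>v v) \<in> mat_kernel \<psi>" using ex b by (metis imageI mult_mat_vec_carrier)
      then have "\<psi> *\<^sub>v (\<phi> *\<^sub>v (bi *\<^sub>v v)) = 0\<^sub>v m" using p by (simp add: mat_kernel_def)
      moreover have cw: "ci *\<^sub>v w = \<phi> *\<^sub>v (bi *\<^sub>v v)" unfolding v(2) pv[OF v(1)]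
        using v(1) p b by (intro inv_vec_c) simp
      moreover have wc: "w \<in> carrier_vec r" using v pc by simp
      ultimately have "?s *\<^sub>v w = a *\<^sub>v 0\<^sub>v m" by (simp only: sv)
      then have "?s *\<^sub>v w = 0\<^sub>v m" by (simp only: mat_zero_vec[OF a(1)])
      then show "w \<in> mat_kernel ?s" using v pc by (intro mat_kernelI[OF pc(2)]) auto
    next
      fix w assume "w \<in> mat_kernel ?s"
      then have w: "w \<in> carrier_vec r" "?s *\<^sub>v w = 0\<^sub>v m" using pc a c by (auto simp: mat_kernel_def)
      then have "ai *\<^sub>v (a *\<^sub>v (\<psi> *\<^sub>v (ci *\<^sub>v w))) = ai *\<^sub>v 0\<^sub>v m" by (simp add: sv)
      then have "\<psi> *\<^sub>v (ci *\<^sub>v w) = 0\<^sub>v m" using w p a c by (simp add: inv_vec mat_zero_vec[OF a(2)])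
      then have "ci *\<^sub>v w \<in> mat_kernel \<psi>" using w p c by (intro mat_kernelI[OF p(2)]) auto
      with ex obtain v where v: "v \<in> carrier_vec n" "ci *\<^sub>v w = \<phi> *\<^sub>v v" by (metis imageE)
      then have "?p *\<^sub>v (b *\<^sub>v v) = c *\<^sub>v (ci *\<^sub>v w)" using b by (simp add: pv inv_vec_b)
      then have "?p *\<^sub>v (b *\<^sub>v v) = w" using w by (simp add: inv_vec_c)
      then show "w \<in> (\<lambda>v. ?p *\<^sub>v v) ` carrier_vec n" using v b by (metis imageI mult_mat_vec_carrier)
    qed
    show ?thesis unfolding f_def prod.case
      by (rule short_exact_seqsI[of ?p R' N' ?s M', unfolded d, OF pc h1 h2 h3 h4 h5])
  qed
  moreover have "inj_on f (short_exact_seqs M N R)"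
  proof (rule inj_onI; clarify)
    fix \<phi> \<psi> \<phi>' \<psi>'
    assume "(\<phi>, \<psi>) \<in> short_exact_seqs M N R" "(\<phi>', \<psi>') \<in> short_exact_seqs M N R"
      and eq: "f (\<phi>, \<psi>) = f (\<phi>', \<psi>')"
    then have p: "\<phi> \<in> carrier_mat r n" "\<psi> \<in> carrier_mat m r"
      "\<phi>' \<in> carrier_mat r n" "\<psi>' \<in> carrier_mat m r"
      by (metis d(1,3,5) short_exact_seqsD(1,2))+
    have 1: "ci * (c * x * bi) * b = x" if "x \<in> carrier_mat r n" for x
      using conj_cancel_mat[OF c(2,1) that b(2,1) c(4) b(4)] .
    have 2: "ai * (a * x * ci) * c = x" if "x \<in> carrier_mat m r" for x
      using conj_cancel_mat[OF a(2,1) that c(2,1) a(4) c(4)] .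
    from eq have "c * \<phi> * bi = c * \<phi>' * bi" "a * \<psi> * ci = a * \<psi>' * ci" by (simp_all add: f_def)
    with 1 2 p show "\<phi> = \<phi>' \<and> \<psi> = \<psi>'" by metis
  qed
  ultimately show ?thesis
    by (intro card_inj_on_le[of f]) (auto simp: finite_short_exact_seqs)
qed

lemma card_rep_aut_le:
  fixes A B :: "'k::{field,finite} mat"
  assumes sq: "square_mat A" "square_mat B" and iso: "rep_iso A B \<noteq> {}"
  shows "card (rep_iso A A) \<le> card (rep_iso B B)"
proof -
  from iso obtain a where isoa: "a \<in> rep_iso A B" by blast
  from rep_isoE[OF this sq] obtain ai m where A: "A \<in> carrier_mat m m"
    "B \<in> carrier_mat m m" and a: "a \<in> carrier_mat m m" "ai \<in> carrier_mat m m"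
    "a * ai = 1\<^sub>m m" "ai * a = 1\<^sub>m m" and aA: "a * A = B * a" "ai * B = A * ai" by metis
  have isoai: "ai \<in> rep_iso B A" using A a aA by (intro rep_isoI[of _ m _ _ a]) auto
  have "a * x * ai \<in> rep_iso B B" if "x \<in> rep_iso A A" for x
    using rep_iso_comp[OF isoai rep_iso_comp[OF that isoa sq(1,1,2)]] sq a A that
    by (auto simp: rep_iso_def rep_hom_def)
  moreover have "inj_on (\<lambda>x. a * x * ai) (rep_iso A A)"
  proof (rule inj_onI)
    fix x y assume "x \<in> rep_iso A A" "y \<in> rep_iso A A" and eq: "a * x * ai = a * y * ai"
    then have p: "x \<in> carrier_mat m m" "y \<in> carrier_mat m m"
      using A by (auto simp: rep_iso_def rep_hom_def)
    have "ai * (a * x * ai) * a = x" if "x \<in> carrier_mat m m" for x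
      using conj_cancel_mat[OF a(2,1) that a(2,1) a(4,4)] .
    with p eq show "x = y" by metis
  qed
  moreover have "finite (rep_iso B B)"
    by (rule finite_subset[OF _ finite_carrier_mat[of "dim_row B" "dim_row B"]])
      (auto simp: rep_iso_def rep_hom_def)
  ultimately show ?thesis by (intro card_inj_on_le) auto
qed

lemma short_exact_seqs_dim:
  fixes M N R :: "'k::{field,finite} mat"
  assumes "short_exact_seqs M N R \<noteq> {}" and R: "square_mat R"
  shows "dim_row R = dim_row M + dim_row N"
proof -
  define m n r where "m = dim_row M" and "n = dim_row N" and "r = dim_row R"
  from assms(1) obtain \<phi> \<psi> :: "'k mat" where mem: "(\<phi>, \<psi>) \<in> short_exact_seqs M N R"
    by auto
  note D = short_exact_seqsD[OF mem, folded m_def n_def r_def]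
  note p = D(1,2) and inj = D(5) and surj = D(6) and ex = D(7)
  define s where "s w = (SOME u. u \<in> carrier_vec r \<and> \<psi> *\<^sub>v u = w)" for w
  have s: "s w \<in> carrier_vec r" "\<psi> *\<^sub>v s w = w" if "w \<in> carrier_vec m" for w
  proof -
    from that obtain u where "u \<in> carrier_vec r \<and> \<psi> *\<^sub>v u = w"
      unfolding surj[symmetric] by blast
    from someI[of "\<lambda>u. u \<in> carrier_vec r \<and> \<psi> *\<^sub>v u = w", OF this]
    show "s w \<in> carrier_vec r" "\<psi> *\<^sub>v s w = w" unfolding s_def by simp_all
  qed
  have ker: "\<psi> *\<^sub>v (\<phi> *\<^sub>v v) = 0\<^sub>v m" if "v \<in> carrier_vec n" for v
  proof -
    from that ex have "\<phi> *\<^sub>v v \<in> mat_kernel \<psi>" by blast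
    then show ?thesis using p by (simp add: mat_kernel_def)
  qed
  let ?g = "\<lambda>(v, w). \<phi> *\<^sub>v v + s w"
  have psi: "\<psi> *\<^sub>v (?g (v, w)) = w" if "v \<in> carrier_vec n" "w \<in> carrier_vec m" for v w
    using that p s by (simp add: mult_add_distrib_mat_vec[of _ m r] ker)
  have "bij_betw ?g (carrier_vec n \<times> carrier_vec m) (carrier_vec r)"
  proof (rule bij_betw_imageI)
    show "inj_on ?g (carrier_vec n \<times> carrier_vec m)"
    proof (rule inj_onI; clarify)
      fix v w v' w'
      assume c: "v \<in> carrier_vec n" "w \<in> carrier_vec m" "v' \<in> carrier_vec n" "w' \<in> carrier_vec m"
        and eq: "\<phi> *\<^sub>v v + s w = \<phi> *\<^sub>v v' + s w'"
      from eq psi[OF c(1,2)] psi[OF c(3,4)] have w: "w = w'" by simp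
      have add_diff: "x + y - y = x" if "x \<in> carrier_vec r" "y \<in> carrier_vec r" for x y :: "'k vec"
        using that by (intro eq_vecI) auto
      have "\<phi> *\<^sub>v v = \<phi> *\<^sub>v v + s w - s w"
        using p c s by (intro add_diff[symmetric]) auto
      also have "\<dots> = \<phi> *\<^sub>v v' + s w - s w" using eq unfolding w by simp
      also have "\<dots> = \<phi> *\<^sub>v v'" using p c s by (intro add_diff) auto
      finally show "v = v' \<and> w = w'" using inj c w by (auto simp: inj_on_def)
    qed
    show "?g ` (carrier_vec n \<times> carrier_vec m) = carrier_vec r"
    proof (intro subset_antisym subsetI)
      fix u assume "u \<in> ?g ` (carrier_vec n \<times> carrier_vec m)"
      then show "u \<in> carrier_vec r" using p s by auto
    next
      fix u :: "'k vec" assume u: "u \<in> carrier_vec r"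
      define w where "w = \<psi> *\<^sub>v u"
      have w: "w \<in> carrier_vec m" using u p by (auto simp: w_def)
      have "\<psi> *\<^sub>v (u - s w) = 0\<^sub>v m"
        using u p w s by (simp add: mult_minus_distrib_mat_vec[of _ m r] w_def)
      then have "u - s w \<in> mat_kernel \<psi>" using u s w by (intro mat_kernelI[OF p(2)]) auto
      then obtain v where v: "v \<in> carrier_vec n" "\<phi> *\<^sub>v v = u - s w" using ex by (metis imageE)
      have "u = ?g (v, w)" using u s[OF w] v by (intro eq_vecI) auto
      then show "u \<in> ?g ` (carrier_vec n \<times> carrier_vec m)" using v w by blast
    qed
  qed
  then have "CARD('k) ^ n * CARD('k) ^ m = CARD('k) ^ r"
    by (auto dest!: bij_betw_same_card simp: card_cartesian_product card_carrier_vec)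
  then have "CARD('k) ^ (m + n) = CARD('k) ^ r" by (simp add: power_add mult.commute)
  moreover have "card {0, 1 :: 'k} \<le> CARD('k)" by (intro card_mono) auto
  ultimately have "m + n = r" by (simp add: power_inject_exp)
  then show ?thesis by (simp add: m_def n_def r_def)
qed

lift_definition num_ses :: "'k::{field,finite} rep_class \<Rightarrow> 'k rep_class \<Rightarrow> 'k rep_class \<Rightarrow> nat"
  is "\<lambda>M N R. card (short_exact_seqs M N R)"
  by (rule antisym; rule card_short_exact_seqs_le; elim conjE)
    (assumption | rule nilpotent_mat_square rep_iso_sym)+

lift_definition num_aut :: "'k::{field,finite} rep_class \<Rightarrow> nat"
  is "\<lambda>M. card (rep_iso M M)"
  by (rule antisym; rule card_rep_aut_le; elim conjE)
    (assumption | rule nilpotent_mat_square rep_iso_sym)+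

lift_definition rep_dim :: "'k::field rep_class \<Rightarrow> nat" is dim_row
  by (auto simp: nilpotent_mat_def elim!: rep_isoE)

lemma finite_rep_dim: "finite {M :: 'k::{field,finite} rep_class. rep_dim M = d}"
proof (rule finite_subset)
  show "{M :: 'k rep_class. rep_dim M = d} \<subseteq> abs_rep_class ` carrier_mat d d"
  proof (clarify)
    fix M :: "'k rep_class"
    show "M \<in> abs_rep_class ` carrier_mat (rep_dim M) (rep_dim M)"
      using Quotient_rep_reflp[OF Quotient_rep_class, of M]
      by (intro image_eqI[of _ _ "rep_rep_class M"])
        (auto simp: Quotient_abs_rep[OF Quotient_rep_class] rep_dim.rep_eq nilpotent_mat_def)
  qed
qed (simp add: finite_carrier_mat)

lemma num_ses_dim: "num_ses M N R \<noteq> 0 \<Longrightarrow> rep_dim R = rep_dim M + rep_dim N"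
  by transfer (auto simp: nilpotent_mat_def intro!: short_exact_seqs_dim)


section \<open>The Hall algebra\<close>

type_synonym 'k hall = "'k rep_class \<Rightarrow>\<^sub>0 rat"

definition hall_coeff :: "'k::{field,finite} rep_class \<Rightarrow> 'k rep_class \<Rightarrow> 'k rep_class \<Rightarrow> rat" where
  "hall_coeff M N R = of_nat (num_ses M N R) / (of_nat (num_aut M) * of_nat (num_aut N))"

text \<open>
  The bilinear extension of \<open>[M] \<cdot> [N] = (\<Sum>R. hall_coeff M N R [R])\<close>. The product on
  \<open>\<Rightarrow>\<^sub>0\<close> provided by the library is a convolution and is not used.
\<close>

lift_definition hall_mult :: "'k::{field,finite} hall \<Rightarrow> 'k hall \<Rightarrow> 'k hall" (infixr "\<star>" 70)
  is "\<lambda>x y R. \<Sum>M | x M \<noteq> 0. \<Sum>N | y N \<noteq> 0. x M * y N * hall_coeff M N R"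
proof -
  fix x y :: "'k rep_class \<Rightarrow> rat"
  assume fin: "finite {M. x M \<noteq> 0}" "finite {N. y N \<noteq> 0}"
  show "finite {R. (\<Sum>M | x M \<noteq> 0. \<Sum>N | y N \<noteq> 0. x M * y N * hall_coeff M N R) \<noteq> 0}"
  proof (rule finite_subset)
    show "{R. (\<Sum>M | x M \<noteq> 0. \<Sum>N | y N \<noteq> 0. x M * y N * hall_coeff M N R) \<noteq> 0} \<subseteq>
      (\<Union>M\<in>{M. x M \<noteq> 0}. \<Union>N\<in>{N. y N \<noteq> 0}. {R. rep_dim R = rep_dim M + rep_dim N})"
    proof
      fix R assume "R \<in> {R. (\<Sum>M | x M \<noteq> 0. \<Sum>N | y N \<noteq> 0. x M * y N * hall_coeff M N R) \<noteq> 0}"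
      then obtain M N where "x M \<noteq> 0" "y N \<noteq> 0" "hall_coeff M N R \<noteq> 0"
        by (auto elim!: sum.not_neutral_contains_not_neutral)
      then show "R \<in> (\<Union>M\<in>{M. x M \<noteq> 0}. \<Union>N\<in>{N. y N \<noteq> 0}. {R. rep_dim R = rep_dim M + rep_dim N})"
        using num_ses_dim[of M N R] by (auto simp: hall_coeff_def)
    qed
  qed (use fin finite_rep_dim in auto)
qed

lift_definition zero_rep :: "'k::field rep_class" is "0\<^sub>m 0 0"
  using rep_iso_refl[of "0\<^sub>m 0 0"] by (auto simp: nilpotent_mat_def intro!: exI[of _ 1])

definition hall_one :: "'k::field hall" where
  "hall_one = Poly_Mapping.single zero_rep 1"

text \<open>
  The Hall algebra is associative with unit \<open>hall_one\<close>, so the bracketing chosen for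
  powers and for products of lists is immaterial.
\<close>

primrec hall_power :: "'k::{field,finite} hall \<Rightarrow> nat \<Rightarrow> 'k hall" where
  "hall_power x 0 = hall_one"
| "hall_power x (Suc m) = x \<star> hall_power x m"

definition hall_prod_list :: "'k::{field,finite} hall list \<Rightarrow> 'k hall" where
  "hall_prod_list xs = foldr (\<star>) xs hall_one"


section \<open>Partitions and Hall numbers\<close>

text \<open>
  A partition is the multiset of its parts: \<open>size \<lambda>\<close> is the length \<open>l(\<lambda>)\<close> and
  \<open>count \<lambda> i\<close> is the multiplicity \<open>m\<^sub>i(\<lambda>)\<close>.
\<close>

definition partitions_of :: "nat \<Rightarrow> nat multiset set" where
  "partitions_of n = {\<mu>. 0 \<notin># \<mu> \<and> \<Sum>\<^sub># \<mu> = n}"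

lemma finite_partitions_of: "finite (partitions_of n)"
proof (rule finite_subset)
  show "partitions_of n \<subseteq> mset ` {xs. set xs \<subseteq> {..n} \<and> length xs \<le> n}"
  proof
    fix \<mu> assume "\<mu> \<in> partitions_of n"
    then have \<mu>: "0 \<notin># \<mu>" "\<Sum>\<^sub># \<mu> = n" by (auto simp: partitions_of_def)
    have "x \<le> n" if "x \<in># \<mu>" for x
      using that \<mu>(2) by (auto dest!: multi_member_split)
    moreover have "0 \<notin># \<mu> \<Longrightarrow> size \<mu> \<le> \<Sum>\<^sub># \<mu>" by (induction \<mu>) (auto simp: Suc_le_eq add_strict_increasing)
    moreover obtain xs where "\<mu> = mset xs" by (metis ex_mset)
    ultimately show "\<mu> \<in> mset ` {xs. set xs \<subseteq> {..n} \<and> length xs \<le> n}"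
      using \<mu> by (intro image_eqI[of _ _ xs]) auto
  qed
  show "finite (mset ` {xs. set xs \<subseteq> {..n} \<and> length xs \<le> n})"
    by (intro finite_imageI finite_lists_length_le) simp
qed

lemma nilpotent_jordan_matrix: "nilpotent_mat (jordan_matrix (map (\<lambda>r. (r, 0 :: 'k::field)) rs))"
proof -
  have z: "diag_block_mat (map (\<lambda>r. 0\<^sub>m r r :: 'k mat) rs) = 0\<^sub>m (sum_list rs) (sum_list rs)" for rs
    by (induction rs) (auto simp: Let_def intro!: eq_matI)
  have "jordan_block r (0 :: 'k) ^\<^sub>m sum_list rs = 0\<^sub>m r r" if "r \<in> set rs" for r
    using member_le_sum_list[OF that] by (intro eq_matI) (auto simp: jordan_block_zero_pow)
  then have "jordan_matrix (map (\<lambda>r. (r, 0 :: 'k)) rs) ^\<^sub>m sum_list rs =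
      diag_block_mat (map (\<lambda>r. 0\<^sub>m r r) rs)"
    by (auto simp: jordan_matrix_pow o_def intro!: arg_cong[of _ _ diag_block_mat])
  then have "jordan_matrix (map (\<lambda>r. (r, 0 :: 'k)) rs) ^\<^sub>m sum_list rs = 0\<^sub>m (sum_list rs) (sum_list rs)"
    by (simp only: z)
  then show ?thesis by (auto simp: nilpotent_mat_def o_def)
qed

text \<open>The class of \<open>I\<^sub>\<lambda>\<close>, the direct sum of one nilpotent Jordan block of size \<open>r\<close> for each part \<open>r\<close> of \<open>\<lambda>\<close>.\<close>

lift_definition rep_of_partition :: "nat multiset \<Rightarrow> 'k::field rep_class"
  is "\<lambda>\<mu>. jordan_matrix (map (\<lambda>r. (r, 0)) (sorted_list_of_multiset \<mu>))"
  using rep_iso_refl[OF nilpotent_mat_square[OF nilpotent_jordan_matrix]]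
  by (intro conjI nilpotent_jordan_matrix) blast

definition hall_indec :: "nat \<Rightarrow> 'k::field hall" where
  "hall_indec r = Poly_Mapping.single (rep_of_partition {#r#}) 1"

definition hall_number :: "'k::{field,finite} itself \<Rightarrow> nat \<Rightarrow> nat multiset \<Rightarrow> nat multiset \<Rightarrow> rat" where
  "hall_number _ n \<mu> \<nu> = Poly_Mapping.lookup
     (hall_prod_list (map (\<lambda>r. hall_power (hall_indec r :: 'k hall) (count \<nu> r)) [1..<Suc n]))
     (rep_of_partition \<mu>)"

end

theory Submission
  imports Defs "Jordan_Normal_Form.Jordan_Normal_Form_Existence"
begin

text \<open>
  Let \<open>I\<^sub>r\<close> be the class of a single Jordan block of size \<open>r\<close>, put \<open>q\<^sub>r = (1 - 1/q) I\<^sub>r\<close>, and let \<open>l(R)\<close> be the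
  number of Jordan blocks of \<open>R\<close>. Transposing matrices reverses short exact sequences and fixes every
  isomorphism class, so the Hall product is commutative (\<open>hall_mult_commute\<close>); it is associative because both
  bracketings count filtrations with three subquotients (\<open>hall_mult_assoc\<close>). Hence the order of the
  factors in the products defining the Hall numbers does not matter.

  In a commutative ring, \<open>n\<close> times the degree \<open>n\<close> part of \<open>log (1 + q\<^sub>1 + q\<^sub>2 + \<dots>)\<close> is
  \<open>p\<^sub>n = n \<Sum>\<^sub>\<mu> (-1)\<^bsup>l(\<mu>)-1\<^esup> (l(\<mu>) - 1)! / (\<Prod> m\<^sub>i(\<mu>)!) \<Prod> q\<^sub>i\<^bsup>m\<^sub>i(\<mu>)\<^esup>\<close>, where \<open>\<mu>\<close> runs through the partitions
  of \<open>n\<close>. The sum in the theorem is the coefficient of \<open>I\<^sub>\<lambda>\<close> in \<open>p\<^sub>n / n\<close>. Newton's identity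
  \<open>n q\<^sub>n = p\<^sub>n + \<Sum>\<^bsub>0<j<n\<^esub> q\<^sub>j p\<^bsub>n-j\<^esub>\<close> (\<open>newton_sum_recursion\<close>) determines the \<open>p\<^sub>n\<close> recursively. It therefore
  suffices that the expected coefficients
  \<open>G(R) = (1 - q\<^bsup>-dim R\<^esup>) \<Prod>\<^bsub>0<i<l(R)\<^esub> (1 - q\<^sup>i)\<close> obey the same recursion (\<open>power_sum_coeff_recursion\<close>).

  The product with \<open>I\<^sub>j\<close> sums over the surjections of \<open>R\<close> onto a Jordan block of size \<open>j\<close>. Such a
  surjection is given by its first row, a vector \<open>v\<close> with \<open>B\<^sup>j v = 0\<close> and \<open>B\<^bsup>j-1\<^esup> v \<noteq> 0\<close>, where \<open>B\<close> is the transpose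
  of \<open>R\<close>; write \<open>j = ht v\<close>. Its kernel has \<open>l(R)\<close> blocks if \<open>v\<close> is in the image of \<open>B\<close>, and \<open>l(R) - 1\<close>
  blocks otherwise (\<open>kernel_class_krylov\<close>). The recursion becomes a statement about the sums of
  \<open>q\<^bsup>-ht v\<^esup> - q\<^bsup>-n\<^esup>\<close> over all \<open>v\<close> and over the image of \<open>B\<close>, and these two sums are proportional because \<open>B\<close>
  lowers the height of every nonzero vector by one and has fibres of size \<open>q\<^bsup>l(R)\<^esup>\<close>.
\<close>


section \<open>Linear algebra over a finite field\<close>

definition inj_mat :: "'a::field mat \<Rightarrow> bool" where
  "inj_mat A \<longleftrightarrow> inj_on (\<lambda>v. A *\<^sub>v v) (carrier_vec (dim_col A))"

definition surj_mat :: "'a::field mat \<Rightarrow> bool" where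
  "surj_mat A \<longleftrightarrow> (\<lambda>v. A *\<^sub>v v) ` carrier_vec (dim_col A) = carrier_vec (dim_row A)"

lemma mult_unit_vec:
  fixes A :: "'a::field mat"
  assumes "A \<in> carrier_mat m n" "i < n"
  shows "A *\<^sub>v unit_vec n i = col A i"
  using assms by (intro eq_vecI) (auto simp: scalar_prod_right_unit)

lemma mat_eq_on_vecs:
  fixes X Y :: "'a::field mat"
  assumes X: "X \<in> carrier_mat m n" and Y: "Y \<in> carrier_mat m n"
    and eq: "\<And>v. v \<in> carrier_vec n \<Longrightarrow> X *\<^sub>v v = Y *\<^sub>v v"
  shows "X = Y"
proof (rule mat_col_eqI)
  fix i assume "i < dim_col Y"
  then have i: "i < n" using Y by simp
  show "col X i = col Y i"
    using eq[of "unit_vec n i"] mult_unit_vec[OF X i] mult_unit_vec[OF Y i] by simp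
qed (use X Y in auto)

lemma vec_diff_eq_0_iff:
  fixes v w :: "'a::field vec"
  assumes "v \<in> carrier_vec n" "w \<in> carrier_vec n"
  shows "v - w = 0\<^sub>v n \<longleftrightarrow> v = w"
proof
  assume *: "v - w = 0\<^sub>v n"
  show "v = w"
  proof (rule eq_vecI)
    fix i assume "i < dim_vec w"
    then show "v $ i = w $ i" using arg_cong[OF *, of "\<lambda>u. u $ i"] assms by simp
  qed (use assms in auto)
qed (use assms in auto)

lemma inj_mat_iff_kernel:
  assumes A: "A \<in> carrier_mat m n"
  shows "inj_mat A \<longleftrightarrow> (\<forall>v\<in>carrier_vec n. A *\<^sub>v v = 0\<^sub>v m \<longrightarrow> v = 0\<^sub>v n)"
proof
  assume inj: "inj_mat A"
  show "\<forall>v\<in>carrier_vec n. A *\<^sub>v v = 0\<^sub>v m \<longrightarrow> v = 0\<^sub>v n"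
  proof (intro ballI impI)
    fix v assume "v \<in> carrier_vec n" "A *\<^sub>v v = 0\<^sub>v m"
    then show "v = 0\<^sub>v n"
      using inj A mat_zero_vec[OF A] unfolding inj_mat_def by (auto dest!: inj_onD[of _ _ v "0\<^sub>v n"])
  qed
next
  assume ker: "\<forall>v\<in>carrier_vec n. A *\<^sub>v v = 0\<^sub>v m \<longrightarrow> v = 0\<^sub>v n"
  show "inj_mat A" unfolding inj_mat_def
  proof (rule inj_onI)
    fix v w assume v: "v \<in> carrier_vec (dim_col A)" and w: "w \<in> carrier_vec (dim_col A)"
      and eq: "A *\<^sub>v v = A *\<^sub>v w"
    have v': "v \<in> carrier_vec n" and w': "w \<in> carrier_vec n" using v w A by auto
    have "A *\<^sub>v (v - w) = A *\<^sub>v v - A *\<^sub>v w"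
      using mult_minus_distrib_mat_vec[OF A v' w'] .
    also have "\<dots> = 0\<^sub>v m" using eq A by (auto intro!: eq_vecI)
    finally have "v - w = 0\<^sub>v n" using ker v' w' by auto
    then show "v = w" using vec_diff_eq_0_iff[OF v' w'] by simp
  qed
qed

lemma inj_matI_left_inverse:
  assumes A: "A \<in> carrier_mat m n" and L: "L \<in> carrier_mat n m" and LA: "L * A = 1\<^sub>m n"
  shows "inj_mat A"
  unfolding inj_mat_iff_kernel[OF A]
proof (intro ballI impI)
  fix v assume v: "v \<in> carrier_vec n" and 0: "A *\<^sub>v v = 0\<^sub>v m"
  have "v = (L * A) *\<^sub>v v" using v LA by simp
  also have "\<dots> = L *\<^sub>v (A *\<^sub>v v)" using L A v by (rule assoc_mult_mat_vec)
  finally show "v = 0\<^sub>v n" using 0 mat_zero_vec[OF L] by simp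
qed

lemma surj_matI_right_inverse:
  assumes A: "A \<in> carrier_mat m n" and S: "S \<in> carrier_mat n m" and AS: "A * S = 1\<^sub>m m"
  shows "surj_mat A"
proof -
  have "w \<in> (\<lambda>v. A *\<^sub>v v) ` carrier_vec n" if w: "w \<in> carrier_vec m" for w
  proof
    show "w = A *\<^sub>v (S *\<^sub>v w)" using assoc_mult_mat_vec[OF A S w] AS w by simp
    show "S *\<^sub>v w \<in> carrier_vec n" using S w by simp
  qed
  then show ?thesis using A by (auto simp: surj_mat_def)
qed

lemma surj_mat_right_inverse:
  assumes A: "A \<in> carrier_mat m n" and surj: "surj_mat A"
  obtains S where "S \<in> carrier_mat n m" "A * S = 1\<^sub>m m"
proof -
  have "\<forall>w\<in>carrier_vec m. \<exists>v\<in>carrier_vec n. A *\<^sub>v v = w"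
    using A surj unfolding surj_mat_def by (metis carrier_matD imageE)
  then obtain s where s: "\<And>w. w \<in> carrier_vec m \<Longrightarrow> s w \<in> carrier_vec n"
      "\<And>w. w \<in> carrier_vec m \<Longrightarrow> A *\<^sub>v s w = w" by metis
  define S where "S = mat_of_cols n (map (\<lambda>j. s (unit_vec m j)) [0..<m])"
  have S: "S \<in> carrier_mat n m" unfolding S_def by auto
  have "A * S = 1\<^sub>m m"
  proof (rule mat_col_eqI)
    fix j assume "j < dim_col (1\<^sub>m m :: 'a mat)"
    then have j: "j < m" by simp
    have "col S j = s (unit_vec m j)" unfolding S_def using j s by (subst col_mat_of_cols) auto
    then have "col (A * S) j = unit_vec m j" using col_mult2[OF A S j] s j by (metis unit_vec_carrier)
    then show "col (A * S) j = col (1\<^sub>m m) j" using j by simp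
  qed (use A S in auto)
  then show thesis using that S by blast
qed

text \<open>
  The fibres of a linear map are translates of its kernel. Over a finite field this way of counting
  can take the place of dimension theory.
\<close>

lemma sum_mult_mat_vec:
  fixes A :: "'k::{field,finite} mat" and f :: "'k vec \<Rightarrow> 'b::comm_semiring_1"
  assumes A: "A \<in> carrier_mat m n"
  shows "(\<Sum>v\<in>carrier_vec n. f (A *\<^sub>v v)) =
    of_nat (card (mat_kernel A)) * (\<Sum>w\<in>(\<lambda>v. A *\<^sub>v v) ` carrier_vec n. f w)"
proof -
  have fibre: "card {v \<in> carrier_vec n. A *\<^sub>v v = A *\<^sub>v u} = card (mat_kernel A)"
    if u: "u \<in> carrier_vec n" for u
  proof (rule bij_betw_same_card[of "\<lambda>v. v - u"], rule bij_betw_byWitness[of _ "\<lambda>v. v + u"])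
    have ker: "mat_kernel A = {v \<in> carrier_vec n. A *\<^sub>v v = 0\<^sub>v m}" using mat_kernel[OF A] by simp
    show "\<forall>v\<in>{v \<in> carrier_vec n. A *\<^sub>v v = A *\<^sub>v u}. v - u + u = v" using u by auto
    show "\<forall>v\<in>mat_kernel A. v + u - u = v" using u unfolding ker by auto
    show "(\<lambda>v. v - u) ` {v \<in> carrier_vec n. A *\<^sub>v v = A *\<^sub>v u} \<subseteq> mat_kernel A"
      using u A unfolding ker by (auto simp: mult_minus_distrib_mat_vec[OF A])
    show "(\<lambda>v. v + u) ` mat_kernel A \<subseteq> {v \<in> carrier_vec n. A *\<^sub>v v = A *\<^sub>v u}"
      using u A unfolding ker by (auto simp: mult_add_distrib_mat_vec[OF A])
  qed
  have "(\<Sum>v\<in>carrier_vec n. f (A *\<^sub>v v)) =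
      (\<Sum>w\<in>(\<lambda>v. A *\<^sub>v v) ` carrier_vec n. \<Sum>v\<in>{v. v \<in> carrier_vec n \<and> A *\<^sub>v v = w}. f (A *\<^sub>v v))"
    by (rule sum.image_gen) (rule finite_carrier_vec)
  also have "\<dots> = (\<Sum>w\<in>(\<lambda>v. A *\<^sub>v v) ` carrier_vec n. of_nat (card (mat_kernel A)) * f w)"
    using fibre by (intro sum.cong refl) auto
  finally show ?thesis by (simp add: sum_distrib_left)
qed

lemma card_kernel_image:
  fixes A :: "'k::{field,finite} mat"
  assumes "A \<in> carrier_mat m n"
  shows "card (mat_kernel A) * card ((\<lambda>v. A *\<^sub>v v) ` carrier_vec n) = CARD('k) ^ n"
  using sum_mult_mat_vec[OF assms, of "\<lambda>_. 1::nat"] by (simp add: card_carrier_vec)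

lemma card_field_gt_1: "CARD('k::{field,finite}) > 1"
proof -
  have "card {0, 1 :: 'k} \<le> CARD('k)" by (intro card_mono) auto
  then show ?thesis by simp
qed

lemma card_field_power_inject [simp]: "CARD('k::{field,finite}) ^ m = CARD('k) ^ n \<longleftrightarrow> m = n"
  using card_field_gt_1[where ?'k = 'k] by (simp add: power_inject_exp)

lemma card_kernel_surj:
  fixes A :: "'k::{field,finite} mat"
  assumes "A \<in> carrier_mat m n" "surj_mat A"
  shows "card (mat_kernel A) * CARD('k) ^ m = CARD('k) ^ n"
  using card_kernel_image[OF assms(1)] assms by (simp add: surj_mat_def card_carrier_vec)

lemma card_image_inj:
  fixes A :: "'k::{field,finite} mat"
  assumes "A \<in> carrier_mat m n" "inj_mat A"
  shows "card ((\<lambda>v. A *\<^sub>v v) ` carrier_vec n) = CARD('k) ^ n"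
  using assms by (auto simp: inj_mat_def card_image card_carrier_vec)

lemma surj_mat_dim_le:
  fixes A :: "'k::{field,finite} mat"
  assumes A: "A \<in> carrier_mat m n" and "surj_mat A"
  shows "m \<le> n"
proof -
  have "CARD('k) ^ m dvd CARD('k) ^ n" using card_kernel_surj[OF assms] by (metis dvd_triv_right)
  then show ?thesis using card_field_gt_1[where ?'k = 'k]
    by (metis dvd_imp_le power_increasing_iff power_not_zero neq0_conv not_less_zero)
qed

definition append_col :: "'a::field mat \<Rightarrow> 'a vec \<Rightarrow> 'a mat" where
  "append_col A w = mat (dim_row A) (Suc (dim_col A)) (\<lambda>(i, j). if j < dim_col A then A $$ (i, j) else w $ i)"

lemma append_col_mult_vec:
  assumes A: "A \<in> carrier_mat r n" and w: "w \<in> carrier_vec r" and v: "v \<in> carrier_vec (Suc n)"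
  shows "append_col A w *\<^sub>v v = A *\<^sub>v vec n (\<lambda>i. v $ i) + (v $ n) \<cdot>\<^sub>v w"
proof (rule eq_vecI)
  fix i assume "i < dim_vec (A *\<^sub>v vec n (\<lambda>i. v $ i) + (v $ n) \<cdot>\<^sub>v w)"
  then have i: "i < r" using w by simp
  have "(append_col A w *\<^sub>v v) $ i = (\<Sum>j = 0..<Suc n. (if j < n then A $$ (i, j) else w $ i) * v $ j)"
    using A v i by (auto simp: append_col_def scalar_prod_def intro!: sum.cong)
  also have "\<dots> = (\<Sum>j = 0..<n. A $$ (i, j) * v $ j) + w $ i * v $ n" by simp
  also have "\<dots> = (A *\<^sub>v vec n (\<lambda>i. v $ i) + (v $ n) \<cdot>\<^sub>v w) $ i"
    using A w v i by (auto simp: scalar_prod_def mult.commute)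
  finally show "(append_col A w *\<^sub>v v) $ i = (A *\<^sub>v vec n (\<lambda>i. v $ i) + (v $ n) \<cdot>\<^sub>v w) $ i" .
qed (use A w in \<open>auto simp: append_col_def\<close>)

lemma inj_mat_append_col:
  assumes A: "A \<in> carrier_mat r n" and w: "w \<in> carrier_vec r" and inj: "inj_mat A"
    and out: "w \<notin> (\<lambda>v. A *\<^sub>v v) ` carrier_vec n"
  shows "inj_mat (append_col A w)"
proof -
  have C: "append_col A w \<in> carrier_mat r (Suc n)" using A by (simp add: append_col_def)
  show ?thesis unfolding inj_mat_iff_kernel[OF C]
  proof (intro ballI impI)
    fix v assume v: "v \<in> carrier_vec (Suc n)" and 0: "append_col A w *\<^sub>v v = 0\<^sub>v r"
    define u where "u = vec n (\<lambda>i. v $ i)"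
    have u: "u \<in> carrier_vec n" by (simp add: u_def)
    have eq: "A *\<^sub>v u + (v $ n) \<cdot>\<^sub>v w = 0\<^sub>v r" using append_col_mult_vec[OF A w v] 0 by (simp add: u_def)
    have eqi: "(A *\<^sub>v u) $ i + v $ n * w $ i = 0" if "i < r" for i
      using arg_cong[OF eq, of "\<lambda>x. x $ i"] that A w by simp
    have vn: "v $ n = 0"
    proof (rule ccontr)
      assume nz: "v $ n \<noteq> 0"
      have "w = A *\<^sub>v ((- 1 / v $ n) \<cdot>\<^sub>v u)"
      proof (rule eq_vecI)
        fix i assume "i < dim_vec (A *\<^sub>v ((- 1 / v $ n) \<cdot>\<^sub>v u))"
        then have i: "i < r" using A by simp
        have "(A *\<^sub>v u) $ i = - (v $ n * w $ i)" using eqi[OF i] by (simp add: eq_neg_iff_add_eq_0)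
        then show "w $ i = (A *\<^sub>v ((- 1 / v $ n) \<cdot>\<^sub>v u)) $ i"
          using nz i A mult_mat_vec[OF A u, of "- 1 / v $ n"] by simp
      qed (use A w in auto)
      then have "w \<in> (\<lambda>v. A *\<^sub>v v) ` carrier_vec n" by (rule image_eqI) (use u in simp)
      with out show False ..
    qed
    have "A *\<^sub>v u = 0\<^sub>v r" using eqi vn A by (intro eq_vecI) auto
    then have "u = 0\<^sub>v n" using inj inj_mat_iff_kernel[OF A] u by blast
    then have "v $ i = 0" if "i < n" for i
      using that by (metis u_def index_vec index_zero_vec(1))
    then show "v = 0\<^sub>v (Suc n)" using vn v by (intro eq_vecI) (auto simp: less_Suc_eq)
  qed
qed

text \<open>
  Columns are appended to \<open>A\<close> until its image fills \<open>W\<close>; each new column multiplies the number of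
  vectors in the image by the order of the field, so the process stops.
\<close>

lemma extend_to_basis:
  fixes A :: "'k::{field,finite} mat"
  assumes A: "A \<in> carrier_mat r n" and inj: "inj_mat A"
    and W: "W \<subseteq> carrier_vec r"
    and add: "\<And>v w. v \<in> W \<Longrightarrow> w \<in> W \<Longrightarrow> v + w \<in> W"
    and smult: "\<And>a v. v \<in> W \<Longrightarrow> a \<cdot>\<^sub>v v \<in> W"
    and AW: "(\<lambda>v. A *\<^sub>v v) ` carrier_vec n \<subseteq> W"
  obtains B m where "n \<le> m" "B \<in> carrier_mat r m" "inj_mat B"
    "(\<lambda>v. B *\<^sub>v v) ` carrier_vec m = W" "\<And>i j. i < r \<Longrightarrow> j < n \<Longrightarrow> B $$ (i, j) = A $$ (i, j)"
proof -
  have "\<exists>B m. n \<le> m \<and> B \<in> carrier_mat r m \<and> inj_mat B \<and> (\<lambda>v. B *\<^sub>v v) ` carrier_vec m = W \<and>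
      (\<forall>i<r. \<forall>j<n. B $$ (i, j) = A $$ (i, j))"
    using A inj AW
  proof (induction "card W - CARD('k) ^ n" arbitrary: A n rule: less_induct)
    case less
    note A = less.prems(1) and inj = less.prems(2) and AW = less.prems(3)
    have finW: "finite W" by (rule finite_subset[OF W finite_carrier_vec])
    show ?case
    proof (cases "(\<lambda>v. A *\<^sub>v v) ` carrier_vec n = W")
      case True
      then show ?thesis using A inj by (intro exI[of _ A] exI[of _ n]) auto
    next
      case False
      then obtain w where w: "w \<in> W" "w \<notin> (\<lambda>v. A *\<^sub>v v) ` carrier_vec n" using AW by auto
      let ?C = "append_col A w"
      have C: "?C \<in> carrier_mat r (Suc n)" using A by (simp add: append_col_def)
      have wr: "w \<in> carrier_vec r" using w W by auto
      have injC: "inj_mat ?C" by (rule inj_mat_append_col[OF A wr inj w(2)])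
      have CW: "(\<lambda>v. ?C *\<^sub>v v) ` carrier_vec (Suc n) \<subseteq> W"
      proof clarify
        fix v :: "'k vec" assume v: "v \<in> carrier_vec (Suc n)"
        have "A *\<^sub>v vec n (\<lambda>i. v $ i) \<in> W" using AW by auto
        then show "?C *\<^sub>v v \<in> W" unfolding append_col_mult_vec[OF A wr v]
          using add smult w(1) by blast
      qed
      have "CARD('k) ^ Suc n \<le> card W"
        using card_mono[OF finW CW] card_image_inj[OF C injC] by simp
      moreover have "CARD('k) ^ n < CARD('k) ^ Suc n"
        using card_field_gt_1[where ?'k = 'k] by (intro power_strict_increasing) auto
      ultimately have "card W - CARD('k) ^ Suc n < card W - CARD('k) ^ n" by linarith
      from less.hyps[OF this C injC CW] obtain B m where B: "Suc n \<le> m" "B \<in> carrier_mat r m"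
        "inj_mat B" "(\<lambda>v. B *\<^sub>v v) ` carrier_vec m = W"
        "\<forall>i<r. \<forall>j<Suc n. B $$ (i, j) = ?C $$ (i, j)" by blast
      have "B $$ (i, j) = A $$ (i, j)" if "i < r" "j < n" for i j
        using B(5) that A by (auto simp: append_col_def)
      then show ?thesis using B by (intro exI[of _ B] exI[of _ m]) auto
    qed
  qed
  then show thesis using that by blast
qed

lemma subspace_basis:
  fixes W :: "'k::{field,finite} vec set"
  assumes W: "W \<subseteq> carrier_vec r" and "0\<^sub>v r \<in> W"
    and "\<And>v w. v \<in> W \<Longrightarrow> w \<in> W \<Longrightarrow> v + w \<in> W"
    and "\<And>a v. v \<in> W \<Longrightarrow> a \<cdot>\<^sub>v v \<in> W"
  obtains B m where "B \<in> carrier_mat r m" "inj_mat B" "(\<lambda>v. B *\<^sub>v v) ` carrier_vec m = W"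
proof -
  let ?A = "0\<^sub>m r 0 :: 'k mat"
  have A: "?A \<in> carrier_mat r 0" by simp
  have "inj_mat ?A" unfolding inj_mat_iff_kernel[OF A] by auto
  moreover have "?A *\<^sub>v v = 0\<^sub>v r" if "v \<in> carrier_vec 0" for v using that by (intro eq_vecI) (auto simp: scalar_prod_def)
  ultimately show thesis
    using extend_to_basis[OF A _ W assms(3,4)] assms(2) that by (metis (no_types, lifting) image_subsetI)
qed

text \<open>
  An injective matrix is the left part of an invertible one; the inverse of the latter provides
  both a left inverse and a cokernel.
\<close>

lemma inj_mat_complement:
  fixes A :: "'k::{field,finite} mat"
  assumes A: "A \<in> carrier_mat r n" and inj: "inj_mat A"
  obtains L p where "n \<le> r" "L \<in> carrier_mat n r" "L * A = 1\<^sub>m n"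
    "p \<in> carrier_mat (r - n) r" "surj_mat p" "mat_kernel p = (\<lambda>v. A *\<^sub>v v) ` carrier_vec n"
proof -
  obtain B m where nm: "n \<le> m" and B: "B \<in> carrier_mat r m" and injB: "inj_mat B"
    and im: "(\<lambda>v. B *\<^sub>v v) ` carrier_vec m = carrier_vec r"
    and BA: "\<And>i j. i < r \<Longrightarrow> j < n \<Longrightarrow> B $$ (i, j) = A $$ (i, j)"
    proof (rule extend_to_basis[OF A inj subset_refl])
    show "(\<lambda>v. A *\<^sub>v v) ` carrier_vec n \<subseteq> carrier_vec r" using A by auto
  qed auto
  have "m = r" using card_image_inj[OF B injB] im by (simp add: card_carrier_vec)
  with B nm have B: "B \<in> carrier_mat r r" and nr: "n \<le> r" by auto
  have "surj_mat B" using im B \<open>m = r\<close> by (simp add: surj_mat_def)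
  then obtain S where S: "S \<in> carrier_mat r r" and BS: "B * S = 1\<^sub>m r"
    using surj_mat_right_inverse[OF B] by blast
  have SB: "S * B = 1\<^sub>m r" using mat_mult_left_right_inverse[OF B S BS] .
  have ent: "row S i \<bullet> col B j = (if i = j then 1 else 0)" if "i < r" "j < r" for i j
    using arg_cong[OF SB, of "\<lambda>M. M $$ (i, j)"] that S B by simp
  have colA: "col A j = col B j" if "j < n" for j
    using that BA A B nr by (intro eq_vecI) auto
  define L where "L = mat n r (\<lambda>(i, j). S $$ (i, j))"
  define p where "p = mat (r - n) r (\<lambda>(i, j). S $$ (n + i, j))"
  define s where "s = mat r (r - n) (\<lambda>(i, j). B $$ (i, n + j))"
  have L: "L \<in> carrier_mat n r" and p: "p \<in> carrier_mat (r - n) r" and s: "s \<in> carrier_mat r (r - n)"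
    by (simp_all add: L_def p_def s_def)
  have rowL: "row L i = row S i" if "i < n" for i
    using that nr S by (intro eq_vecI) (auto simp: L_def)
  have rowp: "row p i = row S (n + i)" if "i < r - n" for i
    using that S by (intro eq_vecI) (auto simp: p_def)
  have cols: "col s i = col B (n + i)" if "i < r - n" for i
    using that B by (intro eq_vecI) (auto simp: s_def)
  have LA: "L * A = 1\<^sub>m n"
    using L A nr by (intro eq_matI) (auto simp: rowL colA ent)
  have pA: "p * A = 0\<^sub>m (r - n) n"
    using p A nr by (intro eq_matI) (auto simp: rowp colA ent)
  have ps: "p * s = 1\<^sub>m (r - n)"
    using p s by (intro eq_matI) (auto simp: rowp cols ent)
  have surj: "surj_mat p" by (rule surj_matI_right_inverse[OF p s ps])
  have "(\<lambda>v. A *\<^sub>v v) ` carrier_vec n = mat_kernel p"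
  proof (rule card_subset_eq)
    show "finite (mat_kernel p)" by (rule finite_subset[OF mat_kernel_carrier[OF p] finite_carrier_vec])
    show "(\<lambda>v. A *\<^sub>v v) ` carrier_vec n \<subseteq> mat_kernel p"
    proof clarify
      fix v :: "'k vec" assume v: "v \<in> carrier_vec n"
      have "p *\<^sub>v (A *\<^sub>v v) = (p * A) *\<^sub>v v" using assoc_mult_mat_vec[OF p A v] by simp
      then show "A *\<^sub>v v \<in> mat_kernel p" using pA v A by (intro mat_kernelI[OF p]) (auto intro!: eq_vecI)
    qed
    have "card (mat_kernel p) * CARD('k) ^ (r - n) = CARD('k) ^ n * CARD('k) ^ (r - n)"
      using card_kernel_surj[OF p surj] nr by (simp flip: power_add)
    then show "card ((\<lambda>v. A *\<^sub>v v) ` carrier_vec n) = card (mat_kernel p)"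
      using card_image_inj[OF A inj] card_field_gt_1[where ?'k = 'k] by simp
  qed
  then show thesis using that[OF nr L LA p surj] by simp
qed

lemma inj_mat_transpose:
  fixes A :: "'k::{field,finite} mat"
  assumes A: "A \<in> carrier_mat m n" and inj: "inj_mat A"
  shows "surj_mat A\<^sup>T"
proof -
  obtain L where L: "L \<in> carrier_mat n m" "L * A = 1\<^sub>m n" by (rule inj_mat_complement[OF A inj])
  have "A\<^sup>T * L\<^sup>T = 1\<^sub>m n" using transpose_mult[OF L(1) A] L(2) by simp
  then show ?thesis using A L by (intro surj_matI_right_inverse[of _ n m]) auto
qed

lemma surj_mat_transpose:
  fixes A :: "'a::field mat"
  assumes A: "A \<in> carrier_mat m n" and surj: "surj_mat A"
  shows "inj_mat A\<^sup>T"
proof -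
  obtain S where S: "S \<in> carrier_mat n m" "A * S = 1\<^sub>m m" by (rule surj_mat_right_inverse[OF A surj])
  have "S\<^sup>T * A\<^sup>T = 1\<^sub>m m" using transpose_mult[OF A S(1)] S(2) by simp
  then show ?thesis using A S by (intro inj_matI_left_inverse[of _ n m]) auto
qed

text \<open>
  Dually to \<open>inj_mat_complement\<close>, the inclusion of the kernel of \<open>A\<close> is the transpose of the cokernel of \<open>A\<^sup>T\<close>.
\<close>

lemma surj_mat_kernel:
  fixes A :: "'k::{field,finite} mat"
  assumes A: "A \<in> carrier_mat m n" and surj: "surj_mat A"
  obtains i where "i \<in> carrier_mat n (n - m)" "inj_mat i" "(\<lambda>v. i *\<^sub>v v) ` carrier_vec (n - m) = mat_kernel A"
proof -
  have At: "A\<^sup>T \<in> carrier_mat n m" using A by simp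
  obtain p where mn: "m \<le> n" and p: "p \<in> carrier_mat (n - m) n" and sp: "surj_mat p"
    and kp: "mat_kernel p = (\<lambda>v. A\<^sup>T *\<^sub>v v) ` carrier_vec m"
    by (rule inj_mat_complement[OF At surj_mat_transpose[OF A surj]])
  have pt: "p\<^sup>T \<in> carrier_mat n (n - m)" using p by simp
  have ip: "inj_mat p\<^sup>T" by (rule surj_mat_transpose[OF p sp])
  have "p * A\<^sup>T = 0\<^sub>m (n - m) m"
  proof (rule mat_eq_on_vecs)
    fix v :: "'k vec" assume v: "v \<in> carrier_vec m"
    then have "p *\<^sub>v (A\<^sup>T *\<^sub>v v) = 0\<^sub>v (n - m)" using kp mat_kernelD(2)[OF p] by auto
    then show "(p * A\<^sup>T) *\<^sub>v v = 0\<^sub>m (n - m) m *\<^sub>v v"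
      using assoc_mult_mat_vec[OF p At v] v by (auto intro!: eq_vecI)
  qed (use p A in auto)
  then have 0: "A * p\<^sup>T = 0\<^sub>m m (n - m)" using arg_cong[OF \<open>p * A\<^sup>T = _\<close>, of transpose_mat] transpose_mult[OF p At] by simp
  have "(\<lambda>v. p\<^sup>T *\<^sub>v v) ` carrier_vec (n - m) = mat_kernel A"
  proof (rule card_subset_eq)
    show "finite (mat_kernel A)" by (rule finite_subset[OF mat_kernel_carrier[OF A] finite_carrier_vec])
    show "(\<lambda>v. p\<^sup>T *\<^sub>v v) ` carrier_vec (n - m) \<subseteq> mat_kernel A"
    proof clarify
      fix v :: "'k vec" assume v: "v \<in> carrier_vec (n - m)"
      have "A *\<^sub>v (p\<^sup>T *\<^sub>v v) = (A * p\<^sup>T) *\<^sub>v v" using assoc_mult_mat_vec[OF A pt v] by simp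
      then show "p\<^sup>T *\<^sub>v v \<in> mat_kernel A" using 0 v pt by (intro mat_kernelI[OF A]) (auto intro!: eq_vecI)
    qed
    have "card (mat_kernel A) * CARD('k) ^ m = CARD('k) ^ (n - m) * CARD('k) ^ m"
      using card_kernel_surj[OF A surj] mn by (simp flip: power_add)
    then show "card ((\<lambda>v. p\<^sup>T *\<^sub>v v) ` carrier_vec (n - m)) = card (mat_kernel A)"
      using card_image_inj[OF pt ip] card_field_gt_1[where ?'k = 'k] by simp
  qed
  then show thesis using that pt ip by blast
qed

lemma inj_mat_square:
  fixes A :: "'k::{field,finite} mat"
  assumes A: "A \<in> carrier_mat n n" and inj: "inj_mat A"
  obtains L where "L \<in> carrier_mat n n" "L * A = 1\<^sub>m n" "A * L = 1\<^sub>m n"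
proof -
  obtain L where L: "L \<in> carrier_mat n n" "L * A = 1\<^sub>m n" by (rule inj_mat_complement[OF A inj])
  then show thesis using that mat_mult_left_right_inverse[OF L(1) A] by blast
qed

lemma surj_mat_square:
  fixes A :: "'a::field mat"
  assumes A: "A \<in> carrier_mat n n" and surj: "surj_mat A"
  obtains L where "L \<in> carrier_mat n n" "L * A = 1\<^sub>m n" "A * L = 1\<^sub>m n"
proof -
  obtain L where L: "L \<in> carrier_mat n n" "A * L = 1\<^sub>m n" by (rule surj_mat_right_inverse[OF A surj])
  then show thesis using that mat_mult_left_right_inverse[OF A L(1)] by blast
qed

lemma inj_mat_cancel:
  fixes \<phi> :: "'k::{field,finite} mat"
  assumes \<phi>: "\<phi> \<in> carrier_mat r n" and inj: "inj_mat \<phi>"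
    and f: "f \<in> carrier_mat n k" and g: "g \<in> carrier_mat n k" and eq: "\<phi> * f = \<phi> * g"
  shows "f = g"
proof -
  obtain L where L: "L \<in> carrier_mat n r" "L * \<phi> = 1\<^sub>m n" by (rule inj_mat_complement[OF \<phi> inj])
  have "L * \<phi> * f = L * \<phi> * g" using assoc_mult_mat[OF L(1) \<phi> f] assoc_mult_mat[OF L(1) \<phi> g] eq by simp
  then show ?thesis unfolding L(2) using left_mult_one_mat[OF f] left_mult_one_mat[OF g] by simp
qed

lemma surj_mat_cancel:
  fixes \<psi> :: "'a::field mat"
  assumes \<psi>: "\<psi> \<in> carrier_mat m r" and surj: "surj_mat \<psi>"
    and f: "f \<in> carrier_mat k m" and g: "g \<in> carrier_mat k m" and eq: "f * \<psi> = g * \<psi>"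
  shows "f = g"
proof -
  obtain S where S: "S \<in> carrier_mat r m" "\<psi> * S = 1\<^sub>m m" by (rule surj_mat_right_inverse[OF \<psi> surj])
  have "f * (\<psi> * S) = g * (\<psi> * S)" using assoc_mult_mat[OF f \<psi> S(1)] assoc_mult_mat[OF g \<psi> S(1)] eq by simp
  then show ?thesis unfolding S(2) using right_mult_one_mat[OF f] right_mult_one_mat[OF g] by simp
qed

lemma factor_inj:
  fixes \<phi> :: "'k::{field,finite} mat"
  assumes \<phi>: "\<phi> \<in> carrier_mat r n" and inj: "inj_mat \<phi>" and f: "f \<in> carrier_mat r k"
    and im: "\<And>v. v \<in> carrier_vec k \<Longrightarrow> \<exists>u\<in>carrier_vec n. f *\<^sub>v v = \<phi> *\<^sub>v u"
  obtains g where "g \<in> carrier_mat n k" "\<phi> * g = f"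
proof -
  obtain L where L: "L \<in> carrier_mat n r" "L * \<phi> = 1\<^sub>m n" by (rule inj_mat_complement[OF \<phi> inj])
  have g: "L * f \<in> carrier_mat n k" using L f by simp
  have "\<phi> * (L * f) = f"
  proof (rule mat_eq_on_vecs[of _ r k])
    fix v :: "'k vec" assume v: "v \<in> carrier_vec k"
    obtain u where u: "u \<in> carrier_vec n" "f *\<^sub>v v = \<phi> *\<^sub>v u" using im[OF v] by blast
    have "L *\<^sub>v (\<phi> *\<^sub>v u) = u" using assoc_mult_mat_vec[OF L(1) \<phi> u(1)] L(2) u(1) by simp
    then have "(L * f) *\<^sub>v v = u" using assoc_mult_mat_vec[OF L(1) f v] u(2) by simp
    then show "(\<phi> * (L * f)) *\<^sub>v v = f *\<^sub>v v" using assoc_mult_mat_vec[OF \<phi> g v] u(2) by simp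
  qed (use \<phi> L f in auto)
  with g show thesis using that by blast
qed

lemma factor_surj:
  fixes \<psi> :: "'k::{field,finite} mat"
  assumes \<psi>: "\<psi> \<in> carrier_mat m r" and surj: "surj_mat \<psi>" and f: "f \<in> carrier_mat k r"
    and ker: "\<And>v. v \<in> carrier_vec r \<Longrightarrow> \<psi> *\<^sub>v v = 0\<^sub>v m \<Longrightarrow> f *\<^sub>v v = 0\<^sub>v k"
  obtains g where "g \<in> carrier_mat k m" "g * \<psi> = f"
proof -
  obtain S where S: "S \<in> carrier_mat r m" "\<psi> * S = 1\<^sub>m m" by (rule surj_mat_right_inverse[OF \<psi> surj])
  have g: "f * S \<in> carrier_mat k m" using S f by simp
  have "f * S * \<psi> = f"
  proof (rule mat_eq_on_vecs[of _ k r])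
    fix v :: "'k vec" assume v: "v \<in> carrier_vec r"
    have pv: "\<psi> *\<^sub>v v \<in> carrier_vec m" using \<psi> v by simp
    have Spv: "S *\<^sub>v (\<psi> *\<^sub>v v) \<in> carrier_vec r" using S pv by simp
    have "\<psi> *\<^sub>v (S *\<^sub>v (\<psi> *\<^sub>v v)) = \<psi> *\<^sub>v v" using assoc_mult_mat_vec[OF \<psi> S(1) pv] S(2) pv by simp
    then have "\<psi> *\<^sub>v (S *\<^sub>v (\<psi> *\<^sub>v v) - v) = 0\<^sub>v m"
      using mult_minus_distrib_mat_vec[OF \<psi> Spv v] pv by simp
    then have "f *\<^sub>v (S *\<^sub>v (\<psi> *\<^sub>v v) - v) = 0\<^sub>v k" using ker Spv v by simp
    then have "f *\<^sub>v (S *\<^sub>v (\<psi> *\<^sub>v v)) = f *\<^sub>v v"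
      using mult_minus_distrib_mat_vec[OF f Spv v] vec_diff_eq_0_iff[of "f *\<^sub>v (S *\<^sub>v (\<psi> *\<^sub>v v))" k "f *\<^sub>v v"] f Spv v
      by simp
    then show "(f * S * \<psi>) *\<^sub>v v = f *\<^sub>v v"
      using assoc_mult_mat_vec[OF g \<psi> v] assoc_mult_mat_vec[OF f S(1) pv] by simp
  qed (use \<psi> S f in auto)
  with g show thesis using that by blast
qed

lemma row_mult_eq_transpose:
  fixes A B :: "'a::field mat"
  assumes A: "A \<in> carrier_mat m n" and B: "B \<in> carrier_mat n k" and i: "i < m"
  shows "row (A * B) i = B\<^sup>T *\<^sub>v row A i"
  using assms by (intro eq_vecI) (auto simp: comm_scalar_prod[of _ n])

text \<open>
  The Fredholm alternative \<open>im A\<^sup>T = (ker A)\<^sup>\<bottom>\<close>. Let \<open>p\<close> be the quotient map by \<open>ker A\<close>. Both \<open>A\<close> and a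
  functional \<open>v\<close> vanishing on \<open>ker A\<close> factor through \<open>p\<close>, as \<open>A = g p\<close> with \<open>g\<close> injective and \<open>v = h p\<close>;
  then \<open>h\<close> is in the range of the surjective map \<open>g\<^sup>T\<close>.
\<close>

lemma range_transpose_iff:
  fixes A :: "'k::{field,finite} mat"
  assumes A: "A \<in> carrier_mat m n" and v: "v \<in> carrier_vec n"
  shows "v \<in> (\<lambda>u. A\<^sup>T *\<^sub>v u) ` carrier_vec m \<longleftrightarrow> (\<forall>w\<in>mat_kernel A. v \<bullet> w = 0)"
proof
  assume "v \<in> (\<lambda>u. A\<^sup>T *\<^sub>v u) ` carrier_vec m"
  then obtain u where u: "u \<in> carrier_vec m" "v = A\<^sup>T *\<^sub>v u" by auto
  show "\<forall>w\<in>mat_kernel A. v \<bullet> w = 0"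
  proof
    fix w assume "w \<in> mat_kernel A"
    then have w: "w \<in> carrier_vec n" "A *\<^sub>v w = 0\<^sub>v m" using mat_kernelD[OF A] by auto
    have "v \<bullet> w = u \<bullet> (A *\<^sub>v w)" using transpose_vec_mult_scalar[OF A w(1) u(1)] u(2) by simp
    then show "v \<bullet> w = 0" using w u by simp
  qed
next
  assume orth: "\<forall>w\<in>mat_kernel A. v \<bullet> w = 0"
  obtain i l where i: "i \<in> carrier_mat n l" "inj_mat i" "(\<lambda>v. i *\<^sub>v v) ` carrier_vec l = mat_kernel A"
  proof (rule subspace_basis[of "mat_kernel A" n])
    show "0\<^sub>v n \<in> mat_kernel A" using mat_zero_vec[OF A] by (intro mat_kernelI[OF A]) auto
    show "v + w \<in> mat_kernel A" if "v \<in> mat_kernel A" "w \<in> mat_kernel A" for v w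
      using mat_kernelD[OF A that(1)] mat_kernelD[OF A that(2)]
      by (intro mat_kernelI[OF A]) (auto simp: mult_add_distrib_mat_vec[OF A])
    show "a \<cdot>\<^sub>v v \<in> mat_kernel A" if "v \<in> mat_kernel A" for v a
      by (rule mat_kernel_smult[OF A that])
  qed (use mat_kernel_carrier[OF A] in auto)
  obtain p where p: "p \<in> carrier_mat (n - l) n" "surj_mat p"
    "mat_kernel p = (\<lambda>v. i *\<^sub>v v) ` carrier_vec l"
    by (rule inj_mat_complement[OF i(1,2)])
  have ker: "w \<in> mat_kernel A" if "w \<in> carrier_vec n" "p *\<^sub>v w = 0\<^sub>v (n - l)" for w
    using mat_kernelI[OF p(1) that] i(3) p(3) by simp
  obtain g where g: "g \<in> carrier_mat m (n - l)" "g * p = A"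
    by (rule factor_surj[OF p(1,2) A mat_kernelD(2)[OF A ker]])
  have "inj_mat g" unfolding inj_mat_iff_kernel[OF g(1)]
  proof (intro ballI impI)
    fix u assume u: "u \<in> carrier_vec (n - l)" and 0: "g *\<^sub>v u = 0\<^sub>v m"
    obtain w where w: "w \<in> carrier_vec n" "p *\<^sub>v w = u"
      using p(1,2) u unfolding surj_mat_def by (metis carrier_matD imageE)
    have "A *\<^sub>v w = 0\<^sub>v m" using assoc_mult_mat_vec[OF g(1) p(1) w(1)] g(2) w(2) 0 by simp
    then have "w \<in> mat_kernel p" using w(1) i(3) p(3) by (simp add: mat_kernelI[OF A])
    then show "u = 0\<^sub>v (n - l)" using mat_kernelD(2)[OF p(1)] w(2) by simp
  qed
  then have surj: "surj_mat g\<^sup>T" by (rule inj_mat_transpose[OF g(1)])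
  define V where "V = mat 1 n (\<lambda>(i, j). v $ j)"
  have V: "V \<in> carrier_mat 1 n" and rowV: "row V 0 = v" using v by (auto simp: V_def intro!: eq_vecI)
  have "V *\<^sub>v w = 0\<^sub>v 1" if "w \<in> carrier_vec n" "p *\<^sub>v w = 0\<^sub>v (n - l)" for w
    using orth ker[OF that] V rowV by (intro eq_vecI) auto
  then obtain h where h: "h \<in> carrier_mat 1 (n - l)" "h * p = V" by (rule factor_surj[OF p(1,2) V])
  have "row h 0 \<in> carrier_vec (n - l)" using h(1) by (metis carrier_matD(2) row_carrier)
  then obtain u where u: "u \<in> carrier_vec m" "g\<^sup>T *\<^sub>v u = row h 0"
    using surj g(1) unfolding surj_mat_def by (metis carrier_matD index_transpose_mat(2,3) imageE)
  have "v = p\<^sup>T *\<^sub>v row h 0" using row_mult_eq_transpose[OF h(1) p(1), of 0] h(2) rowV by simp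
  also have "\<dots> = (p\<^sup>T * g\<^sup>T) *\<^sub>v u"
    using assoc_mult_mat_vec[of "p\<^sup>T" n "n - l" "g\<^sup>T" m u] p(1) g(1) u by simp
  also have "p\<^sup>T * g\<^sup>T = A\<^sup>T" using transpose_mult[OF g(1) p(1)] g(2) by simp
  finally show "v \<in> (\<lambda>u. A\<^sup>T *\<^sub>v u) ` carrier_vec m" using u(1) by blast
qed

section \<open>Nilpotent matrices and their Jordan form\<close>

lemma intertwine_pow:
  fixes A B X :: "'a::field mat"
  assumes A: "A \<in> carrier_mat n n" and B: "B \<in> carrier_mat m m" and X: "X \<in> carrier_mat m n"
    and XA: "X * A = B * X"
  shows "X * A ^\<^sub>m i = B ^\<^sub>m i * X"
proof (induction i)
  case 0
  then show ?case using A B X by simp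
next
  case (Suc i)
  have Ai: "A ^\<^sub>m i \<in> carrier_mat n n" and Bi: "B ^\<^sub>m i \<in> carrier_mat m m" using A B by simp_all
  have "X * A ^\<^sub>m Suc i = (X * A ^\<^sub>m i) * A" using assoc_mult_mat[OF X Ai A] by simp
  also have "\<dots> = B ^\<^sub>m i * (X * A)" unfolding Suc by (rule assoc_mult_mat[OF Bi X A])
  also have "\<dots> = B ^\<^sub>m Suc i * X" unfolding XA using assoc_mult_mat[OF Bi B X] by simp
  finally show ?case .
qed

lemma nilpotent_of_inj:
  fixes A B X :: "'a::field mat"
  assumes A: "A \<in> carrier_mat n n" and B: "B \<in> carrier_mat m m" and X: "X \<in> carrier_mat m n"
    and XA: "X * A = B * X" and inj: "inj_mat X" and nil: "nilpotent_mat B"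
  shows "nilpotent_mat A"
proof -
  obtain i where i: "B ^\<^sub>m i = 0\<^sub>m m m" using nil B by (auto simp: nilpotent_mat_def)
  have Ai: "A ^\<^sub>m i \<in> carrier_mat n n" using A by simp
  have "X * A ^\<^sub>m i = 0\<^sub>m m n" using intertwine_pow[OF A B X XA, of i] i X by simp
  have "A ^\<^sub>m i = 0\<^sub>m n n"
  proof (rule mat_eq_on_vecs[OF Ai])
    fix v :: "'a vec" assume v: "v \<in> carrier_vec n"
    have "X *\<^sub>v (A ^\<^sub>m i *\<^sub>v v) = (X * A ^\<^sub>m i) *\<^sub>v v" using assoc_mult_mat_vec[OF X Ai v] by simp
    also have "\<dots> = 0\<^sub>v m" unfolding \<open>X * A ^\<^sub>m i = 0\<^sub>m m n\<close> using v by (auto intro!: eq_vecI)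
    finally have "A ^\<^sub>m i *\<^sub>v v = 0\<^sub>v n" using inj inj_mat_iff_kernel[OF X] Ai v by simp
    then show "A ^\<^sub>m i *\<^sub>v v = 0\<^sub>m n n *\<^sub>v v" using v by (auto intro!: eq_vecI)
  qed simp
  then show ?thesis using A by (auto simp: nilpotent_mat_def)
qed

lemma nilpotent_of_surj:
  fixes A B X :: "'a::field mat"
  assumes A: "A \<in> carrier_mat n n" and B: "B \<in> carrier_mat m m" and X: "X \<in> carrier_mat m n"
    and XA: "X * A = B * X" and surj: "surj_mat X" and nil: "nilpotent_mat A"
  shows "nilpotent_mat B"
proof -
  obtain i where i: "A ^\<^sub>m i = 0\<^sub>m n n" using nil A by (auto simp: nilpotent_mat_def)
  have Bi: "B ^\<^sub>m i \<in> carrier_mat m m" using B by simp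
  obtain S where S: "S \<in> carrier_mat n m" "X * S = 1\<^sub>m m" by (rule surj_mat_right_inverse[OF X surj])
  have BX: "B ^\<^sub>m i * X = 0\<^sub>m m n" using intertwine_pow[OF A B X XA, of i] i X by simp
  have "B ^\<^sub>m i * X * S = B ^\<^sub>m i"
    using assoc_mult_mat[OF Bi X S(1)] S(2) right_mult_one_mat[OF Bi] by simp
  then have "B ^\<^sub>m i = 0\<^sub>m m m" using BX S by simp
  then show ?thesis using B by (auto simp: nilpotent_mat_def)
qed

lemma nilpotent_transpose:
  fixes A :: "'a::field mat"
  assumes A: "A \<in> carrier_mat n n" and nil: "nilpotent_mat A"
  shows "nilpotent_mat A\<^sup>T"
proof -
  obtain i where i: "A ^\<^sub>m i = 0\<^sub>m n n" using nil A by (auto simp: nilpotent_mat_def)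
  have "A\<^sup>T ^\<^sub>m i = (A ^\<^sub>m i)\<^sup>T"
  proof (induction i)
    case (Suc i)
    have Ai: "A ^\<^sub>m i \<in> carrier_mat n n" using A by simp
    have comm: "A ^\<^sub>m i * A = A * A ^\<^sub>m i" using intertwine_pow[OF A A A refl] by simp
    have "A\<^sup>T ^\<^sub>m Suc i = (A ^\<^sub>m i)\<^sup>T * A\<^sup>T" using Suc by simp
    also have "\<dots> = (A * A ^\<^sub>m i)\<^sup>T" using transpose_mult[OF A Ai] by simp
    finally show ?case using comm by simp
  qed (use A in simp)
  then show ?thesis using i A by (auto simp: nilpotent_mat_def)
qed

lemma nilpotent_singular:
  fixes A :: "'a::field mat"
  assumes A: "A \<in> carrier_mat n n" and nil: "nilpotent_mat A" and n: "n > 0"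
  shows "\<not> inj_mat A"
proof
  assume inj: "inj_mat A"
  obtain i where i: "A ^\<^sub>m i = 0\<^sub>m n n" using nil A by (auto simp: nilpotent_mat_def)
  have pow: "v = 0\<^sub>v n" if "v \<in> carrier_vec n" "A ^\<^sub>m i *\<^sub>v v = 0\<^sub>v n" for v i
    using that
  proof (induction i arbitrary: v)
    case (Suc i)
    have Ai: "A ^\<^sub>m i \<in> carrier_mat n n" using A by simp
    have "A ^\<^sub>m i *\<^sub>v (A *\<^sub>v v) = 0\<^sub>v n" using Suc.prems assoc_mult_mat_vec[OF Ai A] by simp
    then have "A *\<^sub>v v = 0\<^sub>v n" using Suc A by simp
    then show ?case using inj inj_mat_iff_kernel[OF A] Suc.prems by blast
  qed (use A in auto)
  have zero_mult_unit: "0\<^sub>m n n *\<^sub>v unit_vec n 0 = (0\<^sub>v n :: 'a vec)" by (intro eq_vecI) auto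
  from pow[of "unit_vec n 0" i] have "unit_vec n 0 = (0\<^sub>v n :: 'a vec)"
    unfolding i using zero_mult_unit by simp
  then have "unit_vec n 0 $ 0 = (0 :: 'a)" using n by simp
  then show False using n by simp
qed

lemma similar_matE:
  assumes "similar_mat A B"
  obtains P Q n where "A \<in> carrier_mat n n" "B \<in> carrier_mat n n" "P \<in> carrier_mat n n"
    "Q \<in> carrier_mat n n" "P * Q = 1\<^sub>m n" "Q * P = 1\<^sub>m n" "A = P * B * Q"
proof -
  from assms obtain P Q where "similar_mat_wit A B P Q" unfolding similar_mat_def by blast
  from similar_mat_witD[OF refl this] show thesis using that by blast
qed

lemma similar_mat_rep_iso:
  assumes "similar_mat A B"
  shows "rep_iso A B \<noteq> {}"
proof -
  from assms obtain P Q n where w: "A \<in> carrier_mat n n" "B \<in> carrier_mat n n" "P \<in> carrier_mat n n"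
    "Q \<in> carrier_mat n n" "P * Q = 1\<^sub>m n" "Q * P = 1\<^sub>m n" "A = P * B * Q"
    by (rule similar_matE)
  have "Q * A = Q * (P * (B * Q))" unfolding w(7) by (simp only: assoc_mult_mat[OF w(3,2,4)])
  also have "\<dots> = (Q * P) * (B * Q)" by (rule assoc_mult_mat[symmetric, OF w(4,3) mult_carrier_mat[OF w(2,4)]])
  also have "\<dots> = B * Q" unfolding w(6) by (rule left_mult_one_mat[OF mult_carrier_mat[OF w(2,4)]])
  finally have "Q \<in> rep_iso A B" by (rule rep_isoI[OF w(1,2,4,3,6,5)])
  then show ?thesis by blast
qed

lemma rep_iso_similar_mat:
  assumes "rep_iso A B \<noteq> {}" "square_mat A" "square_mat B"
  shows "similar_mat A B"
proof -
  from assms(1) obtain X where "X \<in> rep_iso A B" by blast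
  from rep_isoE[OF this assms(2,3)] obtain Y n where w: "A \<in> carrier_mat n n" "B \<in> carrier_mat n n"
    "X \<in> carrier_mat n n" "Y \<in> carrier_mat n n" "X * Y = 1\<^sub>m n" "Y * X = 1\<^sub>m n" "X * A = B * X" by metis
  have "Y * B * X = Y * (X * A)" using w assoc_mult_mat[of Y n n B n X n] by simp
  also have "\<dots> = (Y * X) * A" by (rule assoc_mult_mat[symmetric]) (use w in auto)
  finally have "A = Y * B * X" using w by simp
  then show ?thesis using w by (intro similar_matI[of _ _ Y X n]) auto
qed

text \<open>
  Over a field that is not algebraically closed a nilpotent matrix is still triangularizable: a
  kernel vector is completed to a basis, and the matrix induced on the quotient by its line is
  again nilpotent.
\<close>

lemma nilpotent_triangularizable:
  fixes A :: "'k::{field,finite} mat"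
  assumes "A \<in> carrier_mat n n" "nilpotent_mat A"
  shows "\<exists>T. upper_triangular T \<and> (\<forall>i<n. T $$ (i, i) = 0) \<and> similar_mat A T"
  using assms
proof (induction n arbitrary: A)
  case 0
  then show ?case by (intro exI[of _ A]) (auto intro: similar_mat_refl)
next
  case (Suc n)
  note A = Suc.prems(1) and nil = Suc.prems(2)
  let ?n = "Suc n"
  obtain v where v: "v \<in> carrier_vec ?n" "A *\<^sub>v v = 0\<^sub>v ?n" "v \<noteq> 0\<^sub>v ?n"
    using nilpotent_singular[OF A nil] inj_mat_iff_kernel[OF A] by auto
  define c where "c = mat ?n 1 (\<lambda>(i, j). v $ i)"
  have c: "c \<in> carrier_mat ?n 1" by (simp add: c_def)
  have cu: "c *\<^sub>v u = u $ 0 \<cdot>\<^sub>v v" if "u \<in> carrier_vec 1" for u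
    using that v(1) by (intro eq_vecI) (auto simp: c_def scalar_prod_def)
  have "inj_mat c" unfolding inj_mat_iff_kernel[OF c]
  proof (intro ballI impI)
    fix u assume u: "u \<in> carrier_vec 1" and 0: "c *\<^sub>v u = 0\<^sub>v ?n"
    obtain i where i: "i < ?n" "v $ i \<noteq> 0" using v by (metis eq_vecI carrier_vecD index_zero_vec)
    have "u $ 0 * v $ i = 0" using arg_cong[OF 0, of "\<lambda>x. x $ i"] i v(1) cu[OF u] by simp
    then show "u = 0\<^sub>v 1" using i u by (intro eq_vecI) auto
  qed
  then obtain B m where B: "B \<in> carrier_mat ?n m" "inj_mat B"
    "(\<lambda>v. B *\<^sub>v v) ` carrier_vec m = carrier_vec ?n" "\<And>i j. i < ?n \<Longrightarrow> j < 1 \<Longrightarrow> B $$ (i, j) = c $$ (i, j)"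
  proof (rule extend_to_basis[OF c _ subset_refl])
    show "(\<lambda>v. c *\<^sub>v v) ` carrier_vec 1 \<subseteq> carrier_vec ?n" using c by auto
  qed auto
  have "m = ?n" using card_image_inj[OF B(1,2)] B(3) by (simp only: card_carrier_vec card_field_power_inject)
  with B have Bc: "B \<in> carrier_mat ?n ?n" by simp
  obtain L where L: "L \<in> carrier_mat ?n ?n" "L * B = 1\<^sub>m ?n" "B * L = 1\<^sub>m ?n"
    by (rule inj_mat_square[OF Bc B(2)])
  have col0: "B *\<^sub>v unit_vec ?n 0 = v"
    using mult_unit_vec[OF Bc, of 0] Bc B(4)[of _ 0] v(1) by (auto intro!: eq_vecI simp: c_def)
  define A' where "A' = L * A * B"
  have A': "A' \<in> carrier_mat ?n ?n" using A L Bc by (simp add: A'_def)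
  have LA': "B * A' = A * B"
  proof -
    have "B * A' = B * (L * (A * B))" using A L Bc by (simp add: A'_def assoc_mult_mat[of _ ?n ?n _ ?n _ ?n])
    also have "\<dots> = (B * L) * (A * B)" by (rule assoc_mult_mat[symmetric]) (use A L Bc in auto)
    finally show ?thesis using L A Bc by simp
  qed
  have sim: "similar_mat A A'"
  proof -
    have "A = B * A' * L" using assoc_mult_mat[OF A Bc L(1)] L A by (simp add: LA')
    then show ?thesis using A A' Bc L by (intro similar_matI[of _ _ B L ?n]) auto
  qed
  have nil': "nilpotent_mat A'" by (rule nilpotent_of_inj[OF A' A Bc LA' B(2) nil])
  have "A' *\<^sub>v unit_vec ?n 0 = L *\<^sub>v (A *\<^sub>v (B *\<^sub>v unit_vec ?n 0))"
    using A L Bc by (simp add: A'_def assoc_mult_mat_vec[of _ ?n ?n _ ?n])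
  also have "\<dots> = 0\<^sub>v ?n" unfolding col0 v(2) by (rule mat_zero_vec[OF L(1)])
  finally have "col A' 0 = 0\<^sub>v ?n" using mult_unit_vec[OF A', of 0] by simp
  then have z: "A' $$ (i, 0) = 0" if "i < ?n" for i
    using that A' by (metis carrier_matD index_col index_zero_vec(1) zero_less_Suc)
  define X where "X = mat 1 n (\<lambda>(i, j). A' $$ (0, Suc j))"
  define D where "D = mat n n (\<lambda>(i, j). A' $$ (Suc i, Suc j))"
  define p where "p = mat n ?n (\<lambda>(i, j). if j = Suc i then 1 else 0 :: 'k)"
  define s where "s = mat ?n n (\<lambda>(i, j). if i = Suc j then 1 else 0 :: 'k)"
  have D: "D \<in> carrier_mat n n" and p: "p \<in> carrier_mat n ?n" and X: "X \<in> carrier_mat 1 n"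
    and s: "s \<in> carrier_mat ?n n"
    by (simp_all add: D_def p_def X_def s_def)
  have rowp: "row p i = unit_vec ?n (Suc i)" if "i < n" for i
    using that by (intro eq_vecI) (auto simp: p_def)
  have cols: "col s i = unit_vec ?n (Suc i)" if "i < n" for i
    using that by (intro eq_vecI) (auto simp: s_def)
  have "p * s = 1\<^sub>m n" using p s by (intro eq_matI) (auto simp: rowp cols)
  then have "surj_mat p" by (rule surj_matI_right_inverse[OF p s])
  moreover have "p * A' = D * p"
  proof (rule eq_matI)
    fix i j assume "i < dim_row (D * p)" "j < dim_col (D * p)"
    then have i: "i < n" and j: "j < ?n" using D p by auto
    have l: "(p * A') $$ (i, j) = A' $$ (Suc i, j)" using i j p A' by (simp add: rowp)
    show "(p * A') $$ (i, j) = (D * p) $$ (i, j)"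
    proof (cases j)
      case 0
      have "col p 0 = 0\<^sub>v n" by (intro eq_vecI) (auto simp: p_def)
      then have "(D * p) $$ (i, j) = 0" using i j D p 0 by simp
      then show ?thesis using l z[of "Suc i"] i 0 by simp
    next
      case (Suc k)
      have "col p j = unit_vec n k" using j Suc by (intro eq_vecI) (auto simp: p_def)
      then have "(D * p) $$ (i, j) = D $$ (i, k)" using i j D p Suc by simp
      then show ?thesis using l i j Suc by (simp add: D_def)
    qed
  qed (use D p A' in auto)
  ultimately have "nilpotent_mat D" using nilpotent_of_surj[OF A' D p] nil' by blast
  then obtain T where T: "upper_triangular T" "\<forall>i<n. T $$ (i, i) = 0" "similar_mat D T"
    using Suc.IH[OF D] by blast
  have split: "A' = four_block_mat (0\<^sub>m 1 1) X (0\<^sub>m n 1) D"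
    using A' z by (intro eq_matI) (auto simp: X_def D_def four_block_mat_def Let_def)
  obtain X' where X': "X' \<in> carrier_mat 1 n"
    "similar_mat A' (four_block_mat (0\<^sub>m 1 1) X' (0\<^sub>m n 1) T)"
    using similar_mat_four_block_0_ex[OF similar_mat_refl[OF zero_carrier_mat] T(3) X zero_carrier_mat D]
    unfolding split by blast
  have Tc: "T \<in> carrier_mat n n" using similar_matD[OF T(3)] D by auto
  have "upper_triangular (four_block_mat (0\<^sub>m 1 1) X' (0\<^sub>m n 1) T)"
    by (rule upper_triangular_four_block[OF _ Tc _ T(1)]) (auto simp: upper_triangular_def)
  moreover have "four_block_mat (0\<^sub>m 1 1) X' (0\<^sub>m n 1) T $$ (i, i) = 0" if "i < ?n" for i
    using that Tc T(2) by (auto simp: four_block_mat_def Let_def)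
  ultimately show ?case using similar_mat_trans[OF sim X'(2)] by blast
qed

abbreviation nilpotent_jordan :: "nat list \<Rightarrow> 'a::field mat" where
  "nilpotent_jordan rs \<equiv> jordan_matrix (map (\<lambda>r. (r, 0)) rs)"

lemma nilpotent_jordan_Cons:
  "nilpotent_jordan (r # rs) = four_block_mat (jordan_block r 0) (0\<^sub>m r (sum_list rs))
     (0\<^sub>m (sum_list rs) r) (nilpotent_jordan rs)"
  by (simp add: jordan_matrix_Cons o_def)

lemma nilpotent_jordan_carrier [simp]: "nilpotent_jordan rs \<in> carrier_mat (sum_list rs) (sum_list rs)"
  by (intro carrier_matI) (simp_all add: o_def)

text \<open>
  In \<open>rep_of_partition\<close> the blocks are listed in increasing order. Exchanging adjacent blocks only
  permutes the basis, so insertion sort brings an arbitrary list of blocks into this form.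
\<close>

lemma similar_four_block_swap:
  fixes A B :: "'a::field mat"
  assumes A: "A \<in> carrier_mat n n" and B: "B \<in> carrier_mat m m"
  shows "similar_mat (four_block_mat A (0\<^sub>m n m) (0\<^sub>m m n) B) (four_block_mat B (0\<^sub>m m n) (0\<^sub>m n m) A)"
proof -
  let ?P = "four_block_mat (0\<^sub>m n m) (1\<^sub>m n) (1\<^sub>m m) (0\<^sub>m m n) :: 'a mat"
  let ?Q = "four_block_mat (0\<^sub>m m n) (1\<^sub>m m) (1\<^sub>m n) (0\<^sub>m n m) :: 'a mat"
  let ?A = "four_block_mat A (0\<^sub>m n m) (0\<^sub>m m n) B"
  let ?B = "four_block_mat B (0\<^sub>m m n) (0\<^sub>m n m) A"
  have one: "four_block_mat (1\<^sub>m n) (0\<^sub>m n m) (0\<^sub>m m n) (1\<^sub>m m) = (1\<^sub>m (n + m) :: 'a mat)" for n m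
    by (intro eq_matI) auto
  have idem: "1\<^sub>m n * 1\<^sub>m n = (1\<^sub>m n :: 'a mat)" for n by (rule left_mult_one_mat[OF one_carrier_mat])
  have PQ: "?P * ?Q = 1\<^sub>m (n + m)"
    by (subst mult_four_block_mat[of _ n m _ n _ m _ _ n _ m]) (simp_all add: one idem left_add_zero_mat[OF one_carrier_mat] right_add_zero_mat[OF one_carrier_mat])
  have QP: "?Q * ?P = 1\<^sub>m (m + n)"
    by (subst mult_four_block_mat[of _ m n _ m _ n _ _ m _ n]) (simp_all add: one idem left_add_zero_mat[OF one_carrier_mat] right_add_zero_mat[OF one_carrier_mat])
  have PB: "?P * ?B = four_block_mat (0\<^sub>m n m) A B (0\<^sub>m m n)"
    using A B by (subst mult_four_block_mat[of _ n m _ n _ m _ _ m _ n]) auto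
  have "?P * ?B * ?Q = ?A"
    unfolding PB using A B by (subst mult_four_block_mat[of _ n m _ n _ m _ _ n _ m]) auto
  then show ?thesis using PQ QP A B
    by (intro similar_matI[of _ _ ?P ?Q "n + m"]) (auto simp: add.commute)
qed

lemma nilpotent_jordan_swap:
  "similar_mat (nilpotent_jordan (r # s # rs) :: 'a::field mat) (nilpotent_jordan (s # r # rs))"
proof -
  let ?J = "\<lambda>r. jordan_block r (0 :: 'a)" and ?R = "nilpotent_jordan rs :: 'a mat" and ?n = "sum_list rs"
  have assoc: "nilpotent_jordan (r # s # rs) = four_block_mat
      (four_block_mat (?J r) (0\<^sub>m r s) (0\<^sub>m s r) (?J s)) (0\<^sub>m (r + s) ?n) (0\<^sub>m ?n (r + s)) ?R" for r s
    using assoc_four_block_mat[of "?J r" "?J s" ?R] unfolding nilpotent_jordan_Cons by (simp add: o_def)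
  have "similar_mat (nilpotent_jordan (r # s # rs) :: 'a mat) (four_block_mat
      (four_block_mat (?J s) (0\<^sub>m s r) (0\<^sub>m r s) (?J r)) (0\<^sub>m (r + s) ?n) (0\<^sub>m ?n (r + s)) ?R)"
    unfolding assoc by (intro similar_mat_four_block_0_0 similar_four_block_swap similar_mat_refl) auto
  then show ?thesis unfolding assoc[of s r] by (simp add: add.commute)
qed

lemma nilpotent_jordan_cong_Cons:
  assumes "similar_mat (nilpotent_jordan rs :: 'a::field mat) (nilpotent_jordan ss)" "sum_list rs = sum_list ss"
  shows "similar_mat (nilpotent_jordan (r # rs) :: 'a mat) (nilpotent_jordan (r # ss))"
  unfolding nilpotent_jordan_Cons assms(2)[symmetric]
  by (intro similar_mat_four_block_0_0 similar_mat_refl assms(1)) auto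

lemma nilpotent_jordan_sort: "similar_mat (nilpotent_jordan rs :: 'a::field mat) (nilpotent_jordan (sort rs))"
proof (induction rs)
  case Nil
  show ?case using similar_mat_refl[OF nilpotent_jordan_carrier[of "[]"]] by simp
next
  case (Cons r rs)
  have refl: "similar_mat (nilpotent_jordan xs :: 'a mat) (nilpotent_jordan xs)" for xs
    by (rule similar_mat_refl[OF nilpotent_jordan_carrier])
  have ins: "similar_mat (nilpotent_jordan (r # xs) :: 'a mat) (nilpotent_jordan (insort r xs))" for xs
  proof (induction xs)
    case Nil
    show ?case using refl[of "[r]"] by simp
  next
    case (Cons x xs)
    have "sum_list (r # xs) = sum_list (insort r xs)"
      by (metis mset_insort mset.simps(2) sum_mset_sum_list)
    then have "similar_mat (nilpotent_jordan (x # r # xs) :: 'a mat) (nilpotent_jordan (x # insort r xs))"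
      by (rule nilpotent_jordan_cong_Cons[OF Cons])
    from similar_mat_trans[OF nilpotent_jordan_swap this] show ?case
      using refl[of "r # x # xs"] by (cases "r \<le> x") simp_all
  qed
  have "similar_mat (nilpotent_jordan (r # rs) :: 'a mat) (nilpotent_jordan (r # sort rs))"
    by (rule nilpotent_jordan_cong_Cons[OF Cons]) (metis mset_sort sum_mset_sum_list)
  from similar_mat_trans[OF this ins] show ?case by simp
qed

lemma nilpotent_jordan_form:
  fixes A :: "'k::{field,finite} mat"
  assumes A: "A \<in> carrier_mat n n" and nil: "nilpotent_mat A"
  obtains \<mu> where "\<mu> \<in> partitions_of n" "similar_mat A (nilpotent_jordan (sorted_list_of_multiset \<mu>))"
proof -
  obtain T where T: "upper_triangular T" "\<forall>i<n. T $$ (i, i) = 0" "similar_mat A T"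
    using nilpotent_triangularizable[OF A nil] by blast
  have Tc: "T \<in> carrier_mat n n" using similar_matD[OF T(3)] A by auto
  let ?as = "triangular_to_jnf_vector T"
  have jnf: "jordan_nf T ?as" by (rule triangular_to_jnf_vector[OF Tc T(1)])
  have zero: "a = 0" if "(r, a) \<in> set ?as" for r a
  proof -
    have "r \<noteq> 0" using jnf that by (force simp: jordan_nf_def)
    have "0 = poly (char_poly T) a"
      unfolding jordan_nf_char_poly[OF jnf] using that \<open>r \<noteq> 0\<close>
      by (auto simp: poly_prod_list prod_list_zero_iff o_def image_iff intro!: bexI[of _ "(r, a)"])
    also have "char_poly T = (\<Prod>a\<leftarrow>diag_mat T. [:- a, 1:])"
      by (rule char_poly_upper_triangular[OF Tc T(1)])
    also have "diag_mat T = replicate n 0"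
      using T(2) Tc by (intro nth_equalityI) (auto simp: diag_mat_def)
    finally have "a ^ n = 0" by (simp add: poly_prod_list prod_list_replicate)
    then show ?thesis by simp
  qed
  define rs where "rs = map fst ?as"
  have as: "?as = map (\<lambda>r. (r, 0)) rs"
  proof -
    have "map (\<lambda>x. (fst x, 0)) ?as = ?as" by (rule map_idI) (use zero in force)
    then show ?thesis by (simp add: rs_def o_def)
  qed
  have sim: "similar_mat A (nilpotent_jordan rs)"
    using similar_mat_trans[OF T(3)] jnf unfolding jordan_nf_def as[symmetric] by blast
  have "0 \<notin> set rs" using jnf by (auto simp: jordan_nf_def rs_def)
  moreover have "sum_list rs = n"
  proof -
    obtain m where m: "A \<in> carrier_mat m m" "nilpotent_jordan rs \<in> (carrier_mat m m :: 'k mat set)"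
      by (rule similar_matE[OF sim])
    then have "sum_list rs = m" using nilpotent_jordan_carrier[of rs, where ?'a = 'k] by (auto simp: o_def)
    then show ?thesis using m(1) A by (metis carrier_matD(1))
  qed
  ultimately have "mset rs \<in> partitions_of n" by (simp add: partitions_of_def sum_mset_sum_list)
  moreover have "similar_mat A (nilpotent_jordan (sorted_list_of_multiset (mset rs)))"
    unfolding sorted_list_of_multiset_mset by (rule similar_mat_trans[OF sim nilpotent_jordan_sort])
  ultimately show thesis using that by blast
qed

text \<open>
  Reversing the order of the basis transposes a Jordan block. Consequently a nilpotent representation
  is isomorphic to its dual, which is the source of commutativity in the Hall algebra.
\<close>

lemma similar_jordan_block_transpose:
  "similar_mat (jordan_block n (0 :: 'a::field)) (jordan_block n 0)\<^sup>T"
proof -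
  let ?J = "jordan_block n (0 :: 'a)"
  define P where "P = mat n n (\<lambda>(i, j). if Suc (i + j) = n then 1 else 0 :: 'a)"
  have P: "P \<in> carrier_mat n n" and J: "?J \<in> carrier_mat n n" by (simp_all add: P_def)
  have rowP: "row P i = unit_vec n (n - Suc i)" if "i < n" for i
    using that by (intro eq_vecI) (auto simp: P_def)
  have colP: "col P i = unit_vec n (n - Suc i)" if "i < n" for i
    using that by (intro eq_vecI) (auto simp: P_def)
  have PP: "P * P = 1\<^sub>m n"
    using P by (intro eq_matI) (auto simp: rowP colP)
  have PJ: "P * ?J = ?J\<^sup>T * P"
    using P J by (intro eq_matI) (auto simp: rowP colP jordan_block_def)
  have "P * ?J\<^sup>T * P = P * (P * ?J)" using P J assoc_mult_mat[of P n n "?J\<^sup>T" n P n] PJ by simp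
  also have "\<dots> = P * P * ?J" by (rule assoc_mult_mat[symmetric]) (use P J in auto)
  also have "\<dots> = ?J" unfolding PP by (rule left_mult_one_mat[OF J])
  finally have "?J = P * ?J\<^sup>T * P" by (rule sym)
  from similar_matI[OF _ PP PP this] show ?thesis using P J by simp
qed

lemma similar_nilpotent_jordan_transpose:
  "similar_mat (nilpotent_jordan rs :: 'a::field mat) (nilpotent_jordan rs)\<^sup>T"
proof (induction rs)
  case Nil
  show ?case by (auto intro!: similar_mat_refl[of _ 0] simp: jordan_matrix_def)
next
  case (Cons r rs)
  have "(nilpotent_jordan (r # rs) :: 'a mat)\<^sup>T = four_block_mat (jordan_block r 0)\<^sup>T (0\<^sub>m r (sum_list rs))
     (0\<^sub>m (sum_list rs) r) (nilpotent_jordan rs)\<^sup>T"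
    unfolding nilpotent_jordan_Cons
    by (subst transpose_four_block_mat[of _ r r _ "sum_list rs" _ "sum_list rs"]) (auto simp: o_def)
  then show ?case unfolding nilpotent_jordan_Cons
    by (simp only:) (intro similar_mat_four_block_0_0 similar_jordan_block_transpose Cons; simp add: o_def carrier_matI)
qed

lemma similar_mat_transpose_cong:
  fixes A B :: "'a::field mat"
  assumes "similar_mat A B"
  shows "similar_mat A\<^sup>T B\<^sup>T"
proof -
  from assms obtain P Q n where w: "A \<in> carrier_mat n n" "B \<in> carrier_mat n n" "P \<in> carrier_mat n n"
    "Q \<in> carrier_mat n n" "P * Q = 1\<^sub>m n" "Q * P = 1\<^sub>m n" "A = P * B * Q"
    by (rule similar_matE)
  have PB: "P * B \<in> carrier_mat n n" using w by simp
  have "A\<^sup>T = Q\<^sup>T * (B\<^sup>T * P\<^sup>T)" unfolding w(7)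
    using transpose_mult[OF PB w(4)] transpose_mult[OF w(3,2)] by simp
  also have "\<dots> = Q\<^sup>T * B\<^sup>T * P\<^sup>T" by (rule assoc_mult_mat[symmetric]) (use w(2-4) in auto)
  finally have "A\<^sup>T = Q\<^sup>T * B\<^sup>T * P\<^sup>T" .
  moreover have "Q\<^sup>T * P\<^sup>T = 1\<^sub>m n" "P\<^sup>T * Q\<^sup>T = 1\<^sub>m n"
    unfolding transpose_mult[OF w(3,4), symmetric] transpose_mult[OF w(4,3), symmetric] w(5,6)
    by simp_all
  ultimately show ?thesis using w(1-4) similar_matI[of "A\<^sup>T" "B\<^sup>T" "Q\<^sup>T" "P\<^sup>T" n] by simp
qed

lemma nilpotent_similar_transpose:
  fixes A :: "'k::{field,finite} mat"
  assumes "A \<in> carrier_mat n n" and "nilpotent_mat A"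
  shows "similar_mat A A\<^sup>T"
proof -
  obtain \<mu> where "\<mu> \<in> partitions_of n" and sim: "similar_mat A (nilpotent_jordan (sorted_list_of_multiset \<mu>))"
    by (rule nilpotent_jordan_form[OF assms])
  from similar_mat_trans[OF similar_mat_trans[OF sim similar_nilpotent_jordan_transpose]
      similar_mat_sym[OF similar_mat_transpose_cong[OF sim]]]
  show ?thesis .
qed

lemma card_kernel_similar:
  fixes A B :: "'k::{field,finite} mat"
  assumes "similar_mat A B"
  shows "card (mat_kernel A) = card (mat_kernel B)"
proof -
  have le: "card (mat_kernel A) \<le> card (mat_kernel B)" if sim: "similar_mat A B" for A B :: "'k mat"
  proof -
    from sim obtain P Q n where w: "A \<in> carrier_mat n n" "B \<in> carrier_mat n n" "P \<in> carrier_mat n n"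
      "Q \<in> carrier_mat n n" "P * Q = 1\<^sub>m n" "Q * P = 1\<^sub>m n" "A = P * B * Q"
      by (rule similar_matE)
    have BQ: "B * Q \<in> carrier_mat n n" using w by simp
    have "Q * A = Q * (P * (B * Q))" unfolding w(7) by (simp only: assoc_mult_mat[OF w(3,2,4)])
    also have "\<dots> = (Q * P) * (B * Q)" by (rule assoc_mult_mat[symmetric, OF w(4,3) BQ])
    also have "\<dots> = B * Q" unfolding w(6) by (rule left_mult_one_mat[OF BQ])
    finally have QA: "Q * A = B * Q" .
    have inj: "inj_mat Q" by (rule inj_matI_left_inverse[OF w(4,3,5)])
    show ?thesis
    proof (rule card_inj_on_le[of "\<lambda>v. Q *\<^sub>v v"])
      show "inj_on (\<lambda>v. Q *\<^sub>v v) (mat_kernel A)"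
        using inj w mat_kernel_carrier[OF w(1)] by (auto simp: inj_mat_def intro: inj_on_subset)
      show "(\<lambda>v. Q *\<^sub>v v) ` mat_kernel A \<subseteq> mat_kernel B"
      proof clarify
        fix v assume "v \<in> mat_kernel A"
        then have v: "v \<in> carrier_vec n" "A *\<^sub>v v = 0\<^sub>v n" using mat_kernelD[OF w(1)] by auto
        have "B *\<^sub>v (Q *\<^sub>v v) = Q *\<^sub>v (A *\<^sub>v v)"
          using assoc_mult_mat_vec[OF w(2,4) v(1)] assoc_mult_mat_vec[OF w(4,1) v(1)] QA by simp
        then show "Q *\<^sub>v v \<in> mat_kernel B"
          using v w mat_zero_vec[OF w(4)] by (intro mat_kernelI[OF w(2)]) auto
      qed
      show "finite (mat_kernel B)" by (rule finite_subset[OF mat_kernel_carrier[OF w(2)] finite_carrier_vec])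
    qed
  qed
  show ?thesis using le[OF assms] le[OF similar_mat_sym[OF assms]] by (rule le_antisym)
qed

lemma card_kernel_pow_similar:
  fixes A B :: "'k::{field,finite} mat"
  assumes "similar_mat A B"
  shows "card (mat_kernel (A ^\<^sub>m i)) = card (mat_kernel (B ^\<^sub>m i))"
proof (rule card_kernel_similar)
  show "similar_mat (A ^\<^sub>m i) (B ^\<^sub>m i)"
    using assms similar_mat_wit_pow unfolding similar_mat_def by blast
qed

text \<open>
  The kernel of the \<open>i\<close>-th power is spanned by the first \<open>i\<close> unit vectors.
\<close>

lemma card_kernel_jordan_block_pow:
  assumes "i \<le> n"
  shows "card (mat_kernel (jordan_block n (0 :: 'k::{field,finite}) ^\<^sub>m i)) = CARD('k) ^ i"
proof -
  let ?J = "jordan_block n (0 :: 'k) ^\<^sub>m i"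
  have J: "?J \<in> carrier_mat n n" by simp
  define s where "s = mat n i (\<lambda>(r, c). if r = c then 1 else 0 :: 'k)"
  have s: "s \<in> carrier_mat n i" by (simp add: s_def)
  have su: "(s *\<^sub>v u) $ r = (if r < i then u $ r else 0)" if u: "u \<in> carrier_vec i" and r: "r < n" for u r
  proof -
    have "(s *\<^sub>v u) $ r = (\<Sum>c = 0..<i. (if r = c then 1 else 0) * u $ c)"
      using u r by (simp add: s_def scalar_prod_def)
    also have "\<dots> = (\<Sum>c = 0..<i. if r = c then u $ c else 0)" by (intro sum.cong) auto
    finally have "(s *\<^sub>v u) $ r = (\<Sum>c = 0..<i. if r = c then u $ c else 0)" .
    then show ?thesis by simp
  qed
  have inj: "inj_mat s" unfolding inj_mat_iff_kernel[OF s]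
  proof (intro ballI impI)
    fix u assume u: "u \<in> carrier_vec i" and "s *\<^sub>v u = 0\<^sub>v n"
    then show "u = 0\<^sub>v i" using su[OF u] assms
      by (intro eq_vecI) (auto, metis index_zero_vec(1) less_le_trans)
  qed
  have Jv: "(?J *\<^sub>v v) $ r = (if r + i < n then v $ (r + i) else 0)"
    if v: "v \<in> carrier_vec n" and r: "r < n" for v r
  proof -
    have "(?J *\<^sub>v v) $ r = (\<Sum>c = 0..<n. (if r \<le> c \<and> c - r = i then 1 else 0) * v $ c)"
      using v r by (simp add: jordan_block_zero_pow scalar_prod_def)
    also have "\<dots> = (\<Sum>c = 0..<n. if c = r + i then v $ c else 0)" by (intro sum.cong) auto
    finally have "(?J *\<^sub>v v) $ r = (\<Sum>c = 0..<n. if c = r + i then v $ c else 0)" .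
    then show ?thesis by simp
  qed
  have "mat_kernel ?J = (\<lambda>u. s *\<^sub>v u) ` carrier_vec i"
  proof (intro subset_antisym subsetI)
    fix v assume "v \<in> mat_kernel ?J"
    then have v: "v \<in> carrier_vec n" "?J *\<^sub>v v = 0\<^sub>v n" using mat_kernelD[OF J] by auto
    have 0: "v $ c = 0" if "c < n" "i \<le> c" for c
      using Jv[OF v(1), of "c - i"] v(2) that by simp
    have "v = s *\<^sub>v vec i (\<lambda>r. v $ r)"
      using v(1) 0 s by (intro eq_vecI) (auto simp: su simp del: index_mult_mat_vec)
    then show "v \<in> (\<lambda>u. s *\<^sub>v u) ` carrier_vec i" by (rule image_eqI) simp
  next
    fix v assume "v \<in> (\<lambda>u. s *\<^sub>v u) ` carrier_vec i"
    then obtain u where u: "u \<in> carrier_vec i" "v = s *\<^sub>v u" by auto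
    then have v: "v \<in> carrier_vec n" using s by simp
    have "?J *\<^sub>v v = 0\<^sub>v n"
      using J Jv[OF v] by (intro eq_vecI) (auto simp: su[OF u(1)] u(2) simp del: index_mult_mat_vec)
    then show "v \<in> mat_kernel ?J" using v by (intro mat_kernelI[OF J])
  qed
  then show ?thesis using card_image_inj[OF s inj] by simp
qed

lemma card_kernel_nilpotent_jordan:
  assumes "0 \<notin> set rs"
  shows "card (mat_kernel (nilpotent_jordan rs :: 'k::{field,finite} mat)) = CARD('k) ^ length rs"
  using assms
proof (induction rs)
  case Nil
  have "mat_kernel (nilpotent_jordan [] :: 'k mat) = carrier_vec 0"
    by (auto simp: mat_kernel_def jordan_matrix_def intro!: eq_vecI)
  then show ?case by (simp add: card_carrier_vec)
next
  case (Cons r rs)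
  let ?n = "sum_list rs" and ?J = "jordan_block r (0 :: 'k)" and ?R = "nilpotent_jordan rs :: 'k mat"
  have J: "?J \<in> carrier_mat r r" and R: "?R \<in> carrier_mat ?n ?n" by (simp, rule nilpotent_jordan_carrier)
  have F: "nilpotent_jordan (r # rs) \<in> carrier_mat (r + ?n) (r + ?n)"
    using nilpotent_jordan_carrier[of "r # rs"] by simp
  have zero: "0\<^sub>v (r + ?n) = (0\<^sub>v r @\<^sub>v 0\<^sub>v ?n :: 'k vec)" by (intro eq_vecI) auto
  have app0: "a @\<^sub>v b = 0\<^sub>v (r + ?n) \<longleftrightarrow> a = 0\<^sub>v r \<and> b = 0\<^sub>v ?n"
    if "a \<in> carrier_vec r" "b \<in> carrier_vec ?n" for a b :: "'k vec"
    unfolding zero by (rule append_vec_eq[OF that(1)]) simp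
  have "bij_betw (\<lambda>(a, b). a @\<^sub>v b) (mat_kernel ?J \<times> mat_kernel ?R) (mat_kernel (nilpotent_jordan (r # rs)))"
  proof (rule bij_betw_imageI)
    show "inj_on (\<lambda>(a, b). a @\<^sub>v b) (mat_kernel ?J \<times> mat_kernel ?R)"
    proof (rule inj_onI; clarify)
      fix a a' b b' :: "'k vec" assume "a \<in> mat_kernel ?J" "a' \<in> mat_kernel ?J" and eq: "a @\<^sub>v b = a' @\<^sub>v b'"
      then have "a \<in> carrier_vec r" "a' \<in> carrier_vec r" using mat_kernel_carrier[OF J] by blast+
      then show "a = a' \<and> b = b'" using append_vec_eq eq by simp
    qed
    have eq: "nilpotent_jordan (r # rs) *\<^sub>v (a @\<^sub>v b) = ?J *\<^sub>v a @\<^sub>v ?R *\<^sub>v b"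
      if "a \<in> carrier_vec r" "b \<in> carrier_vec ?n" for a b
      unfolding nilpotent_jordan_Cons using mult_mat_vec_split[OF J R that] .
    have mem: "v \<in> (\<lambda>(a, b). a @\<^sub>v b) ` (mat_kernel ?J \<times> mat_kernel ?R) \<longleftrightarrow> v \<in> mat_kernel (nilpotent_jordan (r # rs))"
      if "v \<in> carrier_vec (r + ?n)" for v
    proof -
      have "v = vec_first v r @\<^sub>v vec_last v ?n" using that by simp
      then obtain a b where v: "a \<in> carrier_vec r" "b \<in> carrier_vec ?n" "v = a @\<^sub>v b"
        by (metis vec_first_carrier vec_last_carrier)
      have "nilpotent_jordan (r # rs) *\<^sub>v (a @\<^sub>v b) = 0\<^sub>v (r + ?n) \<longleftrightarrow> ?J *\<^sub>v a = 0\<^sub>v r \<and> ?R *\<^sub>v b = 0\<^sub>v ?n"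
        unfolding eq[OF v(1,2)]
        by (rule app0[OF mult_mat_vec_carrier[OF J v(1)] mult_mat_vec_carrier[OF R v(2)]])
      moreover have "a @\<^sub>v b \<in> carrier_vec (r + ?n)" using v(1,2) by simp
      ultimately have "v \<in> mat_kernel (nilpotent_jordan (r # rs)) \<longleftrightarrow> a \<in> mat_kernel ?J \<and> b \<in> mat_kernel ?R"
        unfolding mat_kernel[OF F] mat_kernel[OF J] mat_kernel[OF R] v(3) using v(1,2) by blast
      also have "\<dots> \<longleftrightarrow> v \<in> (\<lambda>(a, b). a @\<^sub>v b) ` (mat_kernel ?J \<times> mat_kernel ?R)"
      proof
        assume "a \<in> mat_kernel ?J \<and> b \<in> mat_kernel ?R"
        then show "v \<in> (\<lambda>(a, b). a @\<^sub>v b) ` (mat_kernel ?J \<times> mat_kernel ?R)"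
          using v(3) by (intro image_eqI[of _ _ "(a, b)"]) auto
      next
        assume "v \<in> (\<lambda>(a, b). a @\<^sub>v b) ` (mat_kernel ?J \<times> mat_kernel ?R)"
        then obtain a' b' where ab: "a' \<in> mat_kernel ?J" "b' \<in> mat_kernel ?R" "v = a' @\<^sub>v b'" by auto
        have a': "a' \<in> carrier_vec r" using ab(1) mat_kernel_carrier[OF J] by blast
        have "a @\<^sub>v b = a' @\<^sub>v b'" using ab(3) v(3) by simp
        then have "a = a' \<and> b = b'" using append_vec_eq[OF v(1) a'] by simp
        then show "a \<in> mat_kernel ?J \<and> b \<in> mat_kernel ?R" using ab by blast
      qed
      finally show ?thesis by simp
    qed
    then show "(\<lambda>(a, b). a @\<^sub>v b) ` (mat_kernel ?J \<times> mat_kernel ?R) = mat_kernel (nilpotent_jordan (r # rs))"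
    proof (intro subset_antisym subsetI)
      fix v assume v: "v \<in> (\<lambda>(a, b). a @\<^sub>v b) ` (mat_kernel ?J \<times> mat_kernel ?R)"
      then have "v \<in> carrier_vec (r + ?n)" using mat_kernel_carrier[OF J] mat_kernel_carrier[OF R] by auto
      with mem v show "v \<in> mat_kernel (nilpotent_jordan (r # rs))" by blast
    next
      fix v :: "'k vec" assume v: "v \<in> mat_kernel (nilpotent_jordan (r # rs))"
      then have "v \<in> carrier_vec (r + ?n)" using mat_kernel_carrier[OF F] by blast
      with mem v show "v \<in> (\<lambda>(a, b). a @\<^sub>v b) ` (mat_kernel ?J \<times> mat_kernel ?R)" by blast
    qed
  qed
  then have "card (mat_kernel (nilpotent_jordan (r # rs) :: 'k mat)) = card (mat_kernel ?J) * card (mat_kernel ?R)"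
    by (simp add: bij_betw_same_card[symmetric] card_cartesian_product)
  also have "card (mat_kernel ?J) = CARD('k)"
    using card_kernel_jordan_block_pow[of 1 r, where ?'k = 'k] Cons.prems by (simp add: left_mult_one_mat[OF J])
  finally show ?case using Cons by simp
qed


section \<open>Short exact sequences\<close>

lemma short_exact_seqs_iff:
  assumes M: "M \<in> carrier_mat m m" and N: "N \<in> carrier_mat n n" and R: "R \<in> carrier_mat r r"
  shows "(\<phi>, \<psi>) \<in> short_exact_seqs M N R \<longleftrightarrow>
    \<phi> \<in> carrier_mat r n \<and> \<psi> \<in> carrier_mat m r \<and> \<phi> * N = R * \<phi> \<and> \<psi> * R = M * \<psi> \<and>
    inj_mat \<phi> \<and> surj_mat \<psi> \<and> (\<lambda>v. \<phi> *\<^sub>v v) ` carrier_vec n = mat_kernel \<psi>"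
  using M N R unfolding short_exact_seqs_def rep_hom_def inj_mat_def surj_mat_def mem_Collect_eq prod.case
  by auto

lemma short_exact_seqsE:
  assumes "(\<phi>, \<psi>) \<in> short_exact_seqs M N R"
    and M: "M \<in> carrier_mat m m" and N: "N \<in> carrier_mat n n" and R: "R \<in> carrier_mat r r"
  shows "\<phi> \<in> carrier_mat r n" "\<psi> \<in> carrier_mat m r" "\<phi> * N = R * \<phi>" "\<psi> * R = M * \<psi>"
    "inj_mat \<phi>" "surj_mat \<psi>" "(\<lambda>v. \<phi> *\<^sub>v v) ` carrier_vec n = mat_kernel \<psi>"
    "\<And>u. u \<in> carrier_vec n \<Longrightarrow> \<phi> *\<^sub>v u = 0\<^sub>v r \<Longrightarrow> u = 0\<^sub>v n"
    "\<And>w. w \<in> carrier_vec m \<Longrightarrow> \<exists>u\<in>carrier_vec r. \<psi> *\<^sub>v u = w"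
    "\<And>w. w \<in> carrier_vec r \<Longrightarrow> \<psi> *\<^sub>v w = 0\<^sub>v m \<longleftrightarrow> (\<exists>u\<in>carrier_vec n. w = \<phi> *\<^sub>v u)"
    "\<And>u. u \<in> carrier_vec n \<Longrightarrow> \<psi> *\<^sub>v (\<phi> *\<^sub>v u) = 0\<^sub>v m"
proof -
  note D = assms(1)[unfolded short_exact_seqs_iff[OF M N R]]
  show 1: "\<phi> \<in> carrier_mat r n" and 2: "\<psi> \<in> carrier_mat m r" and "\<phi> * N = R * \<phi>" "\<psi> * R = M * \<psi>"
    and i: "inj_mat \<phi>" and s: "surj_mat \<psi>" and e: "(\<lambda>v. \<phi> *\<^sub>v v) ` carrier_vec n = mat_kernel \<psi>"
    using D by blast+
  show "u = 0\<^sub>v n" if "u \<in> carrier_vec n" "\<phi> *\<^sub>v u = 0\<^sub>v r" for u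
    using i inj_mat_iff_kernel[OF 1] that by blast
  show "\<exists>u\<in>carrier_vec r. \<psi> *\<^sub>v u = w" if "w \<in> carrier_vec m" for w
    using s that 2 unfolding surj_mat_def by (metis carrier_matD imageE)
  show ex: "\<psi> *\<^sub>v w = 0\<^sub>v m \<longleftrightarrow> (\<exists>u\<in>carrier_vec n. w = \<phi> *\<^sub>v u)" if "w \<in> carrier_vec r" for w
  proof -
    have "\<psi> *\<^sub>v w = 0\<^sub>v m \<longleftrightarrow> w \<in> mat_kernel \<psi>" using that unfolding mat_kernel[OF 2] by blast
    then show ?thesis unfolding e[symmetric] by blast
  qed
  show "\<psi> *\<^sub>v (\<phi> *\<^sub>v u) = 0\<^sub>v m" if "u \<in> carrier_vec n" for u
    using ex[of "\<phi> *\<^sub>v u"] that 1 by auto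
qed

lemma short_exact_seqs_vecI:
  assumes M: "M \<in> carrier_mat m m" and N: "N \<in> carrier_mat n n" and R: "R \<in> carrier_mat r r"
    and \<phi>: "\<phi> \<in> carrier_mat r n" and \<psi>: "\<psi> \<in> carrier_mat m r"
    and "\<phi> * N = R * \<phi>" "\<psi> * R = M * \<psi>"
    and inj: "\<And>u. u \<in> carrier_vec n \<Longrightarrow> \<phi> *\<^sub>v u = 0\<^sub>v r \<Longrightarrow> u = 0\<^sub>v n"
    and surj: "\<And>w. w \<in> carrier_vec m \<Longrightarrow> \<exists>u\<in>carrier_vec r. \<psi> *\<^sub>v u = w"
    and ex1: "\<And>u. u \<in> carrier_vec n \<Longrightarrow> \<psi> *\<^sub>v (\<phi> *\<^sub>v u) = 0\<^sub>v m"
    and ex2: "\<And>w. w \<in> carrier_vec r \<Longrightarrow> \<psi> *\<^sub>v w = 0\<^sub>v m \<Longrightarrow> \<exists>u\<in>carrier_vec n. w = \<phi> *\<^sub>v u"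
  shows "(\<phi>, \<psi>) \<in> short_exact_seqs M N R"
proof -
  have "inj_mat \<phi>" using inj inj_mat_iff_kernel[OF \<phi>] by blast
  moreover have "surj_mat \<psi>"
  proof -
    have "carrier_vec m \<subseteq> (\<lambda>v. \<psi> *\<^sub>v v) ` carrier_vec r" using surj by blast
    then show ?thesis using \<psi> by (auto simp: surj_mat_def)
  qed
  moreover have "(\<lambda>v. \<phi> *\<^sub>v v) ` carrier_vec n = mat_kernel \<psi>"
    unfolding mat_kernel[OF \<psi>] using ex1 ex2 mult_mat_vec_carrier[OF \<phi>] by blast
  ultimately show ?thesis using assms(6,7) \<phi> \<psi> short_exact_seqs_iff[OF M N R] by blast
qed

lemma hom_comp:
  fixes f g :: "'a::field mat"
  assumes "f \<in> carrier_mat b a" "g \<in> carrier_mat c b" "A \<in> carrier_mat a a" "B \<in> carrier_mat b b" "C \<in> carrier_mat c c"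
    and "f * A = B * f" "g * B = C * g"
  shows "g * f * A = C * (g * f)"
proof -
  have "g * f * A = g * (B * f)" using assoc_mult_mat[OF assms(2,1,3)] assms(6) by simp
  also have "\<dots> = C * g * f" using assoc_mult_mat[OF assms(2,4,1)] assms(7) by simp
  also have "\<dots> = C * (g * f)" by (rule assoc_mult_mat[OF assms(5,2,1)])
  finally show ?thesis .
qed

lemma factor_through_inj:
  fixes \<phi> :: "'k::{field,finite} mat"
  assumes \<phi>: "\<phi> \<in> carrier_mat r n" and inj: "inj_mat \<phi>" and f: "f \<in> carrier_mat r k"
    and im: "\<And>v. v \<in> carrier_vec k \<Longrightarrow> \<exists>u\<in>carrier_vec n. f *\<^sub>v v = \<phi> *\<^sub>v u"
    and N: "N \<in> carrier_mat n n" and R: "R \<in> carrier_mat r r" and K: "K \<in> carrier_mat k k"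
    and \<phi>N: "\<phi> * N = R * \<phi>" and fK: "f * K = R * f"
  obtains g where "g \<in> carrier_mat n k" "\<phi> * g = f" "g * K = N * g"
proof -
  obtain g where g: "g \<in> carrier_mat n k" and eq: "\<phi> * g = f" by (rule factor_inj[OF \<phi> inj f im])
  have "\<phi> * (g * K) = R * (\<phi> * g)" using assoc_mult_mat[OF \<phi> g K] eq fK by simp
  also have "\<dots> = \<phi> * (N * g)"
    using assoc_mult_mat[OF R \<phi> g] assoc_mult_mat[OF \<phi> N g] \<phi>N by simp
  finally have "g * K = N * g"
    by (rule inj_mat_cancel[OF \<phi> inj mult_carrier_mat[OF g K] mult_carrier_mat[OF N g]])
  with g eq show thesis using that by blast
qed

lemma factor_through_surj:
  fixes \<psi> :: "'k::{field,finite} mat"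
  assumes \<psi>: "\<psi> \<in> carrier_mat m r" and surj: "surj_mat \<psi>" and f: "f \<in> carrier_mat k r"
    and ker: "\<And>v. v \<in> carrier_vec r \<Longrightarrow> \<psi> *\<^sub>v v = 0\<^sub>v m \<Longrightarrow> f *\<^sub>v v = 0\<^sub>v k"
    and M: "M \<in> carrier_mat m m" and R: "R \<in> carrier_mat r r" and K: "K \<in> carrier_mat k k"
    and \<psi>R: "\<psi> * R = M * \<psi>" and fR: "f * R = K * f"
  obtains g where "g \<in> carrier_mat k m" "g * \<psi> = f" "g * M = K * g"
proof -
  obtain g where g: "g \<in> carrier_mat k m" and eq: "g * \<psi> = f" by (rule factor_surj[OF \<psi> surj f ker])
  have "g * M * \<psi> = g * \<psi> * R" using assoc_mult_mat[OF g M \<psi>] assoc_mult_mat[OF g \<psi> R] \<psi>R by simp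
  also have "\<dots> = K * g * \<psi>" using assoc_mult_mat[OF K g \<psi>] eq fR by simp
  finally have "g * M = K * g"
    by (rule surj_mat_cancel[OF \<psi> surj mult_carrier_mat[OF g M] mult_carrier_mat[OF K g]])
  with g eq show thesis using that by blast
qed

section \<open>Kernels and cokernels\<close>

lemma kernel_rep_exists:
  fixes R :: "'k::{field,finite} mat"
  assumes R: "R \<in> carrier_mat r r" and nil: "nilpotent_mat R" and M: "M \<in> carrier_mat m m"
    and \<psi>: "\<psi> \<in> carrier_mat m r" and \<psi>R: "\<psi> * R = M * \<psi>" and surj: "surj_mat \<psi>"
  obtains i L where "L \<in> carrier_mat (r - m) (r - m)" "nilpotent_mat L" "(i, \<psi>) \<in> short_exact_seqs M L R"
proof -
  obtain i where i: "i \<in> carrier_mat r (r - m)" "inj_mat i" "(\<lambda>v. i *\<^sub>v v) ` carrier_vec (r - m) = mat_kernel \<psi>"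
    by (rule surj_mat_kernel[OF \<psi> surj])
  have Ri: "R * i \<in> carrier_mat r (r - m)" using R i by simp
  have im: "\<exists>u\<in>carrier_vec (r - m). (R * i) *\<^sub>v v = i *\<^sub>v u" if v: "v \<in> carrier_vec (r - m)" for v
  proof -
    have iv: "i *\<^sub>v v \<in> carrier_vec r" using i v by simp
    have "i *\<^sub>v v \<in> mat_kernel \<psi>" using i(3) v by blast
    then have "\<psi> *\<^sub>v (i *\<^sub>v v) = 0\<^sub>v m" by (rule mat_kernelD(2)[OF \<psi>])
    then have "\<psi> *\<^sub>v (R *\<^sub>v (i *\<^sub>v v)) = 0\<^sub>v m"
      using assoc_mult_mat_vec[OF \<psi> R iv] assoc_mult_mat_vec[OF M \<psi> iv] \<psi>R mat_zero_vec[OF M] by simp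
    then have "R *\<^sub>v (i *\<^sub>v v) \<in> mat_kernel \<psi>" using R iv by (intro mat_kernelI[OF \<psi>]) auto
    then obtain u where "u \<in> carrier_vec (r - m)" "R *\<^sub>v (i *\<^sub>v v) = i *\<^sub>v u" using i(3) by blast
    then show ?thesis using assoc_mult_mat_vec[OF R i(1) v] by auto
  qed
  obtain L where L: "L \<in> carrier_mat (r - m) (r - m)" and iL: "i * L = R * i"
    by (rule factor_inj[OF i(1,2) Ri im])
  have "nilpotent_mat L" by (rule nilpotent_of_inj[OF L R i(1) iL i(2) nil])
  moreover have "(i, \<psi>) \<in> short_exact_seqs M L R"
    using short_exact_seqs_iff[OF M L R] i \<psi> \<psi>R surj iL by blast
  ultimately show thesis using that L by blast
qed

lemma cokernel_rep_exists:
  fixes R :: "'k::{field,finite} mat"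
  assumes R: "R \<in> carrier_mat r r" and nil: "nilpotent_mat R" and N: "N \<in> carrier_mat n n"
    and \<phi>: "\<phi> \<in> carrier_mat r n" and \<phi>N: "\<phi> * N = R * \<phi>" and inj: "inj_mat \<phi>"
  obtains p C where "C \<in> carrier_mat (r - n) (r - n)" "nilpotent_mat C" "(\<phi>, p) \<in> short_exact_seqs C N R"
proof -
  obtain p where p: "p \<in> carrier_mat (r - n) r" "surj_mat p" "mat_kernel p = (\<lambda>v. \<phi> *\<^sub>v v) ` carrier_vec n"
    by (rule inj_mat_complement[OF \<phi> inj])
  have pR: "p * R \<in> carrier_mat (r - n) r" using p R by simp
  have ker: "(p * R) *\<^sub>v v = 0\<^sub>v (r - n)" if v: "v \<in> carrier_vec r" "p *\<^sub>v v = 0\<^sub>v (r - n)" for v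
  proof -
    have "v \<in> mat_kernel p" using v by (intro mat_kernelI[OF p(1)])
    then obtain u where u: "u \<in> carrier_vec n" "v = \<phi> *\<^sub>v u" using p(3) by blast
    have "R *\<^sub>v v = \<phi> *\<^sub>v (N *\<^sub>v u)"
      using assoc_mult_mat_vec[OF R \<phi> u(1)] assoc_mult_mat_vec[OF \<phi> N u(1)] \<phi>N u(2) by simp
    moreover have "N *\<^sub>v u \<in> carrier_vec n" using N u by simp
    ultimately have "R *\<^sub>v v \<in> mat_kernel p" unfolding p(3) by blast
    then show ?thesis using mat_kernelD(2)[OF p(1)] assoc_mult_mat_vec[OF p(1) R v(1)] by simp
  qed
  obtain C where C: "C \<in> carrier_mat (r - n) (r - n)" and Cp: "C * p = p * R"
    by (rule factor_surj[OF p(1,2) pR ker])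
  have "nilpotent_mat C" by (rule nilpotent_of_surj[OF R C p(1) Cp[symmetric] p(2) nil])
  moreover have "(\<phi>, p) \<in> short_exact_seqs C N R"
    using short_exact_seqs_iff[OF C N R] p \<phi> \<phi>N inj Cp by metis
  ultimately show thesis using that C by blast
qed

text \<open>
  The diagram chase behind associativity. A subobject \<open>K \<subseteq> R\<close> with quotient \<open>C\<close> together with a
  subobject \<open>N \<subseteq> C\<close> with quotient \<open>M\<close> is the same as the kernel \<open>L\<close> of \<open>R \<rightarrow> M\<close> together with
  the subobject \<open>K \<subseteq> L\<close> with quotient \<open>N\<close>; the square \<open>L \<rightarrow> R \<rightarrow> C\<close>, \<open>L \<rightarrow> N \<rightarrow> C\<close> commutes
  and each side of the correspondence is determined by the other.
\<close>

lemma filtration_refine_sub: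
  fixes R :: "'k::{field,finite} mat"
  assumes M: "M \<in> carrier_mat m m" and N: "N \<in> carrier_mat n n" and K: "K \<in> carrier_mat k k"
    and R: "R \<in> carrier_mat r r" and C: "C \<in> carrier_mat c c" and L: "L \<in> carrier_mat l l"
    and s1: "(\<phi>, p) \<in> short_exact_seqs C K R" and s2: "(\<phi>', \<psi>') \<in> short_exact_seqs M N C"
    and s3: "(i, \<psi>' * p) \<in> short_exact_seqs M L R"
  shows "\<exists>!(\<phi>'', \<psi>''). (\<phi>'', \<psi>'') \<in> short_exact_seqs N K L \<and> \<phi> = i * \<phi>'' \<and> \<phi>' * \<psi>'' = p * i"
proof -
  note d1 = short_exact_seqsE[OF s1 C K R]
  note d2 = short_exact_seqsE[OF s2 M N C]
  note d3 = short_exact_seqsE[OF s3 M L R]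
  have \<pi>: "(\<psi>' * p) *\<^sub>v v = \<psi>' *\<^sub>v (p *\<^sub>v v)" if "v \<in> carrier_vec r" for v
    by (rule assoc_mult_mat_vec[OF d2(2) d1(2) that])
  have im: "\<exists>u\<in>carrier_vec l. \<phi> *\<^sub>v v = i *\<^sub>v u" if v: "v \<in> carrier_vec k" for v
  proof -
    have c: "\<phi> *\<^sub>v v \<in> carrier_vec r" using d1(1) v by simp
    have "(\<psi>' * p) *\<^sub>v (\<phi> *\<^sub>v v) = 0\<^sub>v m" using \<pi>[OF c] d1(11)[OF v] mat_zero_vec[OF d2(2)] by simp
    then show ?thesis using d3(10)[OF c] by blast
  qed
  obtain a where a: "a \<in> carrier_mat l k" "i * a = \<phi>" "a * K = L * a"
    by (rule factor_through_inj[OF d3(1,5) d1(1) im L R K d3(3) d1(3)])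
  have pi: "p * i \<in> carrier_mat c l" using d1(2) d3(1) by simp
  have piv: "(p * i) *\<^sub>v v = p *\<^sub>v (i *\<^sub>v v)" if "v \<in> carrier_vec l" for v
    by (rule assoc_mult_mat_vec[OF d1(2) d3(1) that])
  have im': "\<exists>u\<in>carrier_vec n. (p * i) *\<^sub>v v = \<phi>' *\<^sub>v u" if v: "v \<in> carrier_vec l" for v
  proof -
    have c: "i *\<^sub>v v \<in> carrier_vec r" using d3(1) v by simp
    have c': "p *\<^sub>v (i *\<^sub>v v) \<in> carrier_vec c" using d1(2) c by simp
    have "\<psi>' *\<^sub>v (p *\<^sub>v (i *\<^sub>v v)) = 0\<^sub>v m" using \<pi>[OF c] d3(11)[OF v] by simp
    then show ?thesis using d2(10)[OF c'] piv[OF v] by simp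
  qed
  have pihom: "p * i * L = C * (p * i)" by (rule hom_comp[OF d3(1) d1(2) L R C d3(3) d1(4)])
  obtain b where b: "b \<in> carrier_mat n l" "\<phi>' * b = p * i" "b * L = N * b"
    by (rule factor_through_inj[OF d2(1,5) pi im' N C L d2(3) pihom])
  have bv: "\<phi>' *\<^sub>v (b *\<^sub>v v) = p *\<^sub>v (i *\<^sub>v v)" if "v \<in> carrier_vec l" for v
    using assoc_mult_mat_vec[OF d2(1) b(1) that] b(2) piv[OF that] by simp
  have av: "i *\<^sub>v (a *\<^sub>v v) = \<phi> *\<^sub>v v" if "v \<in> carrier_vec k" for v
    using assoc_mult_mat_vec[OF d3(1) a(1) that] a(2) by simp
  have inji: "v = w" if "v \<in> carrier_vec l" "w \<in> carrier_vec l" "i *\<^sub>v v = i *\<^sub>v w" for v w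
    using d3(1,5) that by (auto simp: inj_mat_def inj_on_def)
  have inj\<phi>': "v = w" if "v \<in> carrier_vec n" "w \<in> carrier_vec n" "\<phi>' *\<^sub>v v = \<phi>' *\<^sub>v w" for v w
    using d2(1,5) that by (auto simp: inj_mat_def inj_on_def)
  have "(a, b) \<in> short_exact_seqs N K L"
  proof (rule short_exact_seqs_vecI[OF N K L a(1) b(1) a(3) b(3)])
    fix u :: "'k vec" assume u: "u \<in> carrier_vec k" and "a *\<^sub>v u = 0\<^sub>v l"
    then have "\<phi> *\<^sub>v u = 0\<^sub>v r" using av[OF u] mat_zero_vec[OF d3(1)] by simp
    then show "u = 0\<^sub>v k" using d1(8) u by blast
  next
    fix w :: "'k vec" assume w: "w \<in> carrier_vec n"
    have c: "\<phi>' *\<^sub>v w \<in> carrier_vec c" using d2(1) w by simp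
    then obtain v where v: "v \<in> carrier_vec r" "p *\<^sub>v v = \<phi>' *\<^sub>v w" using d1(9) by blast
    have "(\<psi>' * p) *\<^sub>v v = 0\<^sub>v m" using \<pi>[OF v(1)] v(2) d2(11)[OF w] by simp
    then obtain u where u: "u \<in> carrier_vec l" "v = i *\<^sub>v u" using d3(10)[OF v(1)] by blast
    have "\<phi>' *\<^sub>v (b *\<^sub>v u) = \<phi>' *\<^sub>v w" using bv[OF u(1)] u(2) v(2) by simp
    then have "b *\<^sub>v u = w" using inj\<phi>' b(1) u(1) w by simp
    then show "\<exists>u\<in>carrier_vec l. b *\<^sub>v u = w" using u by blast
  next
    fix u :: "'k vec" assume u: "u \<in> carrier_vec k"
    have c: "a *\<^sub>v u \<in> carrier_vec l" using a(1) u by simp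
    have c': "b *\<^sub>v (a *\<^sub>v u) \<in> carrier_vec n" using b(1) c by simp
    have "\<phi>' *\<^sub>v (b *\<^sub>v (a *\<^sub>v u)) = 0\<^sub>v c" using bv[OF c] av[OF u] d1(11)[OF u] by simp
    then show "b *\<^sub>v (a *\<^sub>v u) = 0\<^sub>v n" using d2(8) c' by blast
  next
    fix w :: "'k vec" assume w: "w \<in> carrier_vec l" and 0: "b *\<^sub>v w = 0\<^sub>v n"
    have c: "i *\<^sub>v w \<in> carrier_vec r" using d3(1) w by simp
    have "p *\<^sub>v (i *\<^sub>v w) = 0\<^sub>v c" using bv[OF w] 0 mat_zero_vec[OF d2(1)] by simp
    then obtain u where u: "u \<in> carrier_vec k" "i *\<^sub>v w = \<phi> *\<^sub>v u" using d1(10)[OF c] by blast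
    then have "w = a *\<^sub>v u" using inji[OF w] av[OF u(1)] a(1) by simp
    then show "\<exists>u\<in>carrier_vec k. w = a *\<^sub>v u" using u by blast
  qed
  moreover have "a' = a \<and> b' = b"
    if "(a', b') \<in> short_exact_seqs N K L \<and> \<phi> = i * a' \<and> \<phi>' * b' = p * i" for a' b'
  proof -
    have e: "(a', b') \<in> short_exact_seqs N K L" using that by blast
    note d = short_exact_seqsE(1,2)[OF e N K L]
    show ?thesis
      using inj_mat_cancel[OF d3(1,5) d(1) a(1)] inj_mat_cancel[OF d2(1,5) d(2) b(1)] a(2) b(2) that by simp
  qed
  ultimately show ?thesis using a(2) b(2) by (intro ex1I[of _ "(a, b)"]) auto
qed

lemma filtration_refine_quot:
  fixes R :: "'k::{field,finite} mat"
  assumes M: "M \<in> carrier_mat m m" and N: "N \<in> carrier_mat n n" and K: "K \<in> carrier_mat k k"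
    and R: "R \<in> carrier_mat r r" and C: "C \<in> carrier_mat c c" and L: "L \<in> carrier_mat l l"
    and s1: "(i, \<pi>) \<in> short_exact_seqs M L R" and s2: "(\<phi>'', \<psi>'') \<in> short_exact_seqs N K L"
    and s3: "(i * \<phi>'', p) \<in> short_exact_seqs C K R"
  shows "\<exists>!(\<phi>', \<psi>'). (\<phi>', \<psi>') \<in> short_exact_seqs M N C \<and> \<pi> = \<psi>' * p \<and> \<phi>' * \<psi>'' = p * i"
proof -
  note d1 = short_exact_seqsE[OF s1 M L R]
  note d2 = short_exact_seqsE[OF s2 N K L]
  note d3 = short_exact_seqsE[OF s3 C K R]
  have iv: "(i * \<phi>'') *\<^sub>v v = i *\<^sub>v (\<phi>'' *\<^sub>v v)" if "v \<in> carrier_vec k" for v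
    by (rule assoc_mult_mat_vec[OF d1(1) d2(1) that])
  have ker: "\<pi> *\<^sub>v v = 0\<^sub>v m" if v: "v \<in> carrier_vec r" "p *\<^sub>v v = 0\<^sub>v c" for v
  proof -
    obtain u where u: "u \<in> carrier_vec k" "v = (i * \<phi>'') *\<^sub>v u" using d3(10)[OF v(1)] v(2) by blast
    then show ?thesis using iv[OF u(1)] d1(11)[of "\<phi>'' *\<^sub>v u"] d2(1) by simp
  qed
  obtain a where a: "a \<in> carrier_mat m c" "a * p = \<pi>" "a * C = M * a"
    by (rule factor_through_surj[OF d3(2,6) d1(2) ker C R M d3(4) d1(4)])
  have pi: "p * i \<in> carrier_mat c l" using d3(2) d1(1) by simp
  have piv: "(p * i) *\<^sub>v v = p *\<^sub>v (i *\<^sub>v v)" if "v \<in> carrier_vec l" for v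
    by (rule assoc_mult_mat_vec[OF d3(2) d1(1) that])
  have ker': "(p * i) *\<^sub>v v = 0\<^sub>v c" if v: "v \<in> carrier_vec l" "\<psi>'' *\<^sub>v v = 0\<^sub>v n" for v
  proof -
    obtain u where u: "u \<in> carrier_vec k" "v = \<phi>'' *\<^sub>v u" using d2(10)[OF v(1)] v(2) by blast
    then show ?thesis using iv[OF u(1)] d3(11)[OF u(1)] piv[OF v(1)] by simp
  qed
  have pihom: "p * i * L = C * (p * i)" by (rule hom_comp[OF d1(1) d3(2) L R C d1(3) d3(4)])
  obtain b where b: "b \<in> carrier_mat c n" "b * \<psi>'' = p * i" "b * N = C * b"
    by (rule factor_through_surj[OF d2(2,6) pi ker' N L C d2(4) pihom])
  have bv: "b *\<^sub>v (\<psi>'' *\<^sub>v v) = p *\<^sub>v (i *\<^sub>v v)" if "v \<in> carrier_vec l" for v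
    using assoc_mult_mat_vec[OF b(1) d2(2) that] b(2) piv[OF that] by simp
  have av: "a *\<^sub>v (p *\<^sub>v v) = \<pi> *\<^sub>v v" if "v \<in> carrier_vec r" for v
    using assoc_mult_mat_vec[OF a(1) d3(2) that] a(2) by simp
  have inji: "v = w" if "v \<in> carrier_vec l" "w \<in> carrier_vec l" "i *\<^sub>v v = i *\<^sub>v w" for v w
    using d1(1,5) that by (auto simp: inj_mat_def inj_on_def)
  have "(b, a) \<in> short_exact_seqs M N C"
  proof (rule short_exact_seqs_vecI[OF M N C b(1) a(1) b(3) a(3)])
    fix u :: "'k vec" assume u: "u \<in> carrier_vec n" and 0: "b *\<^sub>v u = 0\<^sub>v c"
    obtain v where v: "v \<in> carrier_vec l" "\<psi>'' *\<^sub>v v = u" using d2(9)[OF u] by blast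
    have c: "i *\<^sub>v v \<in> carrier_vec r" using d1(1) v by simp
    have "p *\<^sub>v (i *\<^sub>v v) = 0\<^sub>v c" using bv[OF v(1)] v(2) 0 by simp
    then obtain w where w: "w \<in> carrier_vec k" "i *\<^sub>v v = (i * \<phi>'') *\<^sub>v w" using d3(10)[OF c] by blast
    then have "v = \<phi>'' *\<^sub>v w" using inji[OF v(1)] iv[OF w(1)] d2(1) by simp
    then show "u = 0\<^sub>v n" using d2(11)[OF w(1)] v(2) by simp
  next
    fix w :: "'k vec" assume w: "w \<in> carrier_vec m"
    then obtain u where u: "u \<in> carrier_vec r" "\<pi> *\<^sub>v u = w" using d1(9) by blast
    have "p *\<^sub>v u \<in> carrier_vec c" using d3(2) u by simp
    then show "\<exists>u\<in>carrier_vec c. a *\<^sub>v u = w" using av[OF u(1)] u(2) by blast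
  next
    fix u :: "'k vec" assume u: "u \<in> carrier_vec n"
    obtain v where v: "v \<in> carrier_vec l" "\<psi>'' *\<^sub>v v = u" using d2(9)[OF u] by blast
    have c: "i *\<^sub>v v \<in> carrier_vec r" using d1(1) v by simp
    show "a *\<^sub>v (b *\<^sub>v u) = 0\<^sub>v m" using bv[OF v(1)] v(2) av[OF c] d1(11)[OF v(1)] by simp
  next
    fix w :: "'k vec" assume w: "w \<in> carrier_vec c" and 0: "a *\<^sub>v w = 0\<^sub>v m"
    obtain v where v: "v \<in> carrier_vec r" "p *\<^sub>v v = w" using d3(9)[OF w] by blast
    have "\<pi> *\<^sub>v v = 0\<^sub>v m" using av[OF v(1)] v(2) 0 by simp
    then obtain u where u: "u \<in> carrier_vec l" "v = i *\<^sub>v u" using d1(10)[OF v(1)] by blast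
    have "\<psi>'' *\<^sub>v u \<in> carrier_vec n" using d2(2) u by simp
    then show "\<exists>u\<in>carrier_vec n. w = b *\<^sub>v u" using bv[OF u(1)] u(2) v(2) by (metis)
  qed
  moreover have "a' = a \<and> b' = b"
    if "(b', a') \<in> short_exact_seqs M N C \<and> \<pi> = a' * p \<and> b' * \<psi>'' = p * i" for a' b'
  proof -
    have e: "(b', a') \<in> short_exact_seqs M N C" using that by blast
    note d = short_exact_seqsE(1,2)[OF e M N C]
    show ?thesis
      using surj_mat_cancel[OF d3(2,6) d(2) a(1)] surj_mat_cancel[OF d2(2,6) d(1) b(1)] a(2) b(2) that by simp
  qed
  ultimately show ?thesis using a(2) b(2) by (intro ex1I[of _ "(b, a)"]) auto
qed

lemma filtration_compose_quot:
  fixes R :: "'k::{field,finite} mat"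
  assumes M: "M \<in> carrier_mat m m" and N: "N \<in> carrier_mat n n" and K: "K \<in> carrier_mat k k"
    and R: "R \<in> carrier_mat r r" and C: "C \<in> carrier_mat c c"
    and s1: "(\<phi>, p) \<in> short_exact_seqs C K R" and s2: "(\<phi>', \<psi>') \<in> short_exact_seqs M N C"
  shows "\<psi>' * p \<in> carrier_mat m r" "\<psi>' * p * R = M * (\<psi>' * p)" "surj_mat (\<psi>' * p)"
proof -
  note d1 = short_exact_seqsE[OF s1 C K R]
  note d2 = short_exact_seqsE[OF s2 M N C]
  show c: "\<psi>' * p \<in> carrier_mat m r" using d1(2) d2(2) by simp
  show "\<psi>' * p * R = M * (\<psi>' * p)" by (rule hom_comp[OF d1(2) d2(2) R C M d1(4) d2(4)])
  obtain S where S: "S \<in> carrier_mat r c" "p * S = 1\<^sub>m c" by (rule surj_mat_right_inverse[OF d1(2,6)])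
  obtain T where T: "T \<in> carrier_mat c m" "\<psi>' * T = 1\<^sub>m m" by (rule surj_mat_right_inverse[OF d2(2,6)])
  have ST: "S * T \<in> carrier_mat r m" using S T by simp
  have "p * (S * T) = p * S * T" by (rule assoc_mult_mat[OF d1(2) S(1) T(1), symmetric])
  then have "p * (S * T) = T" unfolding S(2) left_mult_one_mat[OF T(1)] .
  then have "\<psi>' * p * (S * T) = 1\<^sub>m m" using assoc_mult_mat[OF d2(2) d1(2) ST] T(2) by simp
  then show "surj_mat (\<psi>' * p)" by (rule surj_matI_right_inverse[OF c ST])
qed

lemma filtration_compose_sub:
  fixes R :: "'k::{field,finite} mat"
  assumes M: "M \<in> carrier_mat m m" and N: "N \<in> carrier_mat n n" and K: "K \<in> carrier_mat k k"
    and R: "R \<in> carrier_mat r r" and L: "L \<in> carrier_mat l l"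
    and s1: "(i, \<pi>) \<in> short_exact_seqs M L R" and s2: "(\<phi>'', \<psi>'') \<in> short_exact_seqs N K L"
  shows "i * \<phi>'' \<in> carrier_mat r k" "i * \<phi>'' * K = R * (i * \<phi>'')" "inj_mat (i * \<phi>'')"
proof -
  note d1 = short_exact_seqsE[OF s1 M L R]
  note d2 = short_exact_seqsE[OF s2 N K L]
  show c: "i * \<phi>'' \<in> carrier_mat r k" using d1(1) d2(1) by simp
  show "i * \<phi>'' * K = R * (i * \<phi>'')" by (rule hom_comp[OF d2(1) d1(1) K L R d2(3) d1(3)])
  show "inj_mat (i * \<phi>'')" unfolding inj_mat_iff_kernel[OF c]
  proof (intro ballI impI)
    fix v assume v: "v \<in> carrier_vec k" and "(i * \<phi>'') *\<^sub>v v = 0\<^sub>v r"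
    then have "i *\<^sub>v (\<phi>'' *\<^sub>v v) = 0\<^sub>v r" using assoc_mult_mat_vec[OF d1(1) d2(1) v] by simp
    then have "\<phi>'' *\<^sub>v v = 0\<^sub>v l" using d1(8) d2(1) v by simp
    then show "v = 0\<^sub>v k" using d2(8) v by blast
  qed
qed

section \<open>Duality\<close>

lemma short_exact_seqs_transpose:
  fixes M N R :: "'k::{field,finite} mat"
  assumes M: "M \<in> carrier_mat m m" and N: "N \<in> carrier_mat n n" and R: "R \<in> carrier_mat r r"
    and s: "(\<phi>, \<psi>) \<in> short_exact_seqs M N R"
  shows "(\<psi>\<^sup>T, \<phi>\<^sup>T) \<in> short_exact_seqs N\<^sup>T M\<^sup>T R\<^sup>T"
proof -
  note d = short_exact_seqsE[OF s M N R]
  have sqR: "square_mat R" using R by simp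
  have "short_exact_seqs M N R \<noteq> {}" using s by blast
  from short_exact_seqs_dim[OF this sqR] have r: "r = m + n" using M N R by simp
  have i: "inj_mat \<psi>\<^sup>T" by (rule surj_mat_transpose[OF d(2,6)])
  have u: "surj_mat \<phi>\<^sup>T" by (rule inj_mat_transpose[OF d(1,5)])
  have c: "\<psi>\<^sup>T \<in> carrier_mat r m" "\<phi>\<^sup>T \<in> carrier_mat n r" using d(1,2) by simp_all
  have "\<psi> * \<phi> = 0\<^sub>m m n"
    using d(1,2) assoc_mult_mat_vec[OF d(2,1)] d(11) by (intro mat_eq_on_vecs[of _ m n]) (auto intro!: eq_vecI)
  then have 0: "\<phi>\<^sup>T * \<psi>\<^sup>T = 0\<^sub>m n m" using transpose_mult[OF d(2,1)] by simp
  have "(\<lambda>v. \<psi>\<^sup>T *\<^sub>v v) ` carrier_vec m = mat_kernel \<phi>\<^sup>T"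
  proof (rule card_subset_eq)
    show "finite (mat_kernel \<phi>\<^sup>T)" by (rule finite_subset[OF mat_kernel_carrier[OF c(2)] finite_carrier_vec])
    show "(\<lambda>v. \<psi>\<^sup>T *\<^sub>v v) ` carrier_vec m \<subseteq> mat_kernel \<phi>\<^sup>T"
    proof (rule image_subsetI)
      fix v :: "'k vec" assume v: "v \<in> carrier_vec m"
      have "\<phi>\<^sup>T *\<^sub>v (\<psi>\<^sup>T *\<^sub>v v) = 0\<^sub>m n m *\<^sub>v v" using assoc_mult_mat_vec[OF c(2,1) v] 0 by simp
      also have "\<dots> = 0\<^sub>v n" using v by (intro eq_vecI) auto
      finally show "\<psi>\<^sup>T *\<^sub>v v \<in> mat_kernel \<phi>\<^sup>T" using v c by (intro mat_kernelI[OF c(2)]) auto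
    qed
    have "card (mat_kernel \<phi>\<^sup>T) * CARD('k) ^ n = CARD('k) ^ m * CARD('k) ^ n"
      using card_kernel_surj[OF c(2) u] r by (simp add: power_add)
    then show "card ((\<lambda>v. \<psi>\<^sup>T *\<^sub>v v) ` carrier_vec m) = card (mat_kernel \<phi>\<^sup>T)"
      using card_image_inj[OF c(1) i] card_field_gt_1[where ?'k = 'k] by simp
  qed
  moreover have "\<psi>\<^sup>T * M\<^sup>T = R\<^sup>T * \<psi>\<^sup>T" "\<phi>\<^sup>T * R\<^sup>T = N\<^sup>T * \<phi>\<^sup>T"
    using transpose_mult[OF M d(2)] transpose_mult[OF d(2) R] transpose_mult[OF R d(1)] transpose_mult[OF d(1) N] d(3,4)
    by simp_all
  moreover have "N\<^sup>T \<in> carrier_mat n n" "M\<^sup>T \<in> carrier_mat m m" "R\<^sup>T \<in> carrier_mat r r"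
    using M N R by simp_all
  ultimately show ?thesis using short_exact_seqs_iff[of "N\<^sup>T" n "M\<^sup>T" m "R\<^sup>T" r] c i u by blast
qed

text \<open>
  Transposition exchanges sub and quotient, and every nilpotent matrix is similar to its transpose.
\<close>

lemma card_short_exact_seqs_commute:
  fixes M N R :: "'k::{field,finite} mat"
  assumes M: "M \<in> carrier_mat m m" and N: "N \<in> carrier_mat n n" and R: "R \<in> carrier_mat r r"
    and nil: "nilpotent_mat M" "nilpotent_mat N" "nilpotent_mat R"
  shows "card (short_exact_seqs M N R) = card (short_exact_seqs N M R)"
proof -
  have le: "card (short_exact_seqs M N R) \<le> card (short_exact_seqs N M R)"
    if M: "M \<in> carrier_mat m m" and N: "N \<in> carrier_mat n n"
      and nil: "nilpotent_mat M" "nilpotent_mat N" for M N :: "'k mat" and m n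
  proof -
    have "card (short_exact_seqs M N R) \<le> card (short_exact_seqs N\<^sup>T M\<^sup>T R\<^sup>T)"
    proof (rule card_inj_on_le[of "\<lambda>(\<phi>, \<psi>). (\<psi>\<^sup>T, \<phi>\<^sup>T)"])
      show "inj_on (\<lambda>(\<phi>, \<psi>). (\<psi>\<^sup>T, \<phi>\<^sup>T)) (short_exact_seqs M N R)"
        by (rule inj_onI) (auto dest: arg_cong[of _ _ transpose_mat])
      show "(\<lambda>(\<phi>, \<psi>). (\<psi>\<^sup>T, \<phi>\<^sup>T)) ` short_exact_seqs M N R \<subseteq> short_exact_seqs N\<^sup>T M\<^sup>T R\<^sup>T"
        using short_exact_seqs_transpose[OF M N R] by auto
    qed (rule finite_short_exact_seqs)
    also have "\<dots> \<le> card (short_exact_seqs N M R)"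
    proof (rule card_short_exact_seqs_le)
      have *: "rep_iso A\<^sup>T A \<noteq> {}" if "A \<in> carrier_mat a a" "nilpotent_mat A" for A :: "'k mat" and a
        by (rule similar_mat_rep_iso[OF similar_mat_sym[OF nilpotent_similar_transpose[OF that]]])
      show "rep_iso N\<^sup>T N \<noteq> {}" "rep_iso M\<^sup>T M \<noteq> {}" "rep_iso R\<^sup>T R \<noteq> {}"
        using *[OF N nil(2)] *[OF M nil(1)] *[OF R \<open>nilpotent_mat R\<close>] .
    qed (use M N R in simp_all)
    finally show ?thesis .
  qed
  show ?thesis using le[OF M N nil(1,2)] le[OF N M nil(2,1)] by simp
qed


section \<open>Sums over subobjects and quotients\<close>

lemma rep_rep_class_nilpotent:
  "rep_rep_class M \<in> carrier_mat (rep_dim M) (rep_dim M)" "nilpotent_mat (rep_rep_class M)"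
  using Quotient_rep_reflp[OF Quotient_rep_class, of M] by (auto simp: rep_dim.rep_eq nilpotent_mat_def)

lemma abs_rep_class_eq_iff:
  assumes "nilpotent_mat A" "nilpotent_mat B"
  shows "abs_rep_class A = abs_rep_class B \<longleftrightarrow> rep_iso A B \<noteq> {}"
  using Quotient_rel[OF Quotient_rep_class, of A B] assms
    rep_iso_refl[OF nilpotent_mat_square[OF assms(1)]] rep_iso_refl[OF nilpotent_mat_square[OF assms(2)]]
  by blast

lemma abs_rep_rep_class [simp]: "abs_rep_class (rep_rep_class M) = M"
  by (rule Quotient_abs_rep[OF Quotient_rep_class])

lemma rep_abs_rep_class_iso:
  assumes "nilpotent_mat A"
  shows "rep_iso (rep_rep_class (abs_rep_class A)) A \<noteq> {}"
  using abs_rep_class_eq_iff[OF rep_rep_class_nilpotent(2) assms, of "abs_rep_class A"] by simp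

lemma rep_iso_carrierE:
  fixes A B :: "'k::field mat"
  assumes "\<theta> \<in> rep_iso A B" "A \<in> carrier_mat n n" "B \<in> carrier_mat m m"
  obtains \<eta> where "m = n" "\<theta> \<in> carrier_mat n n" "\<eta> \<in> carrier_mat n n" "\<theta> * \<eta> = 1\<^sub>m n" "\<eta> * \<theta> = 1\<^sub>m n" "\<theta> * A = B * \<theta>"
proof -
  have sq: "square_mat A" "square_mat B" using assms(2,3) by simp_all
  from rep_isoE[OF assms(1) sq] obtain \<eta> k where *: "A \<in> carrier_mat k k" "B \<in> carrier_mat k k"
    "\<theta> \<in> carrier_mat k k" "\<eta> \<in> carrier_mat k k" "\<theta> * \<eta> = 1\<^sub>m k" "\<eta> * \<theta> = 1\<^sub>m k" "\<theta> * A = B * \<theta>" by metis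
  moreover have "k = n" "k = m" using *(1,2) assms(2,3) by auto
  ultimately show thesis using that by simp
qed

lemma inj_hom_square_iso:
  fixes A B :: "'k::{field,finite} mat"
  assumes "A \<in> carrier_mat n n" "B \<in> carrier_mat n n" "\<theta> \<in> carrier_mat n n" "inj_mat \<theta>" "\<theta> * A = B * \<theta>"
  shows "\<theta> \<in> rep_iso A B"
proof -
  obtain \<eta> where "\<eta> \<in> carrier_mat n n" "\<eta> * \<theta> = 1\<^sub>m n" "\<theta> * \<eta> = 1\<^sub>m n" by (rule inj_mat_square[OF assms(3,4)])
  then show ?thesis using rep_isoI[OF assms(1,2,3)] assms(5) by blast
qed

lemma ses_dim:
  fixes M N R :: "'k::{field,finite} mat"
  assumes "(\<phi>, \<psi>) \<in> short_exact_seqs M N R"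
    and "M \<in> carrier_mat m m" "N \<in> carrier_mat n n" "R \<in> carrier_mat r r"
  shows "r = m + n"
  using short_exact_seqs_dim[of M N R] assms by auto

lemma ses_comp_iso_sub:
  fixes M N R :: "'k::{field,finite} mat"
  assumes M: "M \<in> carrier_mat m m" and N: "N \<in> carrier_mat n n" and L: "L \<in> carrier_mat l l" and R: "R \<in> carrier_mat r r"
    and s: "(i, \<psi>) \<in> short_exact_seqs M L R" and \<theta>: "\<theta> \<in> rep_iso N L"
  shows "(i * \<theta>, \<psi>) \<in> short_exact_seqs M N R"
proof -
  obtain \<eta> where w: "l = n" "\<theta> \<in> carrier_mat n n" "\<eta> \<in> carrier_mat n n" "\<theta> * \<eta> = 1\<^sub>m n" "\<eta> * \<theta> = 1\<^sub>m n" "\<theta> * N = L * \<theta>"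
    by (rule rep_iso_carrierE[OF \<theta> N L])
  note L = L[unfolded w(1)]
  note d = short_exact_seqsE[OF s M L R]
  have iv: "(i * \<theta>) *\<^sub>v v = i *\<^sub>v (\<theta> *\<^sub>v v)" if "v \<in> carrier_vec n" for v
    by (rule assoc_mult_mat_vec[OF d(1) w(2) that])
  have \<theta>v: "\<theta> *\<^sub>v v \<in> carrier_vec n" if "v \<in> carrier_vec n" for v using w(2) that by simp
  show ?thesis
  proof (rule short_exact_seqs_vecI[OF M N R _ d(2) _ d(4)])
    show "i * \<theta> \<in> carrier_mat r n" using d(1) w(2) by simp
    show "i * \<theta> * N = R * (i * \<theta>)" by (rule hom_comp[OF w(2) d(1) N L R w(6) d(3)])
    fix u :: "'k vec" assume u: "u \<in> carrier_vec n"
    show "u = 0\<^sub>v n" if "(i * \<theta>) *\<^sub>v u = 0\<^sub>v r"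
    proof -
      have "\<theta> *\<^sub>v u = 0\<^sub>v n" using that iv[OF u] d(8)[OF \<theta>v[OF u]] by simp
      then show ?thesis using inj_matI_left_inverse[OF w(2,3,5)] inj_mat_iff_kernel[OF w(2)] u by blast
    qed
    show "\<psi> *\<^sub>v ((i * \<theta>) *\<^sub>v u) = 0\<^sub>v m" using iv[OF u] d(11)[OF \<theta>v[OF u]] by simp
  next
    fix x :: "'k vec" assume x: "x \<in> carrier_vec r" "\<psi> *\<^sub>v x = 0\<^sub>v m"
    then obtain u where u: "u \<in> carrier_vec n" "x = i *\<^sub>v u" using d(10) by blast
    have e: "\<eta> *\<^sub>v u \<in> carrier_vec n" using w(3) u(1) by simp
    have "\<theta> *\<^sub>v (\<eta> *\<^sub>v u) = u" using assoc_mult_mat_vec[OF w(2,3) u(1)] w(4) u(1) by simp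
    then show "\<exists>u\<in>carrier_vec n. x = (i * \<theta>) *\<^sub>v u" using iv[OF e] u(2) e by metis
  qed (rule d(9))
qed

lemma ses_comp_iso_quot:
  fixes M N R :: "'k::{field,finite} mat"
  assumes M: "M \<in> carrier_mat m m" and N: "N \<in> carrier_mat n n" and C: "C \<in> carrier_mat c c" and R: "R \<in> carrier_mat r r"
    and s: "(\<phi>, p) \<in> short_exact_seqs C N R" and \<theta>: "\<theta> \<in> rep_iso C M"
  shows "(\<phi>, \<theta> * p) \<in> short_exact_seqs M N R"
proof -
  obtain \<eta> where w: "m = c" "\<theta> \<in> carrier_mat c c" "\<eta> \<in> carrier_mat c c" "\<theta> * \<eta> = 1\<^sub>m c" "\<eta> * \<theta> = 1\<^sub>m c" "\<theta> * C = M * \<theta>"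
    by (rule rep_iso_carrierE[OF \<theta> C M])
  note M = M[unfolded w(1)]
  note d = short_exact_seqsE[OF s C N R]
  have pv: "(\<theta> * p) *\<^sub>v v = \<theta> *\<^sub>v (p *\<^sub>v v)" if "v \<in> carrier_vec r" for v
    by (rule assoc_mult_mat_vec[OF w(2) d(2) that])
  have c: "p *\<^sub>v v \<in> carrier_vec c" if "v \<in> carrier_vec r" for v using d(2) that by simp
  have c': "\<phi> *\<^sub>v v \<in> carrier_vec r" if "v \<in> carrier_vec n" for v using d(1) that by simp
  have inj: "inj_mat \<theta>" by (rule inj_matI_left_inverse[OF w(2,3,5)])
  show ?thesis
  proof (rule short_exact_seqs_vecI[OF M N R d(1) _ d(3) _ d(8)])
    show "\<theta> * p \<in> carrier_mat c r" using d(2) w(2) by simp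
    show "\<theta> * p * R = M * (\<theta> * p)" by (rule hom_comp[OF d(2) w(2) R C M d(4) w(6)])
    show "(\<theta> * p) *\<^sub>v (\<phi> *\<^sub>v u) = 0\<^sub>v c" if u: "u \<in> carrier_vec n" for u
      using pv[OF c'[OF u]] d(11)[OF u] mat_zero_vec[OF w(2)] by simp
    show "\<exists>u\<in>carrier_vec n. x = \<phi> *\<^sub>v u" if x: "x \<in> carrier_vec r" "(\<theta> * p) *\<^sub>v x = 0\<^sub>v c" for x
    proof -
      have "p *\<^sub>v x = 0\<^sub>v c" using inj inj_mat_iff_kernel[OF w(2)] c[OF x(1)] pv[OF x(1)] x(2) by metis
      then show ?thesis using d(10)[OF x(1)] by blast
    qed
    show "\<exists>u\<in>carrier_vec r. (\<theta> * p) *\<^sub>v u = x" if x: "x \<in> carrier_vec c" for x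
    proof -
      have e: "\<eta> *\<^sub>v x \<in> carrier_vec c" using w(3) x by simp
      have "\<theta> *\<^sub>v (\<eta> *\<^sub>v x) = x" using assoc_mult_mat_vec[OF w(2,3) x] w(4) x by simp
      then show ?thesis using d(9)[OF e] pv by metis
    qed
  qed auto
qed

text \<open>
  The exact sequences with a given surjection differ by an isomorphism of the subobject, and those with
  a given injection by an isomorphism of the quotient. This is how the orders of automorphism groups
  enter, and why they cancel in the structure constants of the Hall algebra.
\<close>

lemma ses_fibre_sub:
  fixes M N R :: "'k::{field,finite} mat"
  assumes M: "M \<in> carrier_mat m m" and N: "N \<in> carrier_mat n n" and R: "R \<in> carrier_mat r r" and L: "L \<in> carrier_mat l l"
    and s: "(i, \<psi>) \<in> short_exact_seqs M L R"
  shows "{\<phi>. (\<phi>, \<psi>) \<in> short_exact_seqs M N R} = (\<lambda>\<theta>. i * \<theta>) ` rep_iso N L"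
    and "inj_on (\<lambda>\<theta>. i * \<theta>) (rep_iso N L)"
proof -
  note d = short_exact_seqsE[OF s M L R]
  show "{\<phi>. (\<phi>, \<psi>) \<in> short_exact_seqs M N R} = (\<lambda>\<theta>. i * \<theta>) ` rep_iso N L"
  proof (intro subset_antisym subsetI)
    fix \<phi> assume "\<phi> \<in> {\<phi>. (\<phi>, \<psi>) \<in> short_exact_seqs M N R}"
    then have s': "(\<phi>, \<psi>) \<in> short_exact_seqs M N R" by simp
    note d' = short_exact_seqsE[OF s' M N R]
    have l: "l = n" using ses_dim[OF s M L R] ses_dim[OF s' M N R] by simp
    have im: "\<exists>u\<in>carrier_vec l. \<phi> *\<^sub>v v = i *\<^sub>v u" if "v \<in> carrier_vec n" for v
      using d(10)[of "\<phi> *\<^sub>v v"] d'(11)[OF that] d'(1) that by simp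
    obtain \<theta> where \<theta>: "\<theta> \<in> carrier_mat l n" "i * \<theta> = \<phi>" "\<theta> * N = L * \<theta>"
      by (rule factor_through_inj[OF d(1,5) d'(1) im L R N d(3) d'(3)])
    have "inj_mat \<theta>" unfolding inj_mat_iff_kernel[OF \<theta>(1)]
    proof (intro ballI impI)
      fix v assume v: "v \<in> carrier_vec n" and "\<theta> *\<^sub>v v = 0\<^sub>v l"
      then have "\<phi> *\<^sub>v v = 0\<^sub>v r"
        using assoc_mult_mat_vec[OF d(1) \<theta>(1) v] \<theta>(2) mat_zero_vec[OF d(1)] by simp
      then show "v = 0\<^sub>v n" by (rule d'(8)[OF v])
    qed
    then have "\<theta> \<in> rep_iso N L" using inj_hom_square_iso[of N n L \<theta>] N L \<theta> l by simp
    then show "\<phi> \<in> (\<lambda>\<theta>. i * \<theta>) ` rep_iso N L" using \<theta>(2) by blast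
  next
    fix \<phi> assume "\<phi> \<in> (\<lambda>\<theta>. i * \<theta>) ` rep_iso N L"
    then show "\<phi> \<in> {\<phi>. (\<phi>, \<psi>) \<in> short_exact_seqs M N R}" using ses_comp_iso_sub[OF M N L R s] by blast
  qed
  show "inj_on (\<lambda>\<theta>. i * \<theta>) (rep_iso N L)"
  proof (rule inj_onI)
    fix x y assume "x \<in> rep_iso N L" "y \<in> rep_iso N L" and eq: "i * x = i * y"
    then have "x \<in> carrier_mat l n" "y \<in> carrier_mat l n" using N L by (auto simp: rep_iso_def rep_hom_def)
    then show "x = y" using inj_mat_cancel[OF d(1,5) _ _ eq] by blast
  qed
qed

lemma ses_fibre_quot:
  fixes M N R :: "'k::{field,finite} mat"
  assumes M: "M \<in> carrier_mat m m" and N: "N \<in> carrier_mat n n" and R: "R \<in> carrier_mat r r" and C: "C \<in> carrier_mat c c"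
    and s: "(\<phi>, p) \<in> short_exact_seqs C N R"
  shows "{\<psi>. (\<phi>, \<psi>) \<in> short_exact_seqs M N R} = (\<lambda>\<theta>. \<theta> * p) ` rep_iso C M"
    and "inj_on (\<lambda>\<theta>. \<theta> * p) (rep_iso C M)"
proof -
  note d = short_exact_seqsE[OF s C N R]
  show "{\<psi>. (\<phi>, \<psi>) \<in> short_exact_seqs M N R} = (\<lambda>\<theta>. \<theta> * p) ` rep_iso C M"
  proof (intro subset_antisym subsetI)
    fix \<psi> assume "\<psi> \<in> {\<psi>. (\<phi>, \<psi>) \<in> short_exact_seqs M N R}"
    then have s': "(\<phi>, \<psi>) \<in> short_exact_seqs M N R" by simp
    note d' = short_exact_seqsE[OF s' M N R]
    have l: "c = m" using ses_dim[OF s C N R] ses_dim[OF s' M N R] by simp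
    have ker: "\<psi> *\<^sub>v v = 0\<^sub>v m" if "v \<in> carrier_vec r" "p *\<^sub>v v = 0\<^sub>v c" for v
      using d(10)[OF that(1)] d'(11) that(2) by blast
    obtain \<theta> where \<theta>: "\<theta> \<in> carrier_mat m c" "\<theta> * p = \<psi>" "\<theta> * C = M * \<theta>"
      by (rule factor_through_surj[OF d(2,6) d'(2) ker C R M d(4) d'(4)])
    have "inj_mat \<theta>" unfolding inj_mat_iff_kernel[OF \<theta>(1)]
    proof (intro ballI impI)
      fix v assume v: "v \<in> carrier_vec c" and 0: "\<theta> *\<^sub>v v = 0\<^sub>v m"
      obtain u where u: "u \<in> carrier_vec r" "p *\<^sub>v u = v" using d(9)[OF v] by blast
      have "\<psi> *\<^sub>v u = 0\<^sub>v m" using assoc_mult_mat_vec[OF \<theta>(1) d(2) u(1)] \<theta>(2) u(2) 0 by simp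
      then obtain w where "w \<in> carrier_vec n" "u = \<phi> *\<^sub>v w" using d'(10)[OF u(1)] by blast
      then show "v = 0\<^sub>v c" using d(11) u(2) by blast
    qed
    then have "\<theta> \<in> rep_iso C M" using inj_hom_square_iso[of C c M \<theta>] M C \<theta> l by simp
    then show "\<psi> \<in> (\<lambda>\<theta>. \<theta> * p) ` rep_iso C M" using \<theta>(2) by blast
  next
    fix \<psi> assume "\<psi> \<in> (\<lambda>\<theta>. \<theta> * p) ` rep_iso C M"
    then show "\<psi> \<in> {\<psi>. (\<phi>, \<psi>) \<in> short_exact_seqs M N R}" using ses_comp_iso_quot[OF M N C R s] by blast
  qed
  show "inj_on (\<lambda>\<theta>. \<theta> * p) (rep_iso C M)"
  proof (rule inj_onI)
    fix x y assume "x \<in> rep_iso C M" "y \<in> rep_iso C M" and eq: "x * p = y * p"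
    then have "x \<in> carrier_mat m c" "y \<in> carrier_mat m c" using M C by (auto simp: rep_iso_def rep_hom_def)
    then show "x = y" using surj_mat_cancel[OF d(2,6) _ _ eq] by blast
  qed
qed

definition surj_homs :: "'k::field mat \<Rightarrow> 'k mat \<Rightarrow> 'k mat set" where
  "surj_homs R M = {\<psi> \<in> rep_hom R M. surj_mat \<psi>}"

definition inj_homs :: "'k::field mat \<Rightarrow> 'k mat \<Rightarrow> 'k mat set" where
  "inj_homs N R = {\<phi> \<in> rep_hom N R. inj_mat \<phi>}"

text \<open>
  Classes rather than matrices are chosen, because the matrix of a kernel depends on a basis of it.
  For a surjective homomorphism \<open>\<psi>\<close>, or an injective homomorphism \<open>\<phi>\<close>, the class is unique.
\<close>

definition kernel_class :: "'k::field mat \<Rightarrow> 'k mat \<Rightarrow> 'k mat \<Rightarrow> 'k rep_class" where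
  "kernel_class M R \<psi> = (SOME K. \<exists>i. (i, \<psi>) \<in> short_exact_seqs M (rep_rep_class K) R)"

definition cokernel_class :: "'k::field mat \<Rightarrow> 'k mat \<Rightarrow> 'k mat \<Rightarrow> 'k rep_class" where
  "cokernel_class N R \<phi> = (SOME C. \<exists>p. (\<phi>, p) \<in> short_exact_seqs (rep_rep_class C) N R)"

lemma finite_surj_homs: "finite (surj_homs R M :: 'k::{field,finite} mat set)"
  by (rule finite_subset[OF _ finite_carrier_mat[of "dim_row M" "dim_row R"]]) (auto simp: surj_homs_def rep_hom_def)

lemma finite_inj_homs: "finite (inj_homs N R :: 'k::{field,finite} mat set)"
  by (rule finite_subset[OF _ finite_carrier_mat[of "dim_row R" "dim_row N"]]) (auto simp: inj_homs_def rep_hom_def)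

lemma surj_homs_iff:
  "R \<in> carrier_mat r r \<Longrightarrow> M \<in> carrier_mat m m \<Longrightarrow>
    \<psi> \<in> surj_homs R M \<longleftrightarrow> \<psi> \<in> carrier_mat m r \<and> \<psi> * R = M * \<psi> \<and> surj_mat \<psi>"
  by (auto simp: surj_homs_def rep_hom_def)

lemma inj_homs_iff:
  "N \<in> carrier_mat n n \<Longrightarrow> R \<in> carrier_mat r r \<Longrightarrow>
    \<phi> \<in> inj_homs N R \<longleftrightarrow> \<phi> \<in> carrier_mat r n \<and> \<phi> * N = R * \<phi> \<and> inj_mat \<phi>"
  by (auto simp: inj_homs_def rep_hom_def)

lemma kernel_classE:
  fixes R :: "'k::{field,finite} mat"
  assumes R: "R \<in> carrier_mat r r" "nilpotent_mat R" and M: "M \<in> carrier_mat m m" and \<psi>: "\<psi> \<in> surj_homs R M"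
  obtains i where "(i, \<psi>) \<in> short_exact_seqs M (rep_rep_class (kernel_class M R \<psi>)) R"
proof -
  have "\<psi> \<in> carrier_mat m r" "\<psi> * R = M * \<psi>" "surj_mat \<psi>" using \<psi> surj_homs_iff[OF R(1) M] by blast+
  from kernel_rep_exists[OF R M this] obtain i L where
    L: "L \<in> carrier_mat (r - m) (r - m)" "nilpotent_mat L" "(i, \<psi>) \<in> short_exact_seqs M L R" by blast
  from rep_abs_rep_class_iso[OF L(2)] obtain \<theta> where "\<theta> \<in> rep_iso (rep_rep_class (abs_rep_class L)) L" by blast
  from ses_comp_iso_sub[OF M rep_rep_class_nilpotent(1) L(1) R(1) L(3) this]
  have "\<exists>K i. (i, \<psi>) \<in> short_exact_seqs M (rep_rep_class K) R" by blast
  from someI_ex[OF this] show thesis using that unfolding kernel_class_def by blast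
qed

lemma cokernel_classE:
  fixes R :: "'k::{field,finite} mat"
  assumes R: "R \<in> carrier_mat r r" "nilpotent_mat R" and N: "N \<in> carrier_mat n n" and \<phi>: "\<phi> \<in> inj_homs N R"
  obtains p where "(\<phi>, p) \<in> short_exact_seqs (rep_rep_class (cokernel_class N R \<phi>)) N R"
proof -
  have "\<phi> \<in> carrier_mat r n" "\<phi> * N = R * \<phi>" "inj_mat \<phi>" using \<phi> inj_homs_iff[OF N R(1)] by blast+
  from cokernel_rep_exists[OF R N this] obtain p C where
    C: "C \<in> carrier_mat (r - n) (r - n)" "nilpotent_mat C" "(\<phi>, p) \<in> short_exact_seqs C N R" by blast
  have "rep_iso C (rep_rep_class (abs_rep_class C)) \<noteq> {}"
    using rep_iso_sym[OF rep_abs_rep_class_iso[OF C(2)]] rep_rep_class_nilpotent(2) C(2) nilpotent_mat_square by blast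
  then obtain \<theta> where "\<theta> \<in> rep_iso C (rep_rep_class (abs_rep_class C))" by blast
  from ses_comp_iso_quot[OF rep_rep_class_nilpotent(1) N C(1) R(1) C(3) this]
  have "\<exists>C p. (\<phi>, p) \<in> short_exact_seqs (rep_rep_class C) N R" by blast
  from someI_ex[OF this] show thesis using that unfolding cokernel_class_def by blast
qed

lemma card_ses_fibre_kernel_class:
  fixes R :: "'k::{field,finite} mat"
  assumes R: "R \<in> carrier_mat r r" "nilpotent_mat R" and M: "M \<in> carrier_mat m m" and \<psi>: "\<psi> \<in> surj_homs R M"
  shows "card {\<phi>. (\<phi>, \<psi>) \<in> short_exact_seqs M (rep_rep_class N) R} =
    (if N = kernel_class M R \<psi> then num_aut N else 0)"
proof -
  let ?K = "kernel_class M R \<psi>"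
  obtain i where i: "(i, \<psi>) \<in> short_exact_seqs M (rep_rep_class ?K) R" by (rule kernel_classE[OF R M \<psi>])
  note f = ses_fibre_sub[OF M rep_rep_class_nilpotent(1) R(1) rep_rep_class_nilpotent(1) i, of N]
  have "card {\<phi>. (\<phi>, \<psi>) \<in> short_exact_seqs M (rep_rep_class N) R} =
      card (rep_iso (rep_rep_class N) (rep_rep_class ?K))"
    unfolding f(1) by (rule card_image[OF f(2)])
  also have "\<dots> = (if N = ?K then num_aut N else 0)"
    using abs_rep_class_eq_iff[OF rep_rep_class_nilpotent(2) rep_rep_class_nilpotent(2), of N ?K]
    by (auto simp: num_aut.rep_eq)
  finally show ?thesis .
qed

lemma card_ses_fibre_cokernel_class:
  fixes R :: "'k::{field,finite} mat"
  assumes R: "R \<in> carrier_mat r r" "nilpotent_mat R" and N: "N \<in> carrier_mat n n" and \<phi>: "\<phi> \<in> inj_homs N R"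
  shows "card {\<psi>. (\<phi>, \<psi>) \<in> short_exact_seqs (rep_rep_class M) N R} =
    (if M = cokernel_class N R \<phi> then num_aut M else 0)"
proof -
  let ?C = "cokernel_class N R \<phi>"
  obtain p where p: "(\<phi>, p) \<in> short_exact_seqs (rep_rep_class ?C) N R" by (rule cokernel_classE[OF R N \<phi>])
  note f = ses_fibre_quot[OF rep_rep_class_nilpotent(1) N R(1) rep_rep_class_nilpotent(1) p, of M]
  have "card {\<psi>. (\<phi>, \<psi>) \<in> short_exact_seqs (rep_rep_class M) N R} =
      card (rep_iso (rep_rep_class ?C) (rep_rep_class M))"
    unfolding f(1) by (rule card_image[OF f(2)])
  also have "\<dots> = (if M = ?C then num_aut M else 0)"
    using abs_rep_class_eq_iff[OF rep_rep_class_nilpotent(2) rep_rep_class_nilpotent(2), of ?C M]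
    by (auto simp: num_aut.rep_eq)
  finally show ?thesis .
qed

lemma num_aut_pos: "num_aut (M :: 'k::{field,finite} rep_class) > 0"
proof -
  have "finite (rep_iso (rep_rep_class M) (rep_rep_class M))"
    by (rule finite_subset[OF _ finite_carrier_mat]) (auto simp: rep_iso_def rep_hom_def)
  then show ?thesis unfolding num_aut.rep_eq
    using rep_iso_refl[OF nilpotent_mat_square[OF rep_rep_class_nilpotent(2)], of M] by (auto simp: card_gt_0_iff)
qed

lemma finite_rep_dim_le: "finite {M :: 'k::{field,finite} rep_class. rep_dim M \<le> d}"
proof -
  have "{M :: 'k rep_class. rep_dim M \<le> d} = (\<Union>e\<le>d. {M. rep_dim M = e})" by auto
  then show ?thesis using finite_rep_dim by auto
qed

text \<open>
  The factor \<open>num_aut N\<close> by which each \<open>\<psi>\<close> with \<open>\<kappa> \<psi> = N\<close> is overcounted in \<open>E N\<close> cancels, so that a sum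
  weighted with numbers of exact sequences becomes an unweighted sum over homomorphisms.
\<close>

lemma sum_over_classes:
  fixes y :: "'k::{field,finite} rep_class \<Rightarrow> rat"
  assumes I: "finite I" "\<And>\<psi>. \<psi> \<in> I \<Longrightarrow> rep_dim (\<kappa> \<psi>) \<le> r"
    and fib: "\<And>N. card (E N) = (\<Sum>\<psi>\<in>I. if N = \<kappa> \<psi> then num_aut N else 0)"
  shows "(\<Sum>N | rep_dim N \<le> r. y N * of_nat (card (E N)) / of_nat (num_aut N)) = (\<Sum>\<psi>\<in>I. y (\<kappa> \<psi>))"
proof -
  let ?D = "{N :: 'k rep_class. rep_dim N \<le> r}"
  have "(\<Sum>N\<in>?D. y N * of_nat (card (E N)) / of_nat (num_aut N)) =
      (\<Sum>N\<in>?D. \<Sum>\<psi>\<in>I. if N = \<kappa> \<psi> then y N else 0)"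
  proof (intro sum.cong refl)
    fix N :: "'k rep_class"
    have nz: "of_nat (num_aut N) \<noteq> (0 :: rat)" using num_aut_pos[of N] by simp
    have "y N * of_nat (card (E N)) / of_nat (num_aut N) =
        (\<Sum>\<psi>\<in>I. y N * of_nat (if N = \<kappa> \<psi> then num_aut N else 0) / of_nat (num_aut N))"
      unfolding fib by (simp add: sum_distrib_left sum_divide_distrib)
    also have "\<dots> = (\<Sum>\<psi>\<in>I. if N = \<kappa> \<psi> then y N else 0)"
      using nz by (intro sum.cong) auto
    finally show "y N * of_nat (card (E N)) / of_nat (num_aut N) = \<dots>" .
  qed
  also have "\<dots> = (\<Sum>\<psi>\<in>I. \<Sum>N\<in>?D. if N = \<kappa> \<psi> then y N else 0)" by (rule sum.swap)
  also have "\<dots> = (\<Sum>\<psi>\<in>I. y (\<kappa> \<psi>))"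
    using I(2) finite_rep_dim_le[of r, where ?'k = 'k] by (intro sum.cong refl) simp
  finally show ?thesis .
qed

lemma sum_over_kernels:
  fixes R :: "'k::{field,finite} mat" and y :: "'k rep_class \<Rightarrow> rat"
  assumes R: "R \<in> carrier_mat r r" "nilpotent_mat R" and M: "M \<in> carrier_mat m m"
  shows "(\<Sum>N | rep_dim N \<le> r. y N * of_nat (card (short_exact_seqs M (rep_rep_class N) R)) / of_nat (num_aut N)) =
    (\<Sum>\<psi>\<in>surj_homs R M. y (kernel_class M R \<psi>))"
proof (rule sum_over_classes)
  show "card (short_exact_seqs M (rep_rep_class N) R) =
      (\<Sum>\<psi>\<in>surj_homs R M. if N = kernel_class M R \<psi> then num_aut N else 0)" for N
  proof -
    have "short_exact_seqs M (rep_rep_class N) R =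
        (\<lambda>(\<psi>, \<phi>). (\<phi>, \<psi>)) ` (SIGMA \<psi>:surj_homs R M. {\<phi>. (\<phi>, \<psi>) \<in> short_exact_seqs M (rep_rep_class N) R})"
      by (auto simp: short_exact_seqs_iff[OF M rep_rep_class_nilpotent(1) R(1)] surj_homs_iff[OF R(1) M] image_iff)
    from arg_cong[OF this, of card] have "card (short_exact_seqs M (rep_rep_class N) R) =
        card (SIGMA \<psi>:surj_homs R M. {\<phi>. (\<phi>, \<psi>) \<in> short_exact_seqs M (rep_rep_class N) R})"
      by (rule trans[OF _ card_image]) (auto simp: inj_on_def)
    also have "\<dots> = (\<Sum>\<psi>\<in>surj_homs R M. card {\<phi>. (\<phi>, \<psi>) \<in> short_exact_seqs M (rep_rep_class N) R})"
    proof (rule card_SigmaI[OF finite_surj_homs], rule ballI)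
      fix \<psi>
      have "{\<phi>. (\<phi>, \<psi>) \<in> short_exact_seqs M (rep_rep_class N) R} \<subseteq> fst ` short_exact_seqs M (rep_rep_class N) R" by force
      then show "finite {\<phi>. (\<phi>, \<psi>) \<in> short_exact_seqs M (rep_rep_class N) R}"
        using finite_short_exact_seqs finite_subset by blast
    qed
    also have "\<dots> = (\<Sum>\<psi>\<in>surj_homs R M. if N = kernel_class M R \<psi> then num_aut N else 0)"
      by (intro sum.cong refl card_ses_fibre_kernel_class[OF R M])
    finally show ?thesis .
  qed
  show "rep_dim (kernel_class M R \<psi>) \<le> r" if \<psi>: "\<psi> \<in> surj_homs R M" for \<psi>
  proof -
    obtain i where i: "(i, \<psi>) \<in> short_exact_seqs M (rep_rep_class (kernel_class M R \<psi>)) R"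
      by (rule kernel_classE[OF R M \<psi>])
    then show ?thesis using ses_dim[OF i M rep_rep_class_nilpotent(1) R(1)] by simp
  qed
  show "finite (surj_homs R M)" by (rule finite_surj_homs)
qed

lemma sum_over_cokernels:
  fixes R :: "'k::{field,finite} mat" and y :: "'k rep_class \<Rightarrow> rat"
  assumes R: "R \<in> carrier_mat r r" "nilpotent_mat R" and N: "N \<in> carrier_mat n n"
  shows "(\<Sum>M | rep_dim M \<le> r. y M * of_nat (card (short_exact_seqs (rep_rep_class M) N R)) / of_nat (num_aut M)) =
    (\<Sum>\<phi>\<in>inj_homs N R. y (cokernel_class N R \<phi>))"
proof (rule sum_over_classes)
  show "card (short_exact_seqs (rep_rep_class M) N R) =
      (\<Sum>\<phi>\<in>inj_homs N R. if M = cokernel_class N R \<phi> then num_aut M else 0)" for M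
  proof -
    have sub: "\<phi> \<in> inj_homs N R" if "(\<phi>, \<psi>) \<in> short_exact_seqs (rep_rep_class M) N R" for \<phi> \<psi>
      using that unfolding short_exact_seqs_iff[OF rep_rep_class_nilpotent(1) N R(1)] inj_homs_iff[OF N R(1)] by blast
    have "short_exact_seqs (rep_rep_class M) N R =
        (SIGMA \<phi>:inj_homs N R. {\<psi>. (\<phi>, \<psi>) \<in> short_exact_seqs (rep_rep_class M) N R})"
      by (auto dest: sub)
    from arg_cong[OF this, of card] have "card (short_exact_seqs (rep_rep_class M) N R) =
        card (SIGMA \<phi>:inj_homs N R. {\<psi>. (\<phi>, \<psi>) \<in> short_exact_seqs (rep_rep_class M) N R})" .
    also have "\<dots> = (\<Sum>\<phi>\<in>inj_homs N R. card {\<psi>. (\<phi>, \<psi>) \<in> short_exact_seqs (rep_rep_class M) N R})"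
    proof (rule card_SigmaI[OF finite_inj_homs], rule ballI)
      fix \<phi>
      have "{\<psi>. (\<phi>, \<psi>) \<in> short_exact_seqs (rep_rep_class M) N R} \<subseteq> snd ` short_exact_seqs (rep_rep_class M) N R" by force
      then show "finite {\<psi>. (\<phi>, \<psi>) \<in> short_exact_seqs (rep_rep_class M) N R}"
        using finite_short_exact_seqs finite_subset by blast
    qed
    also have "\<dots> = (\<Sum>\<phi>\<in>inj_homs N R. if M = cokernel_class N R \<phi> then num_aut M else 0)"
      by (intro sum.cong refl card_ses_fibre_cokernel_class[OF R N])
    finally show ?thesis .
  qed
  show "rep_dim (cokernel_class N R \<phi>) \<le> r" if \<phi>: "\<phi> \<in> inj_homs N R" for \<phi>
  proof -
    obtain p where p: "(\<phi>, p) \<in> short_exact_seqs (rep_rep_class (cokernel_class N R \<phi>)) N R"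
      by (rule cokernel_classE[OF R N \<phi>])
    then show ?thesis using ses_dim[OF p rep_rep_class_nilpotent(1) N R(1)] by simp
  qed
  show "finite (inj_homs N R)" by (rule finite_inj_homs)
qed

section \<open>Associativity and commutativity of the Hall product\<close>

lemma card_eq_of_unique_relation:
  assumes ab: "\<And>a. a \<in> A \<Longrightarrow> \<exists>!b. b \<in> B \<and> P a b" and ba: "\<And>b. b \<in> B \<Longrightarrow> \<exists>!a. a \<in> A \<and> P a b"
  shows "card A = card B"
proof -
  define f where "f a = (THE b. b \<in> B \<and> P a b)" for a
  have f: "f a \<in> B \<and> P a (f a)" if "a \<in> A" for a
    unfolding f_def by (rule theI'[OF ab[OF that]])
  have "bij_betw f A B"
  proof (rule bij_betw_imageI)
    show "inj_on f A"
    proof (rule inj_onI)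
      fix x y assume "x \<in> A" "y \<in> A" "f x = f y"
      then show "x = y" using f[of x] f[of y] ba[of "f x"] by auto
    qed
    show "f ` A = B"
    proof (intro subset_antisym subsetI)
      fix b assume b: "b \<in> B"
      then obtain a where a: "a \<in> A" "P a b" using ba by blast
      then have "f a = b" using f[of a] ab[of a] b by blast
      then show "b \<in> f ` A" using a by blast
    qed (use f in auto)
  qed
  then show ?thesis by (rule bij_betw_same_card)
qed

text \<open>
  Both sides count the filtrations of \<open>R\<close> with subquotients \<open>K\<close>, \<open>N\<close>, \<open>M\<close> from bottom to top, each one as
  often as these subquotients can be identified with \<open>K\<close>, \<open>N\<close> and \<open>M\<close>: on the left through the quotient
  \<open>C\<close> of \<open>R\<close> by \<open>K\<close>, on the right through the kernel \<open>L\<close> of the map from \<open>R\<close> to \<open>M\<close>.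
\<close>

lemma sum_num_ses_assoc:
  fixes M N K R :: "'k::{field,finite} rep_class"
  shows "(\<Sum>X | rep_dim X \<le> rep_dim R. of_nat (num_ses M N X) * of_nat (num_ses X K R) / of_nat (num_aut X)) =
    (\<Sum>Y | rep_dim Y \<le> rep_dim R. of_nat (num_ses N K Y) * of_nat (num_ses M Y R) / of_nat (num_aut Y) :: rat)"
proof -
  define m n k r where "m = rep_dim M" "n = rep_dim N" "k = rep_dim K" "r = rep_dim R"
  let ?M = "rep_rep_class M" and ?N = "rep_rep_class N" and ?K = "rep_rep_class K" and ?R = "rep_rep_class R"
  have M: "?M \<in> carrier_mat m m" and N: "?N \<in> carrier_mat n n" and K: "?K \<in> carrier_mat k k"
    and R: "?R \<in> carrier_mat r r" "nilpotent_mat ?R"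
    by (simp_all add: m_n_k_r_def rep_rep_class_nilpotent)
  define C where "C \<phi> = rep_rep_class (cokernel_class ?K ?R \<phi>)" for \<phi>
  define L where "L \<pi> = rep_rep_class (kernel_class ?M ?R \<pi>)" for \<pi>
  define p where "p \<phi> = (SOME p. (\<phi>, p) \<in> short_exact_seqs (C \<phi>) ?K ?R)" for \<phi>
  define i where "i \<pi> = (SOME i. (i, \<pi>) \<in> short_exact_seqs ?M (L \<pi>) ?R)" for \<pi>
  have Cc: "C \<phi> \<in> carrier_mat (dim_row (C \<phi>)) (dim_row (C \<phi>))" for \<phi>
    using rep_rep_class_nilpotent(1) unfolding C_def by (metis carrier_matD(1))
  have Lc: "L \<pi> \<in> carrier_mat (dim_row (L \<pi>)) (dim_row (L \<pi>))" for \<pi>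
    using rep_rep_class_nilpotent(1) unfolding L_def by (metis carrier_matD(1))
  have p: "(\<phi>, p \<phi>) \<in> short_exact_seqs (C \<phi>) ?K ?R" if "\<phi> \<in> inj_homs ?K ?R" for \<phi>
    using cokernel_classE[OF R K that] unfolding p_def C_def by (metis someI_ex)
  have i: "(i \<pi>, \<pi>) \<in> short_exact_seqs ?M (L \<pi>) ?R" if "\<pi> \<in> surj_homs ?R ?M" for \<pi>
    using kernel_classE[OF R M that] unfolding i_def L_def by (metis someI_ex)
  let ?A = "SIGMA \<phi>:inj_homs ?K ?R. short_exact_seqs ?M ?N (C \<phi>)"
  let ?B = "SIGMA \<pi>:surj_homs ?R ?M. short_exact_seqs ?N ?K (L \<pi>)"
  let ?P = "\<lambda>(\<phi>, (\<phi>', \<psi>')) (\<pi>, (\<phi>'', \<psi>'')).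
    \<pi> = \<psi>' * p \<phi> \<and> \<phi> = i \<pi> * \<phi>'' \<and> \<phi>' * \<psi>'' = p \<phi> * i \<pi>"
  have "card ?A = card ?B"
  proof (rule card_eq_of_unique_relation[of _ _ ?P])
    fix a assume "a \<in> ?A"
    then obtain \<phi> \<phi>' \<psi>' where a: "a = (\<phi>, (\<phi>', \<psi>'))" and \<phi>: "\<phi> \<in> inj_homs ?K ?R"
      and s: "(\<phi>', \<psi>') \<in> short_exact_seqs ?M ?N (C \<phi>)" by auto
    have \<pi>: "\<psi>' * p \<phi> \<in> surj_homs ?R ?M"
      using filtration_compose_quot[OF M N K R(1) Cc p[OF \<phi>] s] surj_homs_iff[OF R(1) M] by blast
    have "\<exists>!(\<phi>'', \<psi>''). (\<phi>'', \<psi>'') \<in> short_exact_seqs ?N ?K (L (\<psi>' * p \<phi>)) \<and>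
        \<phi> = i (\<psi>' * p \<phi>) * \<phi>'' \<and> \<phi>' * \<psi>'' = p \<phi> * i (\<psi>' * p \<phi>)"
      by (rule filtration_refine_sub[OF M N K R(1) Cc Lc p[OF \<phi>] s i[OF \<pi>]])
    then obtain x where x: "case x of (\<phi>'', \<psi>'') \<Rightarrow> (\<phi>'', \<psi>'') \<in> short_exact_seqs ?N ?K (L (\<psi>' * p \<phi>)) \<and>
        \<phi> = i (\<psi>' * p \<phi>) * \<phi>'' \<and> \<phi>' * \<psi>'' = p \<phi> * i (\<psi>' * p \<phi>)"
      and ux: "\<And>y. (case y of (\<phi>'', \<psi>'') \<Rightarrow> (\<phi>'', \<psi>'') \<in> short_exact_seqs ?N ?K (L (\<psi>' * p \<phi>)) \<and>
        \<phi> = i (\<psi>' * p \<phi>) * \<phi>'' \<and> \<phi>' * \<psi>'' = p \<phi> * i (\<psi>' * p \<phi>)) \<Longrightarrow> y = x" by blast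
    show "\<exists>!b. b \<in> ?B \<and> ?P a b"
    proof (rule ex1I[of _ "(\<psi>' * p \<phi>, x)"])
      obtain u v where xuv: "x = (u, v)" by (cases x) auto
      show "(\<psi>' * p \<phi>, x) \<in> ?B \<and> ?P a (\<psi>' * p \<phi>, x)"
        using x \<pi> unfolding a xuv prod.case mem_Sigma_iff by blast
    next
      fix b assume b: "b \<in> ?B \<and> ?P a b"
      obtain \<pi> u v where b': "b = (\<pi>, (u, v))" by (cases b) auto
      have *: "\<pi> = \<psi>' * p \<phi>" "(u, v) \<in> short_exact_seqs ?N ?K (L \<pi>)" "\<phi> = i \<pi> * u" "\<phi>' * v = p \<phi> * i \<pi>"
        using b unfolding a b' prod.case mem_Sigma_iff by blast+
      have "(u, v) = x" by (rule ux) (use *(2-4) in \<open>unfold *(1) prod.case, blast\<close>)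
      then show "b = (\<psi>' * p \<phi>, x)" unfolding b' *(1) by simp
    qed
  next
    fix b assume "b \<in> ?B"
    then obtain \<pi> \<phi>'' \<psi>'' where b: "b = (\<pi>, (\<phi>'', \<psi>''))" and \<pi>: "\<pi> \<in> surj_homs ?R ?M"
      and s: "(\<phi>'', \<psi>'') \<in> short_exact_seqs ?N ?K (L \<pi>)" by auto
    have \<phi>: "i \<pi> * \<phi>'' \<in> inj_homs ?K ?R"
      using filtration_compose_sub[OF M N K R(1) Lc i[OF \<pi>] s] inj_homs_iff[OF K R(1)] by blast
    have "\<exists>!(\<phi>', \<psi>'). (\<phi>', \<psi>') \<in> short_exact_seqs ?M ?N (C (i \<pi> * \<phi>'')) \<and>
        \<pi> = \<psi>' * p (i \<pi> * \<phi>'') \<and> \<phi>' * \<psi>'' = p (i \<pi> * \<phi>'') * i \<pi>"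
      by (rule filtration_refine_quot[OF M N K R(1) Cc Lc i[OF \<pi>] s p[OF \<phi>]])
    then obtain x where x: "case x of (\<phi>', \<psi>') \<Rightarrow> (\<phi>', \<psi>') \<in> short_exact_seqs ?M ?N (C (i \<pi> * \<phi>'')) \<and>
        \<pi> = \<psi>' * p (i \<pi> * \<phi>'') \<and> \<phi>' * \<psi>'' = p (i \<pi> * \<phi>'') * i \<pi>"
      and ux: "\<And>y. (case y of (\<phi>', \<psi>') \<Rightarrow> (\<phi>', \<psi>') \<in> short_exact_seqs ?M ?N (C (i \<pi> * \<phi>'')) \<and>
        \<pi> = \<psi>' * p (i \<pi> * \<phi>'') \<and> \<phi>' * \<psi>'' = p (i \<pi> * \<phi>'') * i \<pi>) \<Longrightarrow> y = x" by blast
    show "\<exists>!a. a \<in> ?A \<and> ?P a b"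
    proof (rule ex1I[of _ "(i \<pi> * \<phi>'', x)"])
      obtain u v where xuv: "x = (u, v)" by (cases x) auto
      show "(i \<pi> * \<phi>'', x) \<in> ?A \<and> ?P (i \<pi> * \<phi>'', x) b"
        using x \<phi> unfolding b xuv prod.case mem_Sigma_iff by blast
    next
      fix a assume a: "a \<in> ?A \<and> ?P a b"
      obtain \<phi> u v where a': "a = (\<phi>, (u, v))" by (cases a) auto
      have *: "\<phi> = i \<pi> * \<phi>''" "(u, v) \<in> short_exact_seqs ?M ?N (C \<phi>)" "\<pi> = v * p \<phi>" "u * \<psi>'' = p \<phi> * i \<pi>"
        using a unfolding b a' prod.case mem_Sigma_iff by blast+
      have "(u, v) = x" by (rule ux) (use *(2-4) in \<open>unfold *(1) prod.case, blast\<close>)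
      then show "a = (i \<pi> * \<phi>'', x)" unfolding a' *(1) by simp
    qed
  qed
  moreover have "card ?A = (\<Sum>\<phi>\<in>inj_homs ?K ?R. num_ses M N (cokernel_class ?K ?R \<phi>))"
    using card_SigmaI[OF finite_inj_homs, of ?K ?R "\<lambda>\<phi>. short_exact_seqs ?M ?N (C \<phi>)"]
    by (simp add: finite_short_exact_seqs num_ses.rep_eq C_def)
  moreover have "card ?B = (\<Sum>\<pi>\<in>surj_homs ?R ?M. num_ses N K (kernel_class ?M ?R \<pi>))"
    using card_SigmaI[OF finite_surj_homs, of ?R ?M "\<lambda>\<pi>. short_exact_seqs ?N ?K (L \<pi>)"]
    by (simp add: finite_short_exact_seqs num_ses.rep_eq L_def)
  ultimately have "(\<Sum>\<phi>\<in>inj_homs ?K ?R. of_nat (num_ses M N (cokernel_class ?K ?R \<phi>)) :: rat) =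
      (\<Sum>\<pi>\<in>surj_homs ?R ?M. of_nat (num_ses N K (kernel_class ?M ?R \<pi>)))"
    by (simp flip: of_nat_sum)
  then show ?thesis
    using sum_over_cokernels[OF R K, of "\<lambda>X. of_nat (num_ses M N X)"]
      sum_over_kernels[OF R M, of "\<lambda>Y. of_nat (num_ses N K Y)"]
    by (simp add: num_ses.rep_eq m_n_k_r_def)
qed

lemma hall_coeff_assoc:
  fixes M N K R :: "'k::{field,finite} rep_class"
  shows "(\<Sum>X | rep_dim X \<le> rep_dim R. hall_coeff M N X * hall_coeff X K R) =
    (\<Sum>Y | rep_dim Y \<le> rep_dim R. hall_coeff N K Y * hall_coeff M Y R)"
proof -
  let ?a = "of_nat (num_aut M) * of_nat (num_aut N) * of_nat (num_aut K) :: rat"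
  have "(\<Sum>X | rep_dim X \<le> rep_dim R. hall_coeff M N X * hall_coeff X K R) =
      (\<Sum>X | rep_dim X \<le> rep_dim R. of_nat (num_ses M N X) * of_nat (num_ses X K R) / of_nat (num_aut X)) / ?a"
    unfolding sum_divide_distrib by (intro sum.cong) (auto simp: hall_coeff_def field_simps)
  also have "\<dots> = (\<Sum>Y | rep_dim Y \<le> rep_dim R. of_nat (num_ses N K Y) * of_nat (num_ses M Y R) / of_nat (num_aut Y)) / ?a"
    unfolding sum_num_ses_assoc ..
  also have "\<dots> = (\<Sum>Y | rep_dim Y \<le> rep_dim R. hall_coeff N K Y * hall_coeff M Y R)"
    unfolding sum_divide_distrib by (intro sum.cong) (auto simp: hall_coeff_def field_simps)
  finally show ?thesis .
qed

lemma hall_coeff_commute: "hall_coeff M N R = hall_coeff N M R"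
proof -
  have "num_ses M N R = num_ses N M R"
    unfolding num_ses.rep_eq by (rule card_short_exact_seqs_commute) (rule rep_rep_class_nilpotent)+
  then show ?thesis by (simp add: hall_coeff_def mult.commute)
qed

lemma hall_coeff_dim: "hall_coeff M N R \<noteq> 0 \<Longrightarrow> rep_dim R = rep_dim M + rep_dim N"
  using num_ses_dim[of M N R] by (auto simp: hall_coeff_def)

lemma lookup_hall_mult:
  fixes x y :: "'k::{field,finite} hall"
  assumes fin: "finite S" and sub: "{M. rep_dim M \<le> rep_dim R} \<subseteq> S"
  shows "Poly_Mapping.lookup (x \<star> y) R =
    (\<Sum>M\<in>S. \<Sum>N\<in>S. Poly_Mapping.lookup x M * Poly_Mapping.lookup y N * hall_coeff M N R)"
proof -
  let ?x = "Poly_Mapping.lookup x" and ?y = "Poly_Mapping.lookup y"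
  have fx: "finite {M. ?x M \<noteq> 0}" and fy: "finite {M. ?y M \<noteq> 0}" by simp_all
  have out: "hall_coeff M N R = 0" if "M \<notin> S \<or> N \<notin> S" for M N
  proof (rule ccontr)
    assume "hall_coeff M N R \<noteq> 0"
    from hall_coeff_dim[OF this] have "M \<in> S" "N \<in> S" using sub by auto
    with that show False by blast
  qed
  have "(\<Sum>M | ?x M \<noteq> 0. \<Sum>N | ?y N \<noteq> 0. ?x M * ?y N * hall_coeff M N R) =
      (\<Sum>M\<in>S \<union> {M. ?x M \<noteq> 0}. \<Sum>N\<in>S \<union> {N. ?y N \<noteq> 0}. ?x M * ?y N * hall_coeff M N R)"
  proof -
    have "(\<Sum>N | ?y N \<noteq> 0. ?x M * ?y N * hall_coeff M N R) =
        (\<Sum>N\<in>S \<union> {N. ?y N \<noteq> 0}. ?x M * ?y N * hall_coeff M N R)" for M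
      using fin fy by (intro sum.mono_neutral_left) auto
    then show ?thesis using fin fx by (simp only:) (intro sum.mono_neutral_left; auto)
  qed
  also have "\<dots> = (\<Sum>M\<in>S. \<Sum>N\<in>S. ?x M * ?y N * hall_coeff M N R)"
  proof -
    have "(\<Sum>N\<in>S \<union> {N. ?y N \<noteq> 0}. ?x M * ?y N * hall_coeff M N R) = (\<Sum>N\<in>S. ?x M * ?y N * hall_coeff M N R)" for M
      using fin fy out by (intro sum.mono_neutral_right) auto
    then show ?thesis using fin fx out by (simp only:) (intro sum.mono_neutral_right; auto)
  qed
  finally show ?thesis by (simp add: hall_mult.rep_eq)
qed

lemma hall_mult_commute: "x \<star> y = y \<star> x"
proof (rule poly_mapping_eqI)
  fix R
  show "Poly_Mapping.lookup (x \<star> y) R = Poly_Mapping.lookup (y \<star> x) R"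
    unfolding lookup_hall_mult[OF finite_rep_dim_le subset_refl]
    by (subst sum.swap) (simp add: hall_coeff_commute mult.commute)
qed

lemma hall_mult_assoc: "(x \<star> y) \<star> z = x \<star> (y \<star> z)"
proof (rule poly_mapping_eqI)
  fix R :: "'a rep_class"
  let ?D = "{M :: 'a rep_class. rep_dim M \<le> rep_dim R}"
  let ?x = "Poly_Mapping.lookup x" and ?y = "Poly_Mapping.lookup y" and ?z = "Poly_Mapping.lookup z"
  note fin = finite_rep_dim_le[of "rep_dim R", where ?'k = 'a]
  have lo: "Poly_Mapping.lookup (u \<star> v) X = (\<Sum>M\<in>?D. \<Sum>N\<in>?D. Poly_Mapping.lookup u M * Poly_Mapping.lookup v N * hall_coeff M N X)"
    if "X \<in> ?D" for u v X
    by (rule lookup_hall_mult[OF fin]) (use that in auto)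
  have R: "R \<in> ?D" by simp
  have "Poly_Mapping.lookup ((x \<star> y) \<star> z) R =
      (\<Sum>X\<in>?D. \<Sum>K\<in>?D. (\<Sum>M\<in>?D. \<Sum>N\<in>?D. ?x M * ?y N * hall_coeff M N X) * ?z K * hall_coeff X K R)"
    unfolding lo[OF R] using lo by (intro sum.cong refl) auto
  also have "\<dots> = (\<Sum>X\<in>?D. \<Sum>K\<in>?D. \<Sum>M\<in>?D. \<Sum>N\<in>?D. ?x M * ?y N * ?z K * (hall_coeff M N X * hall_coeff X K R))"
    by (simp add: sum_distrib_right sum_distrib_left mult_ac)
  also have "\<dots> = (\<Sum>K\<in>?D. \<Sum>M\<in>?D. \<Sum>N\<in>?D. \<Sum>X\<in>?D. ?x M * ?y N * ?z K * (hall_coeff M N X * hall_coeff X K R))"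
    by (rule trans[OF sum.swap], rule sum.cong[OF refl], rule trans[OF sum.swap], rule sum.cong[OF refl], rule sum.swap)
  also have "\<dots> = (\<Sum>K\<in>?D. \<Sum>M\<in>?D. \<Sum>N\<in>?D. \<Sum>Y\<in>?D. ?x M * ?y N * ?z K * (hall_coeff N K Y * hall_coeff M Y R))"
    by (simp only: sum_distrib_left[symmetric] hall_coeff_assoc)
  also have "\<dots> = (\<Sum>M\<in>?D. \<Sum>N\<in>?D. \<Sum>K\<in>?D. \<Sum>Y\<in>?D. ?x M * ?y N * ?z K * (hall_coeff N K Y * hall_coeff M Y R))"
    by (rule trans[OF sum.swap], rule sum.cong[OF refl], rule sum.swap)
  also have "\<dots> = (\<Sum>M\<in>?D. \<Sum>Y\<in>?D. \<Sum>N\<in>?D. \<Sum>K\<in>?D. ?x M * ?y N * ?z K * (hall_coeff N K Y * hall_coeff M Y R))"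
    by (rule sum.cong[OF refl], rule sym, rule trans[OF sum.swap], rule sum.cong[OF refl], rule sum.swap)
  also have "\<dots> = (\<Sum>M\<in>?D. \<Sum>Y\<in>?D. ?x M * (\<Sum>N\<in>?D. \<Sum>K\<in>?D. ?y N * ?z K * hall_coeff N K Y) * hall_coeff M Y R)"
    by (simp add: sum_distrib_left sum_distrib_right mult_ac)
  also have "\<dots> = Poly_Mapping.lookup (x \<star> (y \<star> z)) R"
    unfolding lo[OF R] using lo by (intro sum.cong refl) auto
  finally show "Poly_Mapping.lookup ((x \<star> y) \<star> z) R = Poly_Mapping.lookup (x \<star> (y \<star> z)) R" .
qed

lemma hall_coeff_zero_rep:
  fixes N R :: "'k::{field,finite} rep_class"
  shows "hall_coeff zero_rep N R = (if N = R then 1 else 0)"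
proof -
  let ?Z = "0\<^sub>m 0 0 :: 'k mat" and ?R = "rep_rep_class R" and ?r = "rep_dim R"
  have Z: "?Z \<in> carrier_mat 0 0" by simp
  have nilZ: "nilpotent_mat ?Z" by (auto simp: nilpotent_mat_def intro!: exI[of _ 1])
  have refl: "nilpotent_mat A \<and> nilpotent_mat A \<and> rep_iso A A \<noteq> {}" if "nilpotent_mat A" for A :: "'k mat"
    using rep_iso_refl[OF nilpotent_mat_square[OF that]] that by blast
  note R = rep_rep_class_nilpotent[of R]
  let ?\<psi> = "0\<^sub>m 0 ?r :: 'k mat"
  have z: "\<psi> = ?\<psi>" if "\<psi> \<in> carrier_mat 0 ?r" for \<psi> :: "'k mat" using that by (intro eq_matI) auto
  have surj: "surj_mat ?\<psi>"
    by (rule surj_matI_right_inverse[of _ 0 ?r "0\<^sub>m ?r 0"]) (auto intro!: eq_matI)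
  have "?\<psi> * ?R = ?Z * ?\<psi>" using z[of "?\<psi> * ?R"] z[of "?Z * ?\<psi>"] R by simp
  then have \<psi>: "surj_homs ?R ?Z = {?\<psi>}"
    using z surj surj_homs_iff[OF R(1) Z] by auto
  have "(1\<^sub>m ?r, ?\<psi>) \<in> short_exact_seqs ?Z ?R ?R"
    by (rule short_exact_seqs_vecI[OF Z R(1) R(1)]) (use R surj in \<open>auto intro!: eq_vecI eq_matI bexI[of _ "0\<^sub>v ?r"]\<close>)
  then have "{\<phi>. (\<phi>, ?\<psi>) \<in> short_exact_seqs ?Z ?R ?R} \<noteq> {}" by blast
  moreover have "finite {\<phi>. (\<phi>, ?\<psi>) \<in> short_exact_seqs ?Z ?R ?R}"
    by (rule finite_subset[OF _ finite_imageI[OF finite_short_exact_seqs, of fst]]) force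
  ultimately have "card {\<phi>. (\<phi>, ?\<psi>) \<in> short_exact_seqs ?Z ?R ?R} \<noteq> 0" by simp
  then have K: "kernel_class ?Z ?R ?\<psi> = R"
    using card_ses_fibre_kernel_class[OF R Z, of ?\<psi> R] \<psi> by (auto split: if_splits)
  have a1: "num_aut (zero_rep :: 'k rep_class) = 1"
  proof -
    have "num_aut (zero_rep :: 'k rep_class) = card (rep_iso ?Z ?Z)"
      unfolding zero_rep_def using num_aut.abs_eq[OF refl[OF nilZ]] by simp
    also have "rep_iso ?Z ?Z = {?Z}"
    proof -
      have "1\<^sub>m 0 = ?Z" by (intro eq_matI) auto
      then show ?thesis using rep_iso_refl[of ?Z] by (auto simp: rep_iso_def rep_hom_def)
    qed
    finally show ?thesis by simp
  qed
  have ns: "num_ses zero_rep N R = card (short_exact_seqs ?Z (rep_rep_class N) ?R)"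
    using num_ses.abs_eq[OF refl[OF nilZ] refl refl, of "rep_rep_class N" ?R]
    by (simp add: zero_rep_def rep_rep_class_nilpotent)
  show ?thesis
  proof (cases "rep_dim N = rep_dim R")
    case True
    have "(\<Sum>N' | rep_dim N' \<le> ?r. (if N' = N then 1 else 0) * of_nat (card (short_exact_seqs ?Z (rep_rep_class N') ?R)) / of_nat (num_aut N'))
        = (if R = N then 1 else 0 :: rat)"
      unfolding sum_over_kernels[OF R Z] \<psi> by (simp add: K)
    also have "(\<Sum>N' | rep_dim N' \<le> ?r. (if N' = N then 1 else 0) * of_nat (card (short_exact_seqs ?Z (rep_rep_class N') ?R)) / of_nat (num_aut N'))
        = (\<Sum>N' | rep_dim N' \<le> ?r. if N' = N then of_nat (card (short_exact_seqs ?Z (rep_rep_class N) ?R)) / of_nat (num_aut N) else (0 :: rat))"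
      by (intro sum.cong) auto
    also have "\<dots> = of_nat (card (short_exact_seqs ?Z (rep_rep_class N) ?R)) / of_nat (num_aut N)"
      using True finite_rep_dim_le[of ?r, where ?'k = 'k] by simp
    finally show ?thesis by (auto simp: hall_coeff_def ns a1)
  next
    case False
    moreover have "rep_dim (zero_rep :: 'k rep_class) = 0"
      unfolding zero_rep_def using rep_dim.abs_eq[OF refl[OF nilZ]] by simp
    ultimately show ?thesis using hall_coeff_dim[of zero_rep N R] by auto
  qed
qed

lemma lookup_single_hall_mult:
  fixes y :: "'k::{field,finite} hall"
  shows "Poly_Mapping.lookup (Poly_Mapping.single M 1 \<star> y) R =
    (\<Sum>N | rep_dim N \<le> rep_dim R. Poly_Mapping.lookup y N * hall_coeff M N R)"
proof -
  let ?D = "{N :: 'k rep_class. rep_dim N \<le> rep_dim R}" and ?S = "{N :: 'k rep_class. rep_dim N \<le> max (rep_dim R) (rep_dim M)}"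
  have fin: "finite ?S" by (rule finite_rep_dim_le)
  have "Poly_Mapping.lookup (Poly_Mapping.single M 1 \<star> y) R =
      (\<Sum>M'\<in>?S. \<Sum>N\<in>?S. Poly_Mapping.lookup (Poly_Mapping.single M 1) M' * Poly_Mapping.lookup y N * hall_coeff M' N R)"
    by (rule lookup_hall_mult[OF fin]) auto
  also have "\<dots> = (\<Sum>M'\<in>?S. if M' = M then (\<Sum>N\<in>?S. Poly_Mapping.lookup y N * hall_coeff M N R) else 0)"
    by (intro sum.cong) (auto simp: lookup_single when_def)
  also have "\<dots> = (\<Sum>N\<in>?S. Poly_Mapping.lookup y N * hall_coeff M N R)" using fin by simp
  also have "\<dots> = (\<Sum>N\<in>?D. Poly_Mapping.lookup y N * hall_coeff M N R)"
    using fin hall_coeff_dim[of M _ R] by (intro sum.mono_neutral_right) fastforce+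
  finally show ?thesis .
qed

lemma hall_mult_one_left: "hall_one \<star> x = x"
proof (rule poly_mapping_eqI)
  fix R :: "'a rep_class"
  have "Poly_Mapping.lookup (hall_one \<star> x) R =
      (\<Sum>N | rep_dim N \<le> rep_dim R. if N = R then Poly_Mapping.lookup x N else 0)"
    unfolding hall_one_def lookup_single_hall_mult by (intro sum.cong) (auto simp: hall_coeff_zero_rep)
  then show "Poly_Mapping.lookup (hall_one \<star> x) R = Poly_Mapping.lookup x R"
    using finite_rep_dim_le[of "rep_dim R", where ?'k = 'a] by simp
qed

section \<open>Heights of vectors\<close>

definition height :: "'a::field mat \<Rightarrow> 'a vec \<Rightarrow> nat" where
  "height B v = (LEAST j. B ^\<^sub>m j *\<^sub>v v = 0\<^sub>v (dim_row B))"

lemma pow_mult_vec_Suc: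
  fixes B :: "'a::field mat"
  assumes "B \<in> carrier_mat n n" "v \<in> carrier_vec n"
  shows "B ^\<^sub>m Suc j *\<^sub>v v = B *\<^sub>v (B ^\<^sub>m j *\<^sub>v v)" "B ^\<^sub>m Suc j *\<^sub>v v = B ^\<^sub>m j *\<^sub>v (B *\<^sub>v v)"
proof -
  have Bj: "B ^\<^sub>m j \<in> carrier_mat n n" using assms by simp
  show 2: "B ^\<^sub>m Suc j *\<^sub>v v = B ^\<^sub>m j *\<^sub>v (B *\<^sub>v v)"
    using assoc_mult_mat_vec[OF Bj assms] by simp
  have "B ^\<^sub>m j * B = B * B ^\<^sub>m j" using intertwine_pow[OF assms(1) assms(1) assms(1) refl] by simp
  then show "B ^\<^sub>m Suc j *\<^sub>v v = B *\<^sub>v (B ^\<^sub>m j *\<^sub>v v)"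
    using assoc_mult_mat_vec[OF assms(1) Bj assms(2)] by simp
qed

lemma height_le_iff:
  fixes B :: "'a::field mat"
  assumes B: "B \<in> carrier_mat n n" "nilpotent_mat B" and v: "v \<in> carrier_vec n"
  shows "height B v \<le> j \<longleftrightarrow> B ^\<^sub>m j *\<^sub>v v = 0\<^sub>v n"
proof
  have ex: "\<exists>j. B ^\<^sub>m j *\<^sub>v v = 0\<^sub>v n"
  proof -
    obtain m where "B ^\<^sub>m m = 0\<^sub>m n n" using B by (auto simp: nilpotent_mat_def)
    then have "B ^\<^sub>m m *\<^sub>v v = 0\<^sub>v n" using v by (auto intro!: eq_vecI)
    then show ?thesis by blast
  qed
  have h: "B ^\<^sub>m height B v *\<^sub>v v = 0\<^sub>v n"
    using LeastI_ex[OF ex] B by (simp add: height_def)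
  assume "height B v \<le> j"
  then show "B ^\<^sub>m j *\<^sub>v v = 0\<^sub>v n"
  proof (induction j rule: dec_induct)
    case (step j)
    then show ?case using pow_mult_vec_Suc(1)[OF B(1) v] mat_zero_vec[OF B(1)] by simp
  qed (rule h)
next
  assume "B ^\<^sub>m j *\<^sub>v v = 0\<^sub>v n"
  then show "height B v \<le> j" unfolding height_def using B by (intro Least_le) simp
qed

lemma height_eq_0_iff:
  fixes B :: "'a::field mat"
  assumes B: "B \<in> carrier_mat n n" "nilpotent_mat B" and v: "v \<in> carrier_vec n"
  shows "height B v = 0 \<longleftrightarrow> v = 0\<^sub>v n"
  using height_le_iff[OF assms, of 0] B v by simp

lemma height_eq_Suc_iff:
  fixes B :: "'a::field mat"
  assumes B: "B \<in> carrier_mat n n" "nilpotent_mat B" and v: "v \<in> carrier_vec n"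
  shows "height B v = Suc j \<longleftrightarrow> B ^\<^sub>m Suc j *\<^sub>v v = 0\<^sub>v n \<and> B ^\<^sub>m j *\<^sub>v v \<noteq> 0\<^sub>v n"
  using height_le_iff[OF assms, of j] height_le_iff[OF assms, of "Suc j"] by linarith

lemma height_mult_vec:
  fixes B :: "'a::field mat"
  assumes B: "B \<in> carrier_mat n n" "nilpotent_mat B" and v: "v \<in> carrier_vec n"
  shows "height B (B *\<^sub>v v) = height B v - 1"
proof -
  have "height B (B *\<^sub>v v) \<le> j \<longleftrightarrow> height B v - 1 \<le> j" for j
    using height_le_iff[OF B, of "B *\<^sub>v v" j] height_le_iff[OF B v, of "Suc j"] pow_mult_vec_Suc(2)[OF B(1) v] B(1) v
    by (metis One_nat_def diff_le_mono diff_Suc_1 le_diff_conv mult_mat_vec_carrier plus_1_eq_Suc add.commute)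
  then show ?thesis by (metis le_antisym order_refl)
qed

lemma card_height_Suc:
  fixes B :: "'k::{field,finite} mat"
  assumes B: "B \<in> carrier_mat n n" "nilpotent_mat B"
  shows "card {v \<in> carrier_vec n. height B v = Suc j} =
    card (mat_kernel (B ^\<^sub>m Suc j)) - card (mat_kernel (B ^\<^sub>m j))"
proof -
  have ker: "mat_kernel (B ^\<^sub>m j) = {v \<in> carrier_vec n. height B v \<le> j}" for j
    using mat_kernel[OF pow_carrier_mat[OF B(1)]] height_le_iff[OF B] by blast
  have "{v \<in> carrier_vec n. height B v = Suc j} = mat_kernel (B ^\<^sub>m Suc j) - mat_kernel (B ^\<^sub>m j)"
    unfolding ker by auto
  moreover have "mat_kernel (B ^\<^sub>m j) \<subseteq> mat_kernel (B ^\<^sub>m Suc j)" unfolding ker by auto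
  moreover have "finite (mat_kernel (B ^\<^sub>m j))" unfolding ker by (rule finite_subset[OF _ finite_carrier_vec]) auto
  ultimately show ?thesis by (simp add: card_Diff_subset)
qed

section \<open>Jordan blocks as quotients\<close>

lemma jordan_block_row:
  assumes "i < j"
  shows "row (jordan_block j (0 :: 'a::field)) i = (if Suc i < j then unit_vec j (Suc i) else 0\<^sub>v j)"
  using assms by (intro eq_vecI) (auto simp: jordan_block_def)

lemma row_jordan_block_mult:
  fixes \<psi> :: "'a::field mat"
  assumes \<psi>: "\<psi> \<in> carrier_mat j n" and i: "i < j"
  shows "row (jordan_block j 0 * \<psi>) i = (if Suc i < j then row \<psi> (Suc i) else 0\<^sub>v n)"
  using assms by (intro eq_vecI) (auto simp: jordan_block_row)

text \<open>
  A homomorphism to a Jordan block is determined by its first row: each further row is obtained from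
  the previous one by applying the transpose of the source. These rows form a Krylov sequence.
\<close>

definition krylov_mat :: "'a::field mat \<Rightarrow> nat \<Rightarrow> 'a vec \<Rightarrow> 'a mat" where
  "krylov_mat B j v = mat j (dim_row B) (\<lambda>(i, c). (B ^\<^sub>m i *\<^sub>v v) $ c)"

lemma krylov_mat_carrier: "B \<in> carrier_mat n n \<Longrightarrow> krylov_mat B j v \<in> carrier_mat j n"
  by (simp add: krylov_mat_def)

lemma row_krylov_mat:
  assumes "B \<in> carrier_mat n n" "v \<in> carrier_vec n" "i < j"
  shows "row (krylov_mat B j v) i = B ^\<^sub>m i *\<^sub>v v"
  using assms by (intro eq_vecI) (auto simp: krylov_mat_def simp del: index_mult_mat_vec)

lemma hom_to_jordan_block_iff:
  fixes R :: "'a::field mat"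
  assumes R: "R \<in> carrier_mat n n" and j: "j > 0" and \<psi>: "\<psi> \<in> carrier_mat j n"
  shows "\<psi> * R = jordan_block j 0 * \<psi> \<longleftrightarrow>
    \<psi> = krylov_mat R\<^sup>T j (row \<psi> 0) \<and> R\<^sup>T ^\<^sub>m j *\<^sub>v row \<psi> 0 = 0\<^sub>v n"
proof -
  let ?B = "R\<^sup>T" and ?v = "row \<psi> 0"
  have B: "?B \<in> carrier_mat n n" and v: "?v \<in> carrier_vec n" using R \<psi> j by auto
  have J: "jordan_block j 0 * \<psi> \<in> carrier_mat j n" using \<psi> by (intro mult_carrier_mat[of _ j j]) auto
  have "\<psi> * R = jordan_block j 0 * \<psi> \<longleftrightarrow> (\<forall>i<j. row (\<psi> * R) i = row (jordan_block j 0 * \<psi>) i)"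
  proof
    assume *: "\<forall>i<j. row (\<psi> * R) i = row (jordan_block j 0 * \<psi>) i"
    show "\<psi> * R = jordan_block j 0 * \<psi>"
      by (rule eq_rowI) (use * \<psi> R J in auto)
  qed simp
  also have "\<dots> \<longleftrightarrow> (\<forall>i<j. ?B *\<^sub>v row \<psi> i = (if Suc i < j then row \<psi> (Suc i) else 0\<^sub>v n))"
    using row_mult_eq_transpose[OF \<psi> R] row_jordan_block_mult[OF \<psi>] by simp
  also have "\<dots> \<longleftrightarrow> (\<forall>i<j. row \<psi> i = ?B ^\<^sub>m i *\<^sub>v ?v) \<and> ?B ^\<^sub>m j *\<^sub>v ?v = 0\<^sub>v n"
  proof
    assume *: "\<forall>i<j. ?B *\<^sub>v row \<psi> i = (if Suc i < j then row \<psi> (Suc i) else 0\<^sub>v n)"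
    have r: "row \<psi> i = ?B ^\<^sub>m i *\<^sub>v ?v" if "i < j" for i
      using that
    proof (induction i)
      case 0
      then show ?case using v R by simp
    next
      case (Suc i)
      have eq: "row \<psi> (Suc i) = ?B *\<^sub>v row \<psi> i" using *[rule_format, of i] Suc.prems by simp
      have IH: "row \<psi> i = ?B ^\<^sub>m i *\<^sub>v ?v" using Suc by simp
      show ?case unfolding pow_mult_vec_Suc(1)[OF B v] eq IH ..
    qed
    obtain k where k: "j = Suc k" using j by (cases j) auto
    have rk: "row \<psi> k = ?B ^\<^sub>m k *\<^sub>v ?v" using r k by blast
    have "?B *\<^sub>v row \<psi> k = 0\<^sub>v n" using *[rule_format, of k] k by simp
    then have "?B ^\<^sub>m j *\<^sub>v ?v = 0\<^sub>v n" unfolding k pow_mult_vec_Suc(1)[OF B v] rk .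
    then show "(\<forall>i<j. row \<psi> i = ?B ^\<^sub>m i *\<^sub>v ?v) \<and> ?B ^\<^sub>m j *\<^sub>v ?v = 0\<^sub>v n" using r by blast
  next
    assume *: "(\<forall>i<j. row \<psi> i = ?B ^\<^sub>m i *\<^sub>v ?v) \<and> ?B ^\<^sub>m j *\<^sub>v ?v = 0\<^sub>v n"
    show "\<forall>i<j. ?B *\<^sub>v row \<psi> i = (if Suc i < j then row \<psi> (Suc i) else 0\<^sub>v n)"
    proof (intro allI impI)
      fix i assume i: "i < j"
      have ri: "row \<psi> i = ?B ^\<^sub>m i *\<^sub>v ?v" using * i by blast
      have eq: "?B *\<^sub>v row \<psi> i = ?B ^\<^sub>m Suc i *\<^sub>v ?v" unfolding ri pow_mult_vec_Suc(1)[OF B v] ..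
      show "?B *\<^sub>v row \<psi> i = (if Suc i < j then row \<psi> (Suc i) else 0\<^sub>v n)"
      proof (cases "Suc i < j")
        case True
        then have "row \<psi> (Suc i) = ?B ^\<^sub>m Suc i *\<^sub>v ?v" using * by blast
        then show ?thesis unfolding eq if_P[OF True] by (rule sym)
      next
        case False
        then have "j = Suc i" using i by simp
        then show ?thesis unfolding eq if_not_P[OF False] using * by blast
      qed
    qed
  qed
  also have "(\<forall>i<j. row \<psi> i = ?B ^\<^sub>m i *\<^sub>v ?v) \<longleftrightarrow> \<psi> = krylov_mat ?B j ?v"
  proof
    assume *: "\<forall>i<j. row \<psi> i = ?B ^\<^sub>m i *\<^sub>v ?v"
    show "\<psi> = krylov_mat ?B j ?v"
    proof (rule eq_rowI)
      have K: "krylov_mat ?B j ?v \<in> carrier_mat j n" by (rule krylov_mat_carrier[OF B])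
      show "dim_row \<psi> = dim_row (krylov_mat ?B j ?v)" "dim_col \<psi> = dim_col (krylov_mat ?B j ?v)"
        unfolding carrier_matD[OF K] carrier_matD[OF \<psi>] by (rule refl)+
      fix i assume "i < dim_row (krylov_mat ?B j ?v)"
      then have i: "i < j" unfolding carrier_matD[OF K] .
      show "row \<psi> i = row (krylov_mat ?B j ?v) i" unfolding row_krylov_mat[OF B v i] using * i by blast
    qed
  next
    assume *: "\<psi> = krylov_mat ?B j ?v"
    show "\<forall>i<j. row \<psi> i = ?B ^\<^sub>m i *\<^sub>v ?v"
    proof (intro allI impI)
      fix i assume "i < j"
      then show "row \<psi> i = ?B ^\<^sub>m i *\<^sub>v ?v" 
        by (rule trans[OF arg_cong[OF *, of "\<lambda>X. row X i"] row_krylov_mat[OF B v]])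
    qed
  qed
  finally show ?thesis .
qed

text \<open>
  A nonzero submodule meets the socle: some iterate of a nonzero vector is a nonzero vector killed
  by the endomorphism.
\<close>

lemma nilpotent_last_iterate:
  fixes A :: "'a::field mat"
  assumes A: "A \<in> carrier_mat n n" "nilpotent_mat A" and u: "u \<in> carrier_vec n" "u \<noteq> 0\<^sub>v n"
  obtains s where "A ^\<^sub>m s *\<^sub>v u \<noteq> 0\<^sub>v n" "A *\<^sub>v (A ^\<^sub>m s *\<^sub>v u) = 0\<^sub>v n"
proof -
  have "height A u \<noteq> 0" using height_eq_0_iff[OF A u(1)] u(2) by simp
  then obtain s where "height A u = Suc s" by (cases "height A u") auto
  then show thesis
    using that[of s] height_eq_Suc_iff[OF A u(1), of s] pow_mult_vec_Suc(1)[OF A(1) u(1), of s] by simp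
qed

text \<open>
  The transpose of \<open>\<psi>\<close> is injective if and only if it is injective on the vectors killed by the
  transposed Jordan block. These are the multiples of the last unit vector, which is mapped to the
  last row of \<open>\<psi>\<close>.
\<close>

lemma surj_to_jordan_block_iff:
  fixes R :: "'k::{field,finite} mat"
  assumes R: "R \<in> carrier_mat n n" and \<psi>: "\<psi> \<in> carrier_mat (Suc j) n"
    and hom: "\<psi> * R = jordan_block (Suc j) 0 * \<psi>"
  shows "surj_mat \<psi> \<longleftrightarrow> row \<psi> j \<noteq> 0\<^sub>v n"
proof -
  let ?J = "jordan_block (Suc j) (0 :: 'k)"
  have T: "\<psi>\<^sup>T \<in> carrier_mat n (Suc j)" using \<psi> by simp
  have J: "?J \<in> carrier_mat (Suc j) (Suc j)" by simp
  have last: "\<psi>\<^sup>T *\<^sub>v unit_vec (Suc j) j = row \<psi> j" using mult_unit_vec[OF T, of j] \<psi> by simp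
  have "surj_mat \<psi> \<longleftrightarrow> inj_mat \<psi>\<^sup>T"
    using surj_mat_transpose[OF \<psi>] inj_mat_transpose[OF T] by auto
  also have "\<dots> \<longleftrightarrow> row \<psi> j \<noteq> 0\<^sub>v n"
  proof
    assume inj: "inj_mat \<psi>\<^sup>T"
    have "unit_vec (Suc j) j $ j \<noteq> (0\<^sub>v (Suc j) :: 'k vec) $ j" by simp
    then have "unit_vec (Suc j) j \<noteq> (0\<^sub>v (Suc j) :: 'k vec)" by metis
    then show "row \<psi> j \<noteq> 0\<^sub>v n" using inj inj_mat_iff_kernel[OF T] last by force
  next
    assume nz: "row \<psi> j \<noteq> 0\<^sub>v n"
    show "inj_mat \<psi>\<^sup>T" unfolding inj_mat_iff_kernel[OF T]
    proof (intro ballI impI, rule ccontr)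
      fix u assume u: "u \<in> carrier_vec (Suc j)" "\<psi>\<^sup>T *\<^sub>v u = 0\<^sub>v n" "u \<noteq> 0\<^sub>v (Suc j)"
      have JT: "?J\<^sup>T \<in> carrier_mat (Suc j) (Suc j)" using J by simp
      have RT: "R\<^sup>T \<in> carrier_mat n n" using R by simp
      have nilJ: "nilpotent_mat ?J"
        using J by (auto simp: nilpotent_mat_def jordan_block_zero_pow intro!: exI[of _ "Suc j"] eq_matI)
      obtain s where s: "?J\<^sup>T ^\<^sub>m s *\<^sub>v u \<noteq> 0\<^sub>v (Suc j)" "?J\<^sup>T *\<^sub>v (?J\<^sup>T ^\<^sub>m s *\<^sub>v u) = 0\<^sub>v (Suc j)"
        by (rule nilpotent_last_iterate[OF JT nilpotent_transpose[OF J nilJ] u(1,3)])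
      define w where "w = ?J\<^sup>T ^\<^sub>m s *\<^sub>v u"
      have w: "w \<in> carrier_vec (Suc j)"
        unfolding w_def by (rule mult_mat_vec_carrier[OF pow_carrier_mat[OF JT] u(1)])
      have Jw: "w $ i = 0" if "i < j" for i
      proof -
        have "col ?J (Suc i) = unit_vec (Suc j) i" using that by (intro eq_vecI) (auto simp: jordan_block_def)
        then have "(?J\<^sup>T *\<^sub>v w) $ Suc i = w $ i" using that w by simp
        then show ?thesis using s(2) that by (simp add: w_def)
      qed
      have weq: "w = w $ j \<cdot>\<^sub>v unit_vec (Suc j) j"
        using Jw w by (intro eq_vecI) (auto simp: less_Suc_eq)
      have "w $ j \<noteq> 0"
      proof
        assume "w $ j = 0"
        then have "w = 0\<^sub>v (Suc j)" using Jw w by (intro eq_vecI) (auto simp: less_Suc_eq)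
        then show False using s(1) by (simp add: w_def)
      qed
      have "\<psi>\<^sup>T * ?J\<^sup>T = R\<^sup>T * \<psi>\<^sup>T"
        using transpose_mult[OF \<psi> R] transpose_mult[OF J \<psi>] hom by simp
      from intertwine_pow[OF JT RT T this, of s]
      have "\<psi>\<^sup>T *\<^sub>v w = R\<^sup>T ^\<^sub>m s *\<^sub>v (\<psi>\<^sup>T *\<^sub>v u)"
        unfolding w_def using assoc_mult_mat_vec[OF T pow_carrier_mat[OF JT] u(1)]
          assoc_mult_mat_vec[OF pow_carrier_mat[OF RT] T u(1)] by metis
      also have "\<dots> = 0\<^sub>v n" unfolding u(2) by (rule mat_zero_vec[OF pow_carrier_mat[OF RT]])
      finally have sm: "w $ j \<cdot>\<^sub>v row \<psi> j = 0\<^sub>v n"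
        using mult_mat_vec[OF T, of "unit_vec (Suc j) j" "w $ j"] last weq by simp
      then have "w $ j * row \<psi> j $ c = 0" if "c < n" for c
      proof -
        have "w $ j * row \<psi> j $ c = (w $ j \<cdot>\<^sub>v row \<psi> j) $ c" using that \<psi> by simp
        also have "\<dots> = 0" unfolding sm using that by simp
        finally show ?thesis .
      qed
      then have "row \<psi> j = 0\<^sub>v n" using \<open>w $ j \<noteq> 0\<close> \<psi> by (intro eq_vecI) auto
      with nz show False by simp
    qed
  qed
  finally show ?thesis .
qed

lemma bij_betw_surj_to_jordan_block:
  fixes R :: "'k::{field,finite} mat"
  assumes R: "R \<in> carrier_mat n n" "nilpotent_mat R"
  shows "bij_betw (krylov_mat R\<^sup>T (Suc j)) {v \<in> carrier_vec n. height R\<^sup>T v = Suc j}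
    (surj_homs R (jordan_block (Suc j) 0))"
proof -
  let ?J = "jordan_block (Suc j) (0 :: 'k)" and ?B = "R\<^sup>T"
  have J: "?J \<in> carrier_mat (Suc j) (Suc j)" by simp
  have B: "?B \<in> carrier_mat n n" "nilpotent_mat ?B" using R nilpotent_transpose[OF R] by simp_all
  have row0: "row (krylov_mat ?B (Suc j) v) 0 = v" if "v \<in> carrier_vec n" for v
    using row_krylov_mat[OF B(1) that, of 0 "Suc j"] B(1) that by simp
  have surj: "surj_mat \<psi> \<longleftrightarrow> ?B ^\<^sub>m j *\<^sub>v row \<psi> 0 \<noteq> 0\<^sub>v n"
    if \<psi>: "\<psi> \<in> carrier_mat (Suc j) n" and hom: "\<psi> * R = ?J * \<psi>" for \<psi>
  proof -
    have v: "row \<psi> 0 \<in> carrier_vec n" using \<psi> by (metis carrier_matD(2) row_carrier)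
    have "\<psi> = krylov_mat ?B (Suc j) (row \<psi> 0)" using hom hom_to_jordan_block_iff[OF R(1) _ \<psi>] by simp
    then have "row \<psi> j = ?B ^\<^sub>m j *\<^sub>v row \<psi> 0" using row_krylov_mat[OF B(1) v, of j "Suc j"] by (metis lessI)
    then show ?thesis using surj_to_jordan_block_iff[OF R(1) \<psi> hom] by simp
  qed
  show ?thesis
  proof (rule bij_betw_byWitness[of _ "\<lambda>\<psi>. row \<psi> 0"])
    show "\<forall>v\<in>{v \<in> carrier_vec n. height ?B v = Suc j}. row (krylov_mat ?B (Suc j) v) 0 = v" using row0 by simp
    show "\<forall>\<psi>\<in>surj_homs R ?J. krylov_mat ?B (Suc j) (row \<psi> 0) = \<psi>"
      using hom_to_jordan_block_iff[OF R(1), of "Suc j"] surj_homs_iff[OF R(1) J] by force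
    show "krylov_mat ?B (Suc j) ` {v \<in> carrier_vec n. height ?B v = Suc j} \<subseteq> surj_homs R ?J"
    proof (rule image_subsetI)
      fix v assume "v \<in> {v \<in> carrier_vec n. height ?B v = Suc j}"
      then have v: "v \<in> carrier_vec n" and h: "?B ^\<^sub>m Suc j *\<^sub>v v = 0\<^sub>v n" "?B ^\<^sub>m j *\<^sub>v v \<noteq> 0\<^sub>v n"
        using height_eq_Suc_iff[OF B] by auto
      let ?\<psi> = "krylov_mat ?B (Suc j) v"
      have \<psi>: "?\<psi> \<in> carrier_mat (Suc j) n" by (rule krylov_mat_carrier[OF B(1)])
      have hom: "?\<psi> * R = ?J * ?\<psi>"
        unfolding hom_to_jordan_block_iff[OF R(1) zero_less_Suc \<psi>] row0[OF v] using h(1) by blast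
      show "?\<psi> \<in> surj_homs R ?J"
        using surj_homs_iff[OF R(1) J] \<psi> hom surj[OF \<psi> hom] row0[OF v] h(2) by simp
    qed
    show "(\<lambda>\<psi>. row \<psi> 0) ` surj_homs R ?J \<subseteq> {v \<in> carrier_vec n. height ?B v = Suc j}"
    proof (rule image_subsetI)
      fix \<psi> assume "\<psi> \<in> surj_homs R ?J"
      then have \<psi>: "\<psi> \<in> carrier_mat (Suc j) n" and hom: "\<psi> * R = ?J * \<psi>" and s: "surj_mat \<psi>"
        using surj_homs_iff[OF R(1) J] by blast+
      have v: "row \<psi> 0 \<in> carrier_vec n" using \<psi> by (metis carrier_matD(2) row_carrier)
      have "?B ^\<^sub>m Suc j *\<^sub>v row \<psi> 0 = 0\<^sub>v n" using hom hom_to_jordan_block_iff[OF R(1) zero_less_Suc \<psi>] by blast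
      then show "row \<psi> 0 \<in> {v \<in> carrier_vec n. height ?B v = Suc j}"
        using height_eq_Suc_iff[OF B v] v surj[OF \<psi> hom] s by blast
    qed
  qed
qed

lemma height_le_dim:
  fixes B :: "'k::{field,finite} mat"
  assumes B: "B \<in> carrier_mat n n" "nilpotent_mat B" and v: "v \<in> carrier_vec n"
  shows "height B v \<le> n"
proof (cases "height B v")
  case (Suc j)
  have R: "B\<^sup>T \<in> carrier_mat n n" "nilpotent_mat B\<^sup>T" using B nilpotent_transpose[OF B] by simp_all
  have "krylov_mat B (Suc j) v \<in> surj_homs B\<^sup>T (jordan_block (Suc j) 0)"
    using bij_betw_apply[OF bij_betw_surj_to_jordan_block[OF R, of j], of v] v Suc by simp
  then have "surj_mat (krylov_mat B (Suc j) v)" by (simp add: surj_homs_def)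
  from surj_mat_dim_le[OF krylov_mat_carrier[OF B(1)] this] show ?thesis using Suc by simp
qed simp

text \<open>
  All rows of \<open>\<psi>\<close> but the first vanish on the kernel of \<open>R\<close>, since they factor through \<open>R\<close>. Hence the
  kernel of \<open>\<psi>\<close> meets it in the hyperplane defined by the first row.
\<close>

lemma card_socle_of_kernel:
  fixes R :: "'k::{field,finite} mat"
  assumes R: "R \<in> carrier_mat n n" and L: "L \<in> carrier_mat l l"
    and \<psi>: "(i, \<psi>) \<in> short_exact_seqs (jordan_block (Suc j) 0) L R"
  shows "card (mat_kernel L) = card {w \<in> mat_kernel R. row \<psi> 0 \<bullet> w = 0}"
proof (rule bij_betw_same_card[of "\<lambda>u. i *\<^sub>v u"], rule bij_betw_imageI)
  let ?J = "jordan_block (Suc j) (0 :: 'k)"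
  have J: "?J \<in> carrier_mat (Suc j) (Suc j)" by simp
  note d = short_exact_seqsE[OF \<psi> J L R]
  have B: "R\<^sup>T \<in> carrier_mat n n" using R by simp
  have v: "row \<psi> 0 \<in> carrier_vec n" using d(2) by (metis carrier_matD(2) row_carrier)
  have \<psi>w: "\<psi> *\<^sub>v w = 0\<^sub>v (Suc j) \<longleftrightarrow> row \<psi> 0 \<bullet> w = 0" if w: "w \<in> mat_kernel R" for w
  proof -
    have w': "w \<in> carrier_vec n" "R *\<^sub>v w = 0\<^sub>v n" using mat_kernelD[OF R w] by auto
    have 0: "row \<psi> (Suc k) \<bullet> w = 0" if k: "Suc k < Suc j" for k
    proof -
      have rk: "row \<psi> k \<in> carrier_vec n" using d(2) by (metis carrier_matD(2) row_carrier)
      have "row \<psi> (Suc k) = row (?J * \<psi>) k" using row_jordan_block_mult[OF d(2), of k] k by simp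
      also have "\<dots> = R\<^sup>T *\<^sub>v row \<psi> k" using row_mult_eq_transpose[OF d(2) R, of k] k d(4) by simp
      finally have "row \<psi> (Suc k) \<bullet> w = row \<psi> k \<bullet> (R *\<^sub>v w)"
        using transpose_vec_mult_scalar[OF R w'(1) rk] by simp
      then show ?thesis using w'(2) rk by simp
    qed
    show ?thesis
    proof
      assume "\<psi> *\<^sub>v w = 0\<^sub>v (Suc j)"
      then have "(\<psi> *\<^sub>v w) $ 0 = 0" by simp
      then show "row \<psi> 0 \<bullet> w = 0" using d(2) by simp
    next
      assume "row \<psi> 0 \<bullet> w = 0"
      then have "row \<psi> k \<bullet> w = 0" if "k < Suc j" for k using 0 that by (cases k) auto
      then show "\<psi> *\<^sub>v w = 0\<^sub>v (Suc j)" using d(2) by (intro eq_vecI) auto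
    qed
  qed
  have comm: "R *\<^sub>v (i *\<^sub>v u) = i *\<^sub>v (L *\<^sub>v u)" if "u \<in> carrier_vec l" for u
    using assoc_mult_mat_vec[OF R d(1) that] assoc_mult_mat_vec[OF d(1) L that] d(3) by simp
  show "inj_on (\<lambda>u. i *\<^sub>v u) (mat_kernel L)"
    using d(1,5) mat_kernel_carrier[OF L] by (auto simp: inj_mat_def intro: inj_on_subset)
  show "(\<lambda>u. i *\<^sub>v u) ` mat_kernel L = {w \<in> mat_kernel R. row \<psi> 0 \<bullet> w = 0}"
  proof (intro subset_antisym subsetI)
    fix w assume "w \<in> (\<lambda>u. i *\<^sub>v u) ` mat_kernel L"
    then obtain u where u: "u \<in> carrier_vec l" "L *\<^sub>v u = 0\<^sub>v l" "w = i *\<^sub>v u" using mat_kernelD[OF L] by auto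
    have "R *\<^sub>v w = 0\<^sub>v n" using comm[OF u(1)] u(2,3) mat_zero_vec[OF d(1)] by simp
    then have w: "w \<in> mat_kernel R" using u d(1) by (intro mat_kernelI[OF R]) auto
    moreover have "\<psi> *\<^sub>v w = 0\<^sub>v (Suc j)" using d(11)[OF u(1)] u(3) by simp
    ultimately show "w \<in> {w \<in> mat_kernel R. row \<psi> 0 \<bullet> w = 0}" using \<psi>w[OF w] by simp
  next
    fix w assume "w \<in> {w \<in> mat_kernel R. row \<psi> 0 \<bullet> w = 0}"
    then have w: "w \<in> mat_kernel R" and "\<psi> *\<^sub>v w = 0\<^sub>v (Suc j)" using \<psi>w by auto
    then obtain u where u: "u \<in> carrier_vec l" "w = i *\<^sub>v u" using d(10) mat_kernelD[OF R w] by blast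
    have "i *\<^sub>v (L *\<^sub>v u) = 0\<^sub>v n" using comm[OF u(1)] mat_kernelD[OF R w] u(2) by simp
    then have "L *\<^sub>v u = 0\<^sub>v l" using d(8)[of "L *\<^sub>v u"] L u(1) by simp
    then show "w \<in> (\<lambda>u. i *\<^sub>v u) ` mat_kernel L" using u by (auto intro!: mat_kernelI[OF L])
  qed
qed

lemma card_kernel_hyperplane:
  fixes R :: "'k::{field,finite} mat"
  assumes R: "R \<in> carrier_mat n n" and v: "v \<in> carrier_vec n"
    and nz: "\<exists>w\<in>mat_kernel R. v \<bullet> w \<noteq> 0"
  shows "CARD('k) * card {w \<in> mat_kernel R. v \<bullet> w = 0} = card (mat_kernel R)"
proof -
  let ?H = "{w \<in> mat_kernel R. v \<bullet> w = 0}"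
  have ker: "mat_kernel R = {w \<in> carrier_vec n. R *\<^sub>v w = 0\<^sub>v n}" using mat_kernel[OF R] by simp
  obtain w where w: "w \<in> mat_kernel R" "v \<bullet> w \<noteq> 0" using nz by blast
  define e where "e = (1 / (v \<bullet> w)) \<cdot>\<^sub>v w"
  have e: "e \<in> mat_kernel R" unfolding e_def by (rule mat_kernel_smult[OF R w(1)])
  have ec: "e \<in> carrier_vec n" "R *\<^sub>v e = 0\<^sub>v n" using e unfolding ker by auto
  have ve: "v \<bullet> e = 1" unfolding e_def using v w mat_kernelD[OF R w(1)] by simp
  have "bij_betw (\<lambda>(a, u). u + a \<cdot>\<^sub>v e) ((UNIV :: 'k set) \<times> ?H) (mat_kernel R)"
  proof (rule bij_betw_byWitness[of _ "\<lambda>u. (v \<bullet> u, u - (v \<bullet> u) \<cdot>\<^sub>v e)"])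
    have val: "v \<bullet> (u + a \<cdot>\<^sub>v e) = a" if "u \<in> ?H" for a u
      using that ec v ve unfolding ker by (simp add: scalar_prod_add_distrib[of _ n])
    show "\<forall>x\<in>UNIV \<times> ?H. (v \<bullet> (case x of (a, u) \<Rightarrow> u + a \<cdot>\<^sub>v e), (case x of (a, u) \<Rightarrow> u + a \<cdot>\<^sub>v e) -
        (v \<bullet> (case x of (a, u) \<Rightarrow> u + a \<cdot>\<^sub>v e)) \<cdot>\<^sub>v e) = x"
    proof
      fix x assume "x \<in> (UNIV :: 'k set) \<times> ?H"
      then obtain a u where x: "x = (a, u)" and u: "u \<in> ?H" by auto
      have "u + a \<cdot>\<^sub>v e - a \<cdot>\<^sub>v e = u" using u ec unfolding ker by (auto intro!: eq_vecI)
      then show "(v \<bullet> (case x of (a, u) \<Rightarrow> u + a \<cdot>\<^sub>v e), (case x of (a, u) \<Rightarrow> u + a \<cdot>\<^sub>v e) -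
          (v \<bullet> (case x of (a, u) \<Rightarrow> u + a \<cdot>\<^sub>v e)) \<cdot>\<^sub>v e) = x"
        unfolding x prod.case val[OF u] by simp
    qed
    show "\<forall>u\<in>mat_kernel R. (case (v \<bullet> u, u - (v \<bullet> u) \<cdot>\<^sub>v e) of (a, u) \<Rightarrow> u + a \<cdot>\<^sub>v e) = u"
      using ec unfolding ker by (auto intro!: eq_vecI)
    show "(\<lambda>(a, u). u + a \<cdot>\<^sub>v e) ` (UNIV \<times> ?H) \<subseteq> mat_kernel R"
      using ec R unfolding ker by (auto simp: mult_add_distrib_mat_vec[OF R] mult_mat_vec[OF R])
    show "(\<lambda>u. (v \<bullet> u, u - (v \<bullet> u) \<cdot>\<^sub>v e)) ` mat_kernel R \<subseteq> UNIV \<times> ?H"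
      using ec R v ve unfolding ker
      by (auto simp: mult_minus_distrib_mat_vec[OF R] mult_mat_vec[OF R] scalar_prod_minus_distrib[of _ n])
  qed
  from bij_betw_same_card[OF this] show ?thesis by (simp add: card_cartesian_product)
qed


section \<open>The number of Jordan blocks\<close>

lemma abs_rep_class_nilpotent_jordan:
  "rep_of_partition \<mu> = abs_rep_class (nilpotent_jordan (sorted_list_of_multiset \<mu>))"
  by (rule rep_of_partition.abs_eq)

lemma rep_class_cases:
  fixes M :: "'k::{field,finite} rep_class"
  obtains \<mu> where "\<mu> \<in> partitions_of (rep_dim M)" "M = rep_of_partition \<mu>"
proof -
  obtain \<mu> where \<mu>: "\<mu> \<in> partitions_of (rep_dim M)"
    "similar_mat (rep_rep_class M) (nilpotent_jordan (sorted_list_of_multiset \<mu>))"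
    by (rule nilpotent_jordan_form[OF rep_rep_class_nilpotent])
  have "abs_rep_class (rep_rep_class M) = rep_of_partition \<mu>"
    unfolding abs_rep_class_nilpotent_jordan
    using abs_rep_class_eq_iff[OF rep_rep_class_nilpotent(2) nilpotent_jordan_matrix] similar_mat_rep_iso[OF \<mu>(2)] by blast
  then show thesis using that \<mu>(1) by simp
qed

lemma rep_rep_class_of_partition:
  "similar_mat (rep_rep_class (rep_of_partition \<mu> :: 'k::{field,finite} rep_class))
    (nilpotent_jordan (sorted_list_of_multiset \<mu>))"
  unfolding abs_rep_class_nilpotent_jordan
  using rep_iso_similar_mat[OF rep_abs_rep_class_iso] nilpotent_jordan_matrix nilpotent_mat_square rep_rep_class_nilpotent(2)
  by blast

lemma rep_dim_rep_of_partition: "rep_dim (rep_of_partition \<mu> :: 'k::{field,finite} rep_class) = \<Sum>\<^sub># \<mu>"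
proof -
  let ?R = "rep_of_partition \<mu> :: 'k rep_class" and ?J = "nilpotent_jordan (sorted_list_of_multiset \<mu>) :: 'k mat"
  obtain k where k: "rep_rep_class ?R \<in> carrier_mat k k" "?J \<in> carrier_mat k k"
    by (rule similar_matE[OF rep_rep_class_of_partition])
  have "rep_dim ?R = k" using carrier_matD(1)[OF k(1)] carrier_matD(1)[OF rep_rep_class_nilpotent(1)[of ?R]] by simp
  also have "k = sum_list (sorted_list_of_multiset \<mu>)"
    using carrier_matD(1)[OF k(2)] carrier_matD(1)[OF nilpotent_jordan_carrier[of "sorted_list_of_multiset \<mu>", where ?'a = 'k]] by simp
  finally have "rep_dim ?R = sum_list (sorted_list_of_multiset \<mu>)" .
  then show ?thesis by (metis mset_sorted_list_of_multiset sum_mset_sum_list)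
qed

text \<open>
  The dimension of the kernel, read off from its cardinality.
\<close>

definition num_blocks :: "'k::{field,finite} rep_class \<Rightarrow> nat" where
  "num_blocks M = (LEAST l. card (mat_kernel (rep_rep_class M)) = CARD('k) ^ l)"

lemma num_blocks_eqI:
  assumes "card (mat_kernel (rep_rep_class (M :: 'k::{field,finite} rep_class))) = CARD('k) ^ l"
  shows "num_blocks M = l"
  unfolding num_blocks_def using assms by (intro Least_equality) auto

lemma num_blocks_rep_of_partition:
  assumes "0 \<notin># \<mu>"
  shows "num_blocks (rep_of_partition \<mu> :: 'k::{field,finite} rep_class) = size \<mu>"
proof (rule num_blocks_eqI)
  have "0 \<notin> set (sorted_list_of_multiset \<mu>)" using assms by simp
  from card_kernel_nilpotent_jordan[OF this, where ?'k = 'k]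
  show "card (mat_kernel (rep_rep_class (rep_of_partition \<mu> :: 'k rep_class))) = CARD('k) ^ size \<mu>"
    using card_kernel_similar[OF rep_rep_class_of_partition[of \<mu>, where ?'k = 'k]]
    by (metis mset_sorted_list_of_multiset size_mset)
qed

lemma card_kernel_num_blocks:
  fixes M :: "'k::{field,finite} rep_class"
  shows "card (mat_kernel (rep_rep_class M)) = CARD('k) ^ num_blocks M"
proof -
  obtain \<mu> where \<mu>: "\<mu> \<in> partitions_of (rep_dim M)" "M = rep_of_partition \<mu>" by (rule rep_class_cases)
  then have "0 \<notin> set (sorted_list_of_multiset \<mu>)" by (simp add: partitions_of_def)
  from card_kernel_nilpotent_jordan[OF this, where ?'k = 'k]
  have "card (mat_kernel (rep_rep_class M)) = CARD('k) ^ length (sorted_list_of_multiset \<mu>)"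
    using card_kernel_similar[OF rep_rep_class_of_partition[of \<mu>, where ?'k = 'k]] \<mu>(2) by simp
  then show ?thesis using num_blocks_eqI by metis
qed

abbreviation indec_class :: "nat \<Rightarrow> 'k::field rep_class" where
  "indec_class j \<equiv> rep_of_partition {#j#}"

lemma indec_class_eq: "(indec_class j :: 'k::field rep_class) = abs_rep_class (jordan_block j 0)"
proof -
  have "nilpotent_jordan [j] = jordan_block j (0 :: 'k)"
    by (intro eq_matI) (auto simp: jordan_matrix_def)
  then show ?thesis unfolding abs_rep_class_nilpotent_jordan by simp
qed

lemma nilpotent_jordan_block: "nilpotent_mat (jordan_block j (0 :: 'a::field))"
  by (auto simp: nilpotent_mat_def jordan_block_zero_pow intro!: exI[of _ j] eq_matI)

lemma num_blocks_eq_1_iff: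
  fixes R :: "'k::{field,finite} rep_class"
  assumes "rep_dim R > 0"
  shows "num_blocks R \<ge> 1" and "num_blocks R = 1 \<longleftrightarrow> R = indec_class (rep_dim R)"
proof -
  obtain \<mu> where \<mu>: "0 \<notin># \<mu>" "\<Sum>\<^sub># \<mu> = rep_dim R" "R = rep_of_partition \<mu>"
    using rep_class_cases[of R] unfolding partitions_of_def by blast
  have l: "num_blocks R = size \<mu>" using num_blocks_rep_of_partition[OF \<mu>(1)] \<mu>(3) by simp
  have "\<mu> \<noteq> {#}" using \<mu>(2) assms by auto
  then show "num_blocks R \<ge> 1" using l by (cases \<mu>) auto
  show "num_blocks R = 1 \<longleftrightarrow> R = indec_class (rep_dim R)"
  proof
    assume "num_blocks R = 1"
    then obtain j where "\<mu> = {#j#}" using l size_1_singleton_mset by metis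
    then show "R = indec_class (rep_dim R)" using \<mu> by simp
  next
    assume R: "R = indec_class (rep_dim R)"
    have "0 \<notin># {#rep_dim R#}" using assms by simp
    from num_blocks_rep_of_partition[OF this, where ?'k = 'k] show "num_blocks R = 1" using R by simp
  qed
qed

lemma num_ses_indec:
  fixes N R :: "'k::{field,finite} rep_class"
  shows "num_ses (indec_class j) N R = card (short_exact_seqs (jordan_block j 0) (rep_rep_class N) (rep_rep_class R))"
proof -
  have refl: "nilpotent_mat A \<and> nilpotent_mat A \<and> rep_iso A A \<noteq> {}" if "nilpotent_mat A" for A :: "'k mat"
    using rep_iso_refl[OF nilpotent_mat_square[OF that]] that by blast
  show ?thesis
    using num_ses.abs_eq[OF refl[OF nilpotent_jordan_block] refl refl, of "rep_rep_class N" "rep_rep_class R" j]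
    by (simp add: indec_class_eq rep_rep_class_nilpotent)
qed

text \<open>
  An automorphism of a Jordan block is a surjective endomorphism, hence given by a vector of maximal
  height.
\<close>

lemma num_aut_indec:
  "of_nat (num_aut (indec_class (Suc j) :: 'k::{field,finite} rep_class)) =
    (of_nat CARD('k) ^ Suc j - of_nat CARD('k) ^ j :: rat)"
proof -
  let ?J = "jordan_block (Suc j) (0 :: 'k)"
  have J: "?J \<in> carrier_mat (Suc j) (Suc j)" by simp
  have "nilpotent_mat ?J \<and> nilpotent_mat ?J \<and> rep_iso ?J ?J \<noteq> {}"
    using nilpotent_jordan_block rep_iso_refl[OF nilpotent_mat_square[OF nilpotent_jordan_block]] by blast
  then have "num_aut (indec_class (Suc j) :: 'k rep_class) = card (rep_iso ?J ?J)"
    unfolding indec_class_eq by (rule num_aut.abs_eq)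
  also have "rep_iso ?J ?J = surj_homs ?J ?J"
  proof (intro subset_antisym subsetI)
    fix X assume X: "X \<in> rep_iso ?J ?J"
    obtain Y where "X \<in> carrier_mat (Suc j) (Suc j)" "Y \<in> carrier_mat (Suc j) (Suc j)" "X * Y = 1\<^sub>m (Suc j)"
      by (rule rep_iso_carrierE[OF X J J])
    then show "X \<in> surj_homs ?J ?J" using X surj_matI_right_inverse by (auto simp: surj_homs_def rep_iso_def)
  next
    fix X assume "X \<in> surj_homs ?J ?J"
    then have X: "X \<in> carrier_mat (Suc j) (Suc j)" "X * ?J = ?J * X" "surj_mat X" using surj_homs_iff[OF J J] by blast+
    obtain L where "L \<in> carrier_mat (Suc j) (Suc j)" "L * X = 1\<^sub>m (Suc j)" "X * L = 1\<^sub>m (Suc j)"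
      by (rule surj_mat_square[OF X(1,3)])
    then show "X \<in> rep_iso ?J ?J" using rep_isoI[OF J J X(1)] X(2) by blast
  qed
  also have "card (surj_homs ?J ?J) = card {v \<in> carrier_vec (Suc j). height ?J\<^sup>T v = Suc j}"
    by (rule bij_betw_same_card[OF bij_betw_surj_to_jordan_block[OF J nilpotent_jordan_block], symmetric])
  also have "\<dots> = card (mat_kernel (?J\<^sup>T ^\<^sub>m Suc j)) - card (mat_kernel (?J\<^sup>T ^\<^sub>m j))"
    by (rule card_height_Suc[OF _ nilpotent_transpose[OF J nilpotent_jordan_block]]) simp
  also have "\<dots> = CARD('k) ^ Suc j - CARD('k) ^ j"
    unfolding card_kernel_pow_similar[OF similar_jordan_block_transpose, symmetric]
    by (simp add: card_kernel_jordan_block_pow del: power_Suc pow_mat.simps)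
  finally show ?thesis
    using card_field_gt_1[where ?'k = 'k] by (simp add: of_nat_diff power_increasing)
qed

lemma sum_hall_coeff_indec:
  fixes R :: "'k::{field,finite} rep_class" and y :: "'k rep_class \<Rightarrow> rat"
  defines "B \<equiv> (rep_rep_class R)\<^sup>T"
  shows "(\<Sum>N | rep_dim N \<le> rep_dim R. y N * hall_coeff (indec_class (Suc j)) N R) =
    (\<Sum>v\<in>{v \<in> carrier_vec (rep_dim R). height B v = Suc j}.
       y (kernel_class (jordan_block (Suc j) 0) (rep_rep_class R) (krylov_mat B (Suc j) v))) /
    (of_nat CARD('k) ^ Suc j - of_nat CARD('k) ^ j)"
proof -
  let ?J = "jordan_block (Suc j) (0 :: 'k)" and ?R = "rep_rep_class R" and ?D = "{N :: 'k rep_class. rep_dim N \<le> rep_dim R}"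
  have J: "?J \<in> carrier_mat (Suc j) (Suc j)" by simp
  note R = rep_rep_class_nilpotent[of R]
  have "(\<Sum>N\<in>?D. y N * hall_coeff (indec_class (Suc j)) N R) =
      (\<Sum>N\<in>?D. y N * of_nat (card (short_exact_seqs ?J (rep_rep_class N) ?R)) / of_nat (num_aut N)) /
      of_nat (num_aut (indec_class (Suc j) :: 'k rep_class))"
    unfolding sum_divide_distrib by (intro sum.cong) (auto simp: hall_coeff_def num_ses_indec field_simps)
  also have "(\<Sum>N\<in>?D. y N * of_nat (card (short_exact_seqs ?J (rep_rep_class N) ?R)) / of_nat (num_aut N)) =
      (\<Sum>\<psi>\<in>surj_homs ?R ?J. y (kernel_class ?J ?R \<psi>))"
    by (rule sum_over_kernels[OF R J])
  also have "\<dots> = (\<Sum>v\<in>{v \<in> carrier_vec (rep_dim R). height B v = Suc j}. y (kernel_class ?J ?R (krylov_mat B (Suc j) v)))"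
    unfolding B_def by (rule sum.reindex_bij_betw[OF bij_betw_surj_to_jordan_block[OF R], symmetric])
  finally show ?thesis unfolding num_aut_indec .
qed

text \<open>
  The kernel of the surjection keeps the number of blocks exactly when \<open>v\<close> vanishes on \<open>ker R\<close>, which by the
  Fredholm alternative means that \<open>v\<close> is in the image of the transpose.
\<close>

lemma kernel_class_krylov:
  fixes R :: "'k::{field,finite} rep_class"
  defines "B \<equiv> (rep_rep_class R)\<^sup>T" and "n \<equiv> rep_dim R"
  assumes v: "v \<in> carrier_vec n" and h: "height B v = Suc j"
  defines "K \<equiv> kernel_class (jordan_block (Suc j) 0) (rep_rep_class R) (krylov_mat B (Suc j) v)"
  shows "rep_dim K + Suc j = n"
    and "num_blocks K = (if v \<in> (\<lambda>u. B *\<^sub>v u) ` carrier_vec n then num_blocks R else num_blocks R - 1)"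
proof -
  let ?J = "jordan_block (Suc j) (0 :: 'k)" and ?R = "rep_rep_class R" and ?\<psi> = "krylov_mat B (Suc j) v"
  have J: "?J \<in> carrier_mat (Suc j) (Suc j)" by simp
  have R: "?R \<in> carrier_mat n n" "nilpotent_mat ?R" unfolding n_def by (rule rep_rep_class_nilpotent)+
  have Bc: "B \<in> carrier_mat n n" unfolding B_def using R by simp
  have \<psi>: "?\<psi> \<in> surj_homs ?R ?J"
    using bij_betw_apply[OF bij_betw_surj_to_jordan_block[OF R]] v h unfolding B_def by blast
  obtain i where i: "(i, ?\<psi>) \<in> short_exact_seqs ?J (rep_rep_class K) ?R"
    unfolding K_def by (rule kernel_classE[OF R J \<psi>])
  show dim: "rep_dim K + Suc j = n" using ses_dim[OF i J rep_rep_class_nilpotent(1) R(1)] by simp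
  have row0: "row ?\<psi> 0 = v" using row_krylov_mat[OF Bc v, of 0 "Suc j"] Bc v by simp
  have ck: "card (mat_kernel (rep_rep_class K)) = card {w \<in> mat_kernel ?R. v \<bullet> w = 0}"
    using card_socle_of_kernel[OF R(1) rep_rep_class_nilpotent(1) i] unfolding row0 .
  have iff: "v \<in> (\<lambda>u. B *\<^sub>v u) ` carrier_vec n \<longleftrightarrow> (\<forall>w\<in>mat_kernel ?R. v \<bullet> w = 0)"
    unfolding B_def by (rule range_transpose_iff[OF R(1) v])
  show "num_blocks K = (if v \<in> (\<lambda>u. B *\<^sub>v u) ` carrier_vec n then num_blocks R else num_blocks R - 1)"
  proof (cases "\<forall>w\<in>mat_kernel ?R. v \<bullet> w = 0")
    case True
    then have "{w \<in> mat_kernel ?R. v \<bullet> w = 0} = mat_kernel ?R" by blast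
    then have "num_blocks K = num_blocks R" using ck card_kernel_num_blocks[of R] by (intro num_blocks_eqI) simp
    then show ?thesis using iff True by simp
  next
    case False
    then have *: "CARD('k) * card {w \<in> mat_kernel ?R. v \<bullet> w = 0} = CARD('k) ^ num_blocks R"
      using card_kernel_hyperplane[OF R(1) v] card_kernel_num_blocks[of R] by simp
    have "n > 0" using dim by simp
    then obtain l where l: "num_blocks R = Suc l"
      using num_blocks_eq_1_iff(1)[of R] unfolding n_def by (cases "num_blocks R") auto
    have "card {w \<in> mat_kernel ?R. v \<bullet> w = 0} = CARD('k) ^ l"
      using * card_field_gt_1[where ?'k = 'k] unfolding l by simp
    then have "num_blocks K = l" using ck by (intro num_blocks_eqI) simp
    then show ?thesis using iff False l by simp
  qed
qed

section \<open>The recursion for the coefficients of the power sums\<close>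

text \<open>
  Let the Hall algebra be identified with the ring of symmetric functions in such a way that \<open>I\<^sub>r\<close>
  corresponds to the Hall-Littlewood function \<open>P\<^sub>r(x; 1/q)\<close>. Then this is the coefficient of \<open>M\<close> in
  \<open>1 - q\<^bsup>-n\<^esup>\<close> times the power sum of degree \<open>n = dim M\<close>.
\<close>

definition power_sum_coeff :: "'k::{field,finite} rep_class \<Rightarrow> rat" where
  "power_sum_coeff M = (1 - 1 / of_nat CARD('k) ^ rep_dim M) * (\<Prod>i=1..<num_blocks M. 1 - of_nat CARD('k) ^ i)"

text \<open>
  Let \<open>B\<close> be the transpose of \<open>R\<close>, \<open>V\<close> the space on which it acts and \<open>l\<close> the number of blocks of \<open>R\<close>. Let
  \<open>t(v) = q\<^bsup>-ht v\<^esup> - q\<^bsup>-n\<^esup>\<close> and \<open>c\<^sub>k = \<Prod>\<^bsub>0<i<k\<^esub> (1 - q\<^sup>i)\<close>. The left side is the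
  sum over \<open>v \<in> V\<close> of \<open>t(v) c\<^sub>l\<close> or \<open>t(v) c\<^bsub>l-1\<^esub>\<close>, according to whether \<open>v\<close> is in the image of \<open>B\<close> or not; the
  term \<open>v = 0\<close> is the coefficient of \<open>R\<close> itself. Summing \<open>t(B v)\<close> over \<open>V\<close> in two ways shows that
  \<open>q\<^bsup>l-1\<^esup>\<close> times the sum of \<open>t\<close> over the image is the sum of \<open>t\<close> over \<open>V\<close>, and for \<open>l \<ge> 2\<close> everything cancels
  because \<open>c\<^sub>l = c\<^bsub>l-1\<^esub> (1 - q\<^bsup>l-1\<^esup>)\<close>. For \<open>l = 1\<close> both weights are \<open>1\<close>, and the \<open>q\<^sup>j - q\<^bsup>j-1\<^esup>\<close> vectors of height \<open>j\<close> in
  a single Jordan block contribute \<open>1 - 1/q\<close> for each \<open>j \<le> n\<close>.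
\<close>

lemma power_sum_coeff_recursion:
  fixes R :: "'k::{field,finite} rep_class" and q :: rat
  assumes q: "q = of_nat CARD('k)" and n: "n = rep_dim R" "n \<ge> 1"
  shows "power_sum_coeff R + (\<Sum>j=1..<n. (1 - 1 / q) *
      (\<Sum>N | rep_dim N \<le> rep_dim R. power_sum_coeff N * hall_coeff (indec_class j) N R)) =
    (if R = indec_class n then of_nat n * (1 - 1 / q) else 0)"
proof -
  define B where "B = (rep_rep_class R)\<^sup>T"
  define l where "l = num_blocks R"
  define V where "V = (carrier_vec n :: 'k vec set)"
  define im where "im = (\<lambda>u. B *\<^sub>v u) ` carrier_vec n"
  define t where "t v = 1 / q ^ height B v - 1 / q ^ n" for v
  define c where "c k = (\<Prod>i=1..<k. 1 - q ^ i)" for k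
  define c' where "c' v = (if v \<in> im then c l else c (l - 1))" for v
  have q1: "q > 1" using card_field_gt_1[where ?'k = 'k] q by simp
  have Rr: "rep_rep_class R \<in> carrier_mat n n" "nilpotent_mat (rep_rep_class R)"
    unfolding n(1) by (rule rep_rep_class_nilpotent)+
  have B: "B \<in> carrier_mat n n" "nilpotent_mat B" unfolding B_def using Rr nilpotent_transpose[OF Rr] by simp_all
  have finV: "finite V" unfolding V_def by (rule finite_carrier_vec)
  have cardV: "of_nat (card V) = q ^ n" unfolding V_def card_carrier_vec q by simp
  have imV: "im \<subseteq> V" unfolding im_def V_def using B by auto
  have l1: "l \<ge> 1" unfolding l_def using num_blocks_eq_1_iff(1)[of R] n by simp
  have zero: "0\<^sub>v n \<in> im" unfolding im_def using mat_zero_vec[OF B(1)] by (intro image_eqI[of _ _ "0\<^sub>v n"]) auto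
  have h0: "{v \<in> V. height B v = 0} = {0\<^sub>v n}" unfolding V_def using height_eq_0_iff[OF B] by auto
  have hle: "height B v \<le> n" if "v \<in> V" for v using height_le_dim[OF B] that unfolding V_def by blast
  have by_height: "(\<Sum>v\<in>V. f v) = (\<Sum>j\<le>n. \<Sum>v\<in>{v \<in> V. height B v = j}. f v)" for f :: "'k vec \<Rightarrow> rat"
    by (rule sum.group[symmetric, OF finV]) (use hle in auto)
  have psc: "power_sum_coeff K = (1 - 1 / q ^ rep_dim K) * c (num_blocks K)" for K :: "'k rep_class"
    unfolding power_sum_coeff_def c_def q ..
  have levels: "(1 - 1 / q) * (\<Sum>N | rep_dim N \<le> rep_dim R. power_sum_coeff N * hall_coeff (indec_class j) N R) =
      (\<Sum>v\<in>{v \<in> V. height B v = j}. t v * c' v)" if j: "j \<in> {1..<n}" for j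
  proof -
    obtain i where i: "j = Suc i" using j by (cases j) auto
    let ?K = "\<lambda>v. kernel_class (jordan_block (Suc i) 0) (rep_rep_class R) (krylov_mat B (Suc i) v)"
    have K: "power_sum_coeff (?K v) = (1 - q ^ Suc i / q ^ n) * c' v" if v: "v \<in> V" "height B v = Suc i" for v
    proof -
      have v': "v \<in> carrier_vec (rep_dim R)" using v(1) unfolding V_def n(1) .
      note k = kernel_class_krylov[of v R i, folded B_def n(1), OF v'[folded n(1)] v(2)]
      have "q ^ n = q ^ rep_dim (?K v) * q ^ Suc i" using k(1) by (metis power_add)
      then have "1 / q ^ rep_dim (?K v) = q ^ Suc i / q ^ n" using q1 by (simp add: field_simps)
      moreover have "c (num_blocks (?K v)) = c' v" unfolding k(2) c'_def im_def l_def by simp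
      ultimately show ?thesis unfolding psc by simp
    qed
    have "(1 - 1 / q) * (\<Sum>N | rep_dim N \<le> rep_dim R. power_sum_coeff N * hall_coeff (indec_class j) N R) =
        (1 - 1 / q) / (q ^ Suc i - q ^ i) * (\<Sum>v\<in>{v \<in> V. height B v = Suc i}. power_sum_coeff (?K v))"
      unfolding i n(1)[symmetric] sum_hall_coeff_indec[of power_sum_coeff i R, folded B_def n(1) V_def q]
      by simp
    also have "(1 - 1 / q) / (q ^ Suc i - q ^ i) = 1 / q ^ Suc i"
      using q1 by (simp add: field_simps)
    also have "1 / q ^ Suc i * (\<Sum>v\<in>{v \<in> V. height B v = Suc i}. power_sum_coeff (?K v)) =
        (\<Sum>v\<in>{v \<in> V. height B v = Suc i}. t v * c' v)"
      unfolding sum_distrib_left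
    proof (intro sum.cong refl)
      fix v assume "v \<in> {v \<in> V. height B v = Suc i}"
      then have v: "v \<in> V" "height B v = Suc i" by auto
      have "1 / q ^ Suc i * (1 - q ^ Suc i / q ^ n) = t v"
        unfolding t_def v(2) using q1 by (simp add: field_simps)
      then show "1 / q ^ Suc i * power_sum_coeff (?K v) = t v * c' v"
        unfolding K[OF v] by (simp add: mult.assoc[symmetric])
    qed
    finally show ?thesis unfolding i .
  qed
  have top: "power_sum_coeff R = (\<Sum>v\<in>{v \<in> V. height B v = 0}. t v * c' v)"
  proof -
    have "height B (0\<^sub>v n) = 0" using height_eq_0_iff[OF B] by simp
    then show ?thesis unfolding h0 using zero by (simp add: psc t_def c'_def l_def n(1))
  qed
  have "power_sum_coeff R + (\<Sum>j=1..<n. (1 - 1 / q) *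
      (\<Sum>N | rep_dim N \<le> rep_dim R. power_sum_coeff N * hall_coeff (indec_class j) N R)) =
      (\<Sum>v\<in>V. t v * c' v)"
  proof -
    have "{..n} = insert 0 (insert n {1..<n})" using n(2) by auto
    then have "(\<Sum>v\<in>V. t v * c' v) = (\<Sum>v\<in>{v \<in> V. height B v = 0}. t v * c' v) +
        ((\<Sum>v\<in>{v \<in> V. height B v = n}. t v * c' v) + (\<Sum>j=1..<n. \<Sum>v\<in>{v \<in> V. height B v = j}. t v * c' v))"
      unfolding by_height using n(2) by simp
    \<comment> \<open>Vectors of height \<open>n\<close>, which belong to the zero kernel, have weight \<open>0\<close>.\<close>
    also have "(\<Sum>v\<in>{v \<in> V. height B v = n}. t v * c' v) = 0"
      by (intro sum.neutral) (auto simp: t_def)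
    finally show ?thesis using levels top by simp
  qed
  also have "\<dots> = c (l - 1) * (\<Sum>v\<in>V. t v) + (c l - c (l - 1)) * (\<Sum>v\<in>im. t v)"
  proof -
    have "(\<Sum>v\<in>V. t v * c' v) = (\<Sum>v\<in>V. c (l - 1) * t v + (if v \<in> im then (c l - c (l - 1)) * t v else 0))"
      by (intro sum.cong) (auto simp: c'_def algebra_simps)
    also have "\<dots> = c (l - 1) * (\<Sum>v\<in>V. t v) + (\<Sum>v\<in>V. if v \<in> im then (c l - c (l - 1)) * t v else 0)"
      by (simp add: sum.distrib sum_distrib_left)
    also have "(\<Sum>v\<in>V. if v \<in> im then (c l - c (l - 1)) * t v else 0) = (\<Sum>v\<in>im. (c l - c (l - 1)) * t v)"
      using sum.inter_restrict[OF finV, of "\<lambda>v. (c l - c (l - 1)) * t v" im] imV by (simp add: Int_absorb1)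
    finally show ?thesis by (simp add: sum_distrib_left)
  qed
  also have "\<dots> = (if R = indec_class n then of_nat n * (1 - 1 / q) else 0)"
  proof (cases "l = 1")
    case True
    have R: "R = indec_class n" using num_blocks_eq_1_iff(2)[of R] True n unfolding l_def by simp
    have sim: "similar_mat (jordan_block n 0) B"
    proof -
      have "abs_rep_class (jordan_block n 0) = abs_rep_class (rep_rep_class R)"
        using R indec_class_eq[of n, where ?'k = 'k] by simp
      then have "rep_iso (jordan_block n 0) (rep_rep_class R) \<noteq> {}"
        using abs_rep_class_eq_iff[OF nilpotent_jordan_block Rr(2)] by blast
      then have "similar_mat (jordan_block n 0) (rep_rep_class R)"
        using rep_iso_similar_mat nilpotent_mat_square nilpotent_jordan_block Rr(2) by blast
      then show ?thesis unfolding B_def using similar_mat_trans nilpotent_similar_transpose[OF Rr] by blast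
    qed
    have level: "(\<Sum>v\<in>{v \<in> V. height B v = Suc j}. 1 / q ^ height B v) = 1 - 1 / q" if "Suc j \<le> n" for j
    proof -
      have "card {v \<in> V. height B v = Suc j} = CARD('k) ^ Suc j - CARD('k) ^ j"
        unfolding V_def card_height_Suc[OF B] card_kernel_pow_similar[OF sim, symmetric]
        using that by (simp add: card_kernel_jordan_block_pow del: power_Suc pow_mat.simps)
      then have "of_nat (card {v \<in> V. height B v = Suc j}) = q ^ Suc j - q ^ j"
        using card_field_gt_1[where ?'k = 'k] by (simp add: of_nat_diff power_increasing q)
      moreover have "(\<Sum>v\<in>{v \<in> V. height B v = Suc j}. 1 / q ^ height B v) =
          of_nat (card {v \<in> V. height B v = Suc j}) / q ^ Suc j" by simp
      ultimately show ?thesis using q1 by (simp add: field_simps)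
    qed
    have "(\<Sum>v\<in>V. 1 / q ^ height B v) = (\<Sum>j\<le>n. \<Sum>v\<in>{v \<in> V. height B v = j}. 1 / q ^ height B v)"
      by (rule by_height)
    also have "\<dots> = (\<Sum>v\<in>{v \<in> V. height B v = 0}. 1 / q ^ height B v) +
        (\<Sum>j=1..n. \<Sum>v\<in>{v \<in> V. height B v = j}. 1 / q ^ height B v)"
      by (simp only: atMost_atLeast0 sum.atLeast_Suc_atMost[of 0 n] le0 One_nat_def)
    also have "(\<Sum>j=1..n. \<Sum>v\<in>{v \<in> V. height B v = j}. 1 / q ^ height B v) = (\<Sum>j=1..n. 1 - 1 / q)"
    proof (intro sum.cong refl)
      fix j assume "j \<in> {1..n}"
      then show "(\<Sum>v\<in>{v \<in> V. height B v = j}. 1 / q ^ height B v) = 1 - 1 / q"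
        using level[of "j - 1"] by simp
    qed
    also have "(\<Sum>v\<in>{v \<in> V. height B v = 0}. 1 / q ^ height B v) = 1"
      unfolding h0 using height_eq_0_iff[OF B, of "0\<^sub>v n"] by simp
    finally have "(\<Sum>v\<in>V. t v) = of_nat n * (1 - 1 / q)"
      using cardV q1 by (simp add: t_def sum_subtractf)
    then show ?thesis using True R by (simp add: c_def)
  next
    case False
    with l1 obtain k where k: "l = Suc (Suc k)" by (metis One_nat_def Suc_le_D not0_implies_Suc nat.inject)
    have "R \<noteq> indec_class n" using num_blocks_eq_1_iff(2)[of R] False n unfolding l_def by simp
    have kerB: "of_nat (card (mat_kernel B)) = q ^ l"
      using card_kernel_similar[OF nilpotent_similar_transpose[OF Rr]] card_kernel_num_blocks[of R]
      by (simp add: B_def l_def q)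
    have fib: "(\<Sum>v\<in>V. f (B *\<^sub>v v)) = q ^ l * (\<Sum>w\<in>im. f w)" for f :: "'k vec \<Rightarrow> rat"
      unfolding V_def im_def kerB[symmetric] by (rule sum_mult_mat_vec[OF B(1)])
    have "q ^ l * (\<Sum>w\<in>im. t w) = (\<Sum>v\<in>V. t (B *\<^sub>v v))" by (rule fib[symmetric])
    \<comment> \<open>The last summand corrects for the vector \<open>0\<close>, whose height does not drop. Summed over \<open>V\<close>, it
      cancels the constant \<open>(q - 1) / q ^ n\<close>.\<close>
    also have "\<dots> = (\<Sum>v\<in>V. q * t v + (q - 1) / q ^ n + (if v = 0\<^sub>v n then 1 - q else 0))"
    proof (intro sum.cong refl)
      fix v assume "v \<in> V"
      then have v: "v \<in> carrier_vec n" unfolding V_def .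
      show "t (B *\<^sub>v v) = q * t v + (q - 1) / q ^ n + (if v = 0\<^sub>v n then 1 - q else 0)"
      proof (cases "height B v")
        case 0
        then show ?thesis using height_mult_vec[OF B v] height_eq_0_iff[OF B v]
          by (simp add: t_def algebra_simps diff_divide_distrib)
      next
        case (Suc h)
        then have "v \<noteq> 0\<^sub>v n" using height_eq_0_iff[OF B v] by auto
        then show ?thesis using height_mult_vec[OF B v] Suc q1 by (simp add: t_def field_simps)
      qed
    qed
    also have "\<dots> = q * (\<Sum>v\<in>V. t v)"
    proof -
      have "0\<^sub>v n \<in> V" by (simp add: V_def)
      then show ?thesis using finV cardV q1 by (simp add: sum.distrib sum_distrib_left)
    qed
    finally have all: "(\<Sum>v\<in>V. t v) = q ^ (l - 1) * (\<Sum>w\<in>im. t w)" using q1 by (simp add: k)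
    have cl: "c l = c (l - 1) * (1 - q ^ (l - 1))" by (simp add: c_def k)
    have "c (l - 1) * (\<Sum>v\<in>V. t v) + (c l - c (l - 1)) * (\<Sum>v\<in>im. t v) = 0"
      unfolding all cl by (simp add: algebra_simps)
    then show ?thesis using \<open>R \<noteq> indec_class n\<close> by simp
  qed
  finally show ?thesis .
qed


section \<open>Products of indecomposables\<close>

text \<open>
  The product over a multiset of Jordan blocks, which is meaningful since the order of the factors is
  irrelevant, replaces the ordered product in the definition of the Hall numbers.
\<close>

interpretation hall_prod: comm_monoid_mset "(\<star>) :: 'k::{field,finite} hall \<Rightarrow> _" hall_one
proof
  fix a b c :: "'k hall"
  show "(a \<star> b) \<star> c = a \<star> (b \<star> c)" by (rule hall_mult_assoc)
  show "a \<star> b = b \<star> a" by (rule hall_mult_commute)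
  show "a \<star> hall_one = a" by (metis hall_mult_commute hall_mult_one_left)
qed

definition indec_prod :: "nat multiset \<Rightarrow> 'k::{field,finite} hall" where
  "indec_prod \<mu> = hall_prod.F (image_mset hall_indec \<mu>)"

lemma indec_prod_simps [simp]:
  "indec_prod {#} = hall_one"
  "indec_prod (add_mset r \<mu>) = hall_indec r \<star> indec_prod \<mu>"
  "indec_prod (\<mu> + \<nu>) = indec_prod \<mu> \<star> indec_prod \<nu>"
  by (simp_all add: indec_prod_def)

lemma hall_power_indec: "hall_power (hall_indec r) m = indec_prod (replicate_mset m r)"
  by (induction m) simp_all

lemma hall_prod_list_indec:
  "hall_prod_list (map (\<lambda>r. hall_power (hall_indec r) (m r)) rs) =
    indec_prod (\<Sum>r\<leftarrow>rs. replicate_mset (m r) r)"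
  by (induction rs) (simp_all add: hall_prod_list_def hall_power_indec)

lemma hall_number_eq_indec_prod:
  assumes "\<nu> \<in> partitions_of n"
  shows "hall_number TYPE('k::{field,finite}) n \<mu> \<nu> =
    Poly_Mapping.lookup (indec_prod \<nu> :: 'k hall) (rep_of_partition \<mu>)"
proof -
  have "(\<Sum>r\<leftarrow>[1..<Suc n]. replicate_mset (count \<nu> r) r) = \<nu>"
  proof (rule multiset_eqI)
    fix x
    have x: "x \<in> {1..<Suc n}" if "x \<in># \<nu>"
    proof -
      have "x \<noteq> 0" using assms that unfolding partitions_of_def by (metis (mono_tags) mem_Collect_eq)
      moreover have "x \<le> n" using assms that by (auto simp: partitions_of_def dest!: multi_member_split)
      ultimately show ?thesis by simp
    qed
    have "count (\<Sum>r\<leftarrow>rs. replicate_mset (count \<nu> r) r) x = (if x \<in> set rs then count \<nu> x else 0)"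
      if "distinct rs" for rs using that by (induction rs) auto
    from this[of "[1..<Suc n]"]
    have c: "count (\<Sum>r\<leftarrow>[1..<Suc n]. replicate_mset (count \<nu> r) r) x = (if x \<in> {1..<Suc n} then count \<nu> x else 0)"
      by (simp del: upt_Suc)
    show "count (\<Sum>r\<leftarrow>[1..<Suc n]. replicate_mset (count \<nu> r) r) x = count \<nu> x"
      unfolding c using x by (auto simp del: atLeastLessThan_iff simp: not_in_iff[symmetric])
  qed
  then show ?thesis unfolding hall_number_def hall_prod_list_indec by simp
qed

lemma lookup_indec_prod_add:
  fixes R :: "'k::{field,finite} rep_class"
  shows "Poly_Mapping.lookup (indec_prod (add_mset j \<mu>)) R =
    (\<Sum>N | rep_dim N \<le> rep_dim R. Poly_Mapping.lookup (indec_prod \<mu>) N * hall_coeff (indec_class j) N R)"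
  unfolding indec_prod_simps unfolding hall_indec_def by (rule lookup_single_hall_mult)

lemma lookup_indec_prod_single:
  "Poly_Mapping.lookup (indec_prod {#j#}) R = (if R = indec_class j then 1 else 0)"
  by (simp add: hall_prod.right_neutral hall_indec_def lookup_single when_def)

section \<open>Newton's identity\<close>

definition mult_fact :: "nat multiset \<Rightarrow> rat" where
  "mult_fact \<mu> = (\<Prod>i\<in>set_mset \<mu>. fact (count \<mu> i))"

lemma mult_fact_pos: "mult_fact \<mu> > 0"
  unfolding mult_fact_def by (intro prod_pos) auto

lemma mult_fact_add_mset: "mult_fact (add_mset j \<mu>) = of_nat (Suc (count \<mu> j)) * mult_fact \<mu>"
proof -
  have *: "mult_fact \<nu> = fact (count \<nu> j) * (\<Prod>i\<in>set_mset \<mu> - {j}. fact (count \<mu> i))"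
    if "set_mset \<nu> - {j} = set_mset \<mu> - {j}" "\<And>i. i \<noteq> j \<Longrightarrow> count \<nu> i = count \<mu> i" for \<nu>
  proof -
    have "mult_fact \<nu> = fact (count \<nu> j) * (\<Prod>i\<in>set_mset \<nu> - {j}. fact (count \<nu> i))"
    proof (cases "j \<in># \<nu>")
      case True
      then show ?thesis unfolding mult_fact_def by (simp add: prod.remove)
    next
      case False
      then show ?thesis unfolding mult_fact_def by (simp add: not_in_iff)
    qed
    also have "(\<Prod>i\<in>set_mset \<nu> - {j}. fact (count \<nu> i) :: rat) = (\<Prod>i\<in>set_mset \<mu> - {j}. fact (count \<mu> i))"
      using that by (intro prod.cong) auto
    finally show ?thesis .
  qed
  show ?thesis using *[of "add_mset j \<mu>"] *[of \<mu>] by (simp add: mult_ac)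
qed

text \<open>
  The coefficient of the monomial \<open>\<mu>\<close> in \<open>n\<close> times the degree \<open>n\<close> part of \<open>log (1 + a x\<^sub>1 + a x\<^sub>2 + \<dots>)\<close>, for
  a partition \<open>\<mu>\<close> of \<open>n\<close>.
\<close>

definition newton_coeff :: "rat \<Rightarrow> nat multiset \<Rightarrow> rat" where
  "newton_coeff a \<mu> = of_nat (\<Sum>\<^sub># \<mu>) * (-1) ^ (size \<mu> + 1) * (fact (size \<mu> - 1) / mult_fact \<mu>) * a ^ size \<mu>"

lemma sum_count_mult: "(\<Sum>j\<in>set_mset \<mu>. count \<mu> j * f j) = \<Sum>\<^sub># (image_mset f \<mu>)" for f :: "nat \<Rightarrow> nat"
proof (induction \<mu>)
  case (add x \<mu>)
  have "(\<Sum>j\<in>set_mset (add_mset x \<mu>). count (add_mset x \<mu>) j * f j) =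
      (\<Sum>j\<in>insert x (set_mset \<mu>). count \<mu> j * f j) + (\<Sum>j\<in>insert x (set_mset \<mu>). if j = x then f j else 0)"
    unfolding sum.distrib[symmetric] by (intro sum.cong) auto
  also have "(\<Sum>j\<in>insert x (set_mset \<mu>). count \<mu> j * f j) = (\<Sum>j\<in>set_mset \<mu>. count \<mu> j * f j)"
    by (intro sum.mono_neutral_right) (auto simp: not_in_iff)
  finally show ?case using add by simp
qed simp

text \<open>
  Removing a part \<open>j\<close> changes the reciprocal product of factorials by the factor \<open>m\<^sub>j\<close>, the multiplicity
  of \<open>j\<close>, so the claim comes down to \<open>\<Sum>\<^sub>j m\<^sub>j (n - j) = n l - n = n (l - 1)\<close>.
\<close>

lemma newton_coeff_recursion:
  assumes "\<mu> \<in> partitions_of n" and "size \<mu> \<ge> 2"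
  shows "newton_coeff a \<mu> + (\<Sum>j\<in>set_mset \<mu>. a * newton_coeff a (\<mu> - {#j#})) = 0"
proof -
  have n: "\<Sum>\<^sub># \<mu> = n" using assms(1) by (simp add: partitions_of_def)
  have "size \<mu> = Suc (Suc (size \<mu> - 2))" using assms(2) by simp
  then obtain l where l: "size \<mu> = Suc (Suc l)" by blast
  let ?c = "(-1) ^ l * (fact l / mult_fact \<mu>) * a ^ Suc (Suc l)"
  have "a * newton_coeff a (\<mu> - {#j#}) = of_nat (count \<mu> j) * of_nat (n - j) * ?c" if "j \<in># \<mu>" for j
  proof -
    from multi_member_split[OF that] obtain \<nu> where \<nu>: "\<mu> = add_mset j \<nu>" by blast
    have sn: "\<Sum>\<^sub># \<nu> = n - j" "size \<nu> = Suc l" "\<mu> - {#j#} = \<nu>" using n l \<nu> by auto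
    have w: "1 / mult_fact \<nu> = of_nat (count \<mu> j) / mult_fact \<mu>"
      using mult_fact_pos[of \<nu>] unfolding \<nu> mult_fact_add_mset by (simp del: of_nat_Suc)
    have "a * newton_coeff a (\<mu> - {#j#}) = of_nat (n - j) * ((-1) ^ l * (fact l * (1 / mult_fact \<nu>)) * a ^ Suc (Suc l))"
      unfolding newton_coeff_def sn by simp
    then show ?thesis unfolding w by simp
  qed
  then have "(\<Sum>j\<in>set_mset \<mu>. a * newton_coeff a (\<mu> - {#j#})) = (\<Sum>j\<in>set_mset \<mu>. of_nat (count \<mu> j) * of_nat (n - j) * ?c)"
    by (intro sum.cong refl)
  also have "\<dots> = of_nat (\<Sum>j\<in>set_mset \<mu>. count \<mu> j * (n - j)) * ?c"
    unfolding of_nat_sum of_nat_mult sum_distrib_right ..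
  also have "(\<Sum>j\<in>set_mset \<mu>. count \<mu> j * (n - j)) = n * Suc l"
  proof -
    have "(\<Sum>j\<in>set_mset \<mu>. count \<mu> j * (n - j)) + (\<Sum>j\<in>set_mset \<mu>. count \<mu> j * j) = (\<Sum>j\<in>set_mset \<mu>. count \<mu> j * n)"
      unfolding sum.distrib[symmetric]
    proof (intro sum.cong refl)
      fix j assume "j \<in># \<mu>"
      then have "j \<le> n" using n by (auto dest!: multi_member_split)
      then show "count \<mu> j * (n - j) + count \<mu> j * j = count \<mu> j * n" by (simp add: distrib_left[symmetric])
    qed
    then show ?thesis using n l sum_count_mult[of \<mu> "\<lambda>j. j"] sum_count_mult[of \<mu> "\<lambda>_. n"] by simp
  qed
  finally show ?thesis unfolding newton_coeff_def n l of_nat_mult by simp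
qed

definition newton_sum :: "rat \<Rightarrow> nat \<Rightarrow> 'k::{field,finite} rep_class \<Rightarrow> rat" where
  "newton_sum a n R = (\<Sum>\<mu>\<in>partitions_of n. newton_coeff a \<mu> * Poly_Mapping.lookup (indec_prod \<mu>) R)"

text \<open>
  Newton's identity \<open>n q\<^sub>n = p\<^sub>n + \<Sum>\<^bsub>0<j<n\<^esub> q\<^sub>j p\<^bsub>n-j\<^esub>\<close> for \<open>q\<^sub>j = a I\<^sub>j\<close>, compared monomial by monomial: a monomial of length at least \<open>2\<close> arises
  from \<open>q\<^sub>j p\<^bsub>n-j\<^esub>\<close> once for each of its distinct parts \<open>j\<close>, and these contributions
  cancel its coefficient in \<open>p\<^sub>n\<close>.
\<close>

lemma newton_sum_recursion:
  fixes R :: "'k::{field,finite} rep_class"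
  assumes n: "n \<ge> 1"
  shows "newton_sum a n R + (\<Sum>j=1..<n. a *
      (\<Sum>N | rep_dim N \<le> rep_dim R. newton_sum a (n - j) N * hall_coeff (indec_class j) N R)) =
    (if R = indec_class n then of_nat n * a else 0)"
proof -
  let ?f = "\<lambda>\<mu>. Poly_Mapping.lookup (indec_prod \<mu>) R"
  let ?P = "partitions_of n - {{#n#}}"
  have fin: "finite ?P" using finite_partitions_of by simp
  have inP: "{#n#} \<in> partitions_of n" using n by (simp add: partitions_of_def)
  have two: "size \<mu> \<ge> 2" if "\<mu> \<in> ?P" for \<mu>
  proof (rule ccontr)
    assume "\<not> size \<mu> \<ge> 2"
    then have "size \<mu> = 0 \<or> size \<mu> = 1" by linarith
    then have "\<mu> = {#} \<or> (\<exists>x. \<mu> = {#x#})" using size_1_singleton_mset by auto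
    then show False using that n by (auto simp: partitions_of_def)
  qed
  have levels: "a * (\<Sum>N | rep_dim N \<le> rep_dim R. newton_sum a (n - j) N * hall_coeff (indec_class j) N R) =
      (\<Sum>\<nu>\<in>partitions_of (n - j). a * newton_coeff a \<nu> * ?f (add_mset j \<nu>))" for j
  proof -
    have "(\<Sum>N | rep_dim N \<le> rep_dim R. newton_sum a (n - j) N * hall_coeff (indec_class j) N R) =
        (\<Sum>N | rep_dim N \<le> rep_dim R. \<Sum>\<nu>\<in>partitions_of (n - j).
          newton_coeff a \<nu> * (Poly_Mapping.lookup (indec_prod \<nu>) N * hall_coeff (indec_class j) N R))"
      by (simp add: newton_sum_def sum_distrib_right mult.assoc)
    also have "\<dots> = (\<Sum>\<nu>\<in>partitions_of (n - j). newton_coeff a \<nu> * ?f (add_mset j \<nu>))"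
      unfolding lookup_indec_prod_add by (subst sum.swap) (simp add: sum_distrib_left)
    finally show ?thesis by (simp add: sum_distrib_left mult.assoc)
  qed
  have "(\<Sum>j=1..<n. \<Sum>\<nu>\<in>partitions_of (n - j). a * newton_coeff a \<nu> * ?f (add_mset j \<nu>)) =
      (\<Sum>(j, \<nu>)\<in>(SIGMA j:{1..<n}. partitions_of (n - j)). a * newton_coeff a \<nu> * ?f (add_mset j \<nu>))"
    by (intro sum.Sigma) (auto simp: finite_partitions_of)
  also have "\<dots> = (\<Sum>(\<mu>, j)\<in>(SIGMA \<mu>:?P. set_mset \<mu>). a * newton_coeff a (\<mu> - {#j#}) * ?f \<mu>)"
  proof (rule sum.reindex_bij_witness[of _ "\<lambda>(\<mu>, j). (j, \<mu> - {#j#})" "\<lambda>(j, \<nu>). (add_mset j \<nu>, j)"])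
    fix x assume "x \<in> (SIGMA j:{1..<n}. partitions_of (n - j))"
    then obtain j \<nu> where x: "x = (j, \<nu>)" "1 \<le> j" "j < n" "\<nu> \<in> partitions_of (n - j)" by auto
    have "\<nu> \<noteq> {#}" using x by (auto simp: partitions_of_def)
    then show "(\<lambda>(j, \<nu>). (add_mset j \<nu>, j)) x \<in> (SIGMA \<mu>:?P. set_mset \<mu>)"
      using x by (auto simp: partitions_of_def)
  next
    fix y assume "y \<in> (SIGMA \<mu>:?P. set_mset \<mu>)"
    then obtain \<mu> j where y: "y = (\<mu>, j)" "\<mu> \<in> ?P" "j \<in># \<mu>" by auto
    from multi_member_split[OF y(3)] obtain \<nu> where \<nu>: "\<mu> = add_mset j \<nu>" by blast
    have "size \<nu> \<ge> 1" using two[OF y(2)] \<nu> by simp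
    then obtain k \<kappa> where \<kappa>: "\<nu> = add_mset k \<kappa>" by (cases \<nu>) auto
    have "0 \<notin># \<mu>" "\<Sum>\<^sub># \<mu> = n" using y(2) by (auto simp: partitions_of_def)
    then show "(\<lambda>(\<mu>, j). (j, \<mu> - {#j#})) y \<in> (SIGMA j:{1..<n}. partitions_of (n - j))"
      using y(1) \<nu> \<kappa> by (auto simp: partitions_of_def)
  qed auto
  also have "\<dots> = (\<Sum>\<mu>\<in>?P. \<Sum>j\<in>set_mset \<mu>. a * newton_coeff a (\<mu> - {#j#}) * ?f \<mu>)"
    by (intro sum.Sigma[symmetric]) (use fin in auto)
  also have "\<dots> = (\<Sum>\<mu>\<in>?P. - newton_coeff a \<mu> * ?f \<mu>)"
  proof (intro sum.cong refl)
    fix \<mu> assume \<mu>: "\<mu> \<in> ?P"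
    then have "(\<Sum>j\<in>set_mset \<mu>. a * newton_coeff a (\<mu> - {#j#})) = - newton_coeff a \<mu>"
      using newton_coeff_recursion[of \<mu> n a] two by (simp add: eq_neg_iff_add_eq_0 add.commute)
    then show "(\<Sum>j\<in>set_mset \<mu>. a * newton_coeff a (\<mu> - {#j#}) * ?f \<mu>) = - newton_coeff a \<mu> * ?f \<mu>"
      by (simp only: sum_distrib_right[symmetric])
  qed
  also have "\<dots> = newton_coeff a {#n#} * ?f {#n#} - newton_sum a n R"
    unfolding newton_sum_def sum.remove[OF finite_partitions_of inP] by (simp add: sum_negf)
  finally have "newton_sum a n R + (\<Sum>j=1..<n. a *
      (\<Sum>N | rep_dim N \<le> rep_dim R. newton_sum a (n - j) N * hall_coeff (indec_class j) N R)) =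
      newton_coeff a {#n#} * ?f {#n#}"
    unfolding levels by simp
  then show ?thesis unfolding lookup_indec_prod_single by (simp add: newton_coeff_def mult_fact_def)
qed

lemma newton_sum_eq_power_sum_coeff:
  fixes R :: "'k::{field,finite} rep_class"
  assumes "rep_dim R = n" "n \<ge> 1"
  shows "newton_sum (1 - 1 / of_nat CARD('k)) n R = power_sum_coeff R"
  using assms
proof (induction n arbitrary: R rule: less_induct)
  case (less n)
  let ?a = "1 - 1 / of_nat CARD('k) :: rat"
  have "(\<Sum>N | rep_dim N \<le> rep_dim R. newton_sum ?a (n - j) N * hall_coeff (indec_class j) N R) =
      (\<Sum>N | rep_dim N \<le> rep_dim R. power_sum_coeff N * hall_coeff (indec_class j) N R)"
    if j: "j \<in> {1..<n}" for j
  proof (intro sum.cong refl)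
    fix N :: "'k rep_class"
    show "newton_sum ?a (n - j) N * hall_coeff (indec_class j) N R = power_sum_coeff N * hall_coeff (indec_class j) N R"
    proof (cases "hall_coeff (indec_class j) N R = 0")
      case False
      have "rep_dim N = n - j"
        using hall_coeff_dim[OF False] less.prems(1) rep_dim_rep_of_partition[of "{#j#}", where ?'k = 'k] by simp
      moreover have "n - j < n" "n - j \<ge> 1" using j by auto
      ultimately have "newton_sum ?a (n - j) N = power_sum_coeff N" using less.IH by blast
      then show ?thesis by simp
    qed simp
  qed
  then have "(\<Sum>j=1..<n. ?a * (\<Sum>N | rep_dim N \<le> rep_dim R. newton_sum ?a (n - j) N * hall_coeff (indec_class j) N R)) =
      (\<Sum>j=1..<n. ?a * (\<Sum>N | rep_dim N \<le> rep_dim R. power_sum_coeff N * hall_coeff (indec_class j) N R))"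
    by (intro sum.cong) auto
  then show ?case
    using newton_sum_recursion[OF less.prems(2), of ?a R]
      power_sum_coeff_recursion[OF refl less.prems(1)[symmetric] less.prems(2)] by linarith
qed

theorem theorem7p2p1:
  fixes n :: nat and lam :: "nat multiset" and q :: rat
  assumes "n \<ge> 1"
    and "q = of_nat CARD('k::{field,finite})"
    and "lam \<in> partitions_of n"
  shows "(\<Prod>i=1..<size lam. 1 - q ^ i) =
    of_nat n / (1 - 1 / q ^ n) *
    (\<Sum>\<mu>\<in>partitions_of n.
      (-1) ^ (size \<mu> + 1) * (1 / of_nat (size \<mu>)) *
      (fact (size \<mu>) / (\<Prod>i=1..n. fact (count \<mu> i))) *
      (1 - 1 / q) ^ size \<mu> * hall_number TYPE('k) n lam \<mu>)"
proof -
  let ?R = "rep_of_partition lam :: 'k rep_class"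
  have lam: "0 \<notin># lam" "\<Sum>\<^sub># lam = n" using assms(3) by (simp_all add: partitions_of_def)
  have dim: "rep_dim ?R = n" using rep_dim_rep_of_partition[of lam] lam by simp
  have q: "q > 1" using card_field_gt_1[where ?'k = 'k] assms(2) by simp
  have "of_nat n * (\<Sum>\<mu>\<in>partitions_of n.
      (-1) ^ (size \<mu> + 1) * (1 / of_nat (size \<mu>)) *
      (fact (size \<mu>) / (\<Prod>i=1..n. fact (count \<mu> i))) *
      (1 - 1 / q) ^ size \<mu> * hall_number TYPE('k) n lam \<mu>) = newton_sum (1 - 1 / q) n ?R"
    unfolding newton_sum_def sum_distrib_left
  proof (intro sum.cong refl)
    fix \<mu> assume \<mu>: "\<mu> \<in> partitions_of n"
    then have \<mu>': "0 \<notin># \<mu>" "\<Sum>\<^sub># \<mu> = n" by (simp_all add: partitions_of_def)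
    have "\<mu> \<noteq> {#}" using \<mu>' assms(1) by auto
    then obtain l where l: "size \<mu> = Suc l" by (cases \<mu>) auto
    have "x \<in> {1..n}" if "x \<in># \<mu>" for x
    proof -
      have "x \<noteq> 0" using that \<mu>'(1) by metis
      moreover have "x \<le> n" using that \<mu>'(2) by (auto dest!: multi_member_split)
      ultimately show ?thesis by simp
    qed
    then have "(\<Prod>i=1..n. fact (count \<mu> i)) = mult_fact \<mu>"
      unfolding mult_fact_def by (intro prod.mono_neutral_right) (auto simp: not_in_iff)
    moreover have "1 / of_nat (size \<mu>) * fact (size \<mu>) = (fact (size \<mu> - 1) :: rat)"
      unfolding l by (simp add: field_simps)
    moreover have "N * (s * u * (F / w) * p * h) = N * s * (u * F / w) * p * h" for N s u F w p h :: rat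
      by simp
    ultimately show "of_nat n * ((-1) ^ (size \<mu> + 1) * (1 / of_nat (size \<mu>)) *
        (fact (size \<mu>) / (\<Prod>i=1..n. fact (count \<mu> i))) *
        (1 - 1 / q) ^ size \<mu> * hall_number TYPE('k) n lam \<mu>) =
        newton_coeff (1 - 1 / q) \<mu> * Poly_Mapping.lookup (indec_prod \<mu>) ?R"
      unfolding newton_coeff_def hall_number_eq_indec_prod[OF \<mu>] \<mu>'(2) by (simp only:)
  qed
  also have "\<dots> = (1 - 1 / q ^ n) * (\<Prod>i=1..<size lam. 1 - q ^ i)"
    using newton_sum_eq_power_sum_coeff[OF dim assms(1)] num_blocks_rep_of_partition[OF lam(1), where ?'k = 'k]
    by (simp add: power_sum_coeff_def dim assms(2))
  finally have eq: "of_nat n * (\<Sum>\<mu>\<in>partitions_of n.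
      (-1) ^ (size \<mu> + 1) * (1 / of_nat (size \<mu>)) *
      (fact (size \<mu>) / (\<Prod>i=1..n. fact (count \<mu> i))) *
      (1 - 1 / q) ^ size \<mu> * hall_number TYPE('k) n lam \<mu>) = (1 - 1 / q ^ n) * (\<Prod>i=1..<size lam. 1 - q ^ i)" .
  have "q ^ n > 1" using q assms(1) by (intro one_less_power) auto
  then have "1 - 1 / q ^ n \<noteq> 0" by simp
  then show ?thesis using eq by (simp only: times_divide_eq_left) simp
qed

end
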